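(* Let $T$ be a tree with edge lengths $\ell\colon E(T)\to\mathbb{R}_{>0}$ and let $\varphi(x)=x/\alpha-\beta$ with $\alpha\ge1$, $\beta\ge0$. An optimal solution of the problem WeakContraction on the instance $(T,\ell,\varphi)$ can be computed in time $O(n^5)$, where $n$ is the number of vertices of $T$.
   Context: For a graph $G=(V,E)$ with edge lengths $\ell\colon E\to\mathbb{R}_{>0}$ and $C\subseteq E$: $\ell_C$ equals $0$ on $C$ and $\ell$ elsewhere; $\mathrm{dist}_\ell$ is shortest-path distance. $C$ is a weak $\varphi$-contraction if the graph $(V,C)$ is disconnected and for all $u,v\in V$ either $\mathrm{dist}_{\ell_C}(u,v)=0$ or $\mathrm{dist}_{\ell_C}(u,v)\ge\varphi(\mathrm{dist}_\ell(u,v))$. The problem WeakContraction on $(G,\ell,\varphi)$ asks for a weak $\varphi$-contraction $C$ maximizing $\Phi(C)=m(G)-m(G/C)$, where $G/C$ is the simple graph obtained by contracting $C$, deleting loops and keeping one edge among parallel edges; on a tree $\Phi(C)=|C|$. *)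

theory Defs
  imports "HOL-Library.Landau_Symbols"
begin

section \<open>Graphs, distances and weak contractions\<close>

text \<open>Finite simple graphs: a vertex set together with a set of two-element sets of vertices.\<close>

definition simple_graph :: "'a set \<Rightarrow> 'a set set \<Rightarrow> bool" where
  "simple_graph V E \<longleftrightarrow> finite V \<and> (\<forall>e\<in>E. \<exists>u\<in>V. \<exists>v\<in>V. u \<noteq> v \<and> e = {u, v})"

definition path :: "'a set \<Rightarrow> 'a set set \<Rightarrow> 'a \<Rightarrow> 'a list \<Rightarrow> 'a \<Rightarrow> bool" where
  "path V E u p v \<longleftrightarrow> p \<noteq> [] \<and> hd p = u \<and> last p = v \<and> set p \<subseteq> V \<and> distinct p
     \<and> successively (\<lambda>x y. {x, y} \<in> E) p"

definition connected_graph :: "'a set \<Rightarrow> 'a set set \<Rightarrow> bool" where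
  "connected_graph V E \<longleftrightarrow> V \<noteq> {} \<and> (\<forall>u\<in>V. \<forall>v\<in>V. \<exists>p. path V E u p v)"

definition cycle :: "'a set \<Rightarrow> 'a set set \<Rightarrow> 'a list \<Rightarrow> bool" where
  "cycle V E p \<longleftrightarrow> length p \<ge> 3 \<and> path V E (hd p) p (last p) \<and> {last p, hd p} \<in> E"

definition tree :: "'a set \<Rightarrow> 'a set set \<Rightarrow> bool" where
  "tree V E \<longleftrightarrow> simple_graph V E \<and> connected_graph V E \<and> (\<nexists>p. cycle V E p)"

definition path_length :: "('a set \<Rightarrow> real) \<Rightarrow> 'a list \<Rightarrow> real" where
  "path_length l p = (\<Sum>(x, y)\<leftarrow>zip p (tl p). l {x, y})"

text \<open>Shortest-path distance for non-negative lengths.  The infimum is a minimum whenever the two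
  vertices are joined by a path; it is unspecified otherwise, so it is meant for connected graphs.\<close>

definition dist_graph :: "'a set \<Rightarrow> 'a set set \<Rightarrow> ('a set \<Rightarrow> real) \<Rightarrow> 'a \<Rightarrow> 'a \<Rightarrow> real" where
  "dist_graph V E l u v = (INF p\<in>{p. path V E u p v}. path_length l p)"

definition contracted_length :: "('a set \<Rightarrow> real) \<Rightarrow> 'a set set \<Rightarrow> 'a set \<Rightarrow> real" where
  "contracted_length l C e = (if e \<in> C then 0 else l e)"

definition weak_contraction ::
  "'a set \<Rightarrow> 'a set set \<Rightarrow> ('a set \<Rightarrow> real) \<Rightarrow> (real \<Rightarrow> real) \<Rightarrow> 'a set set \<Rightarrow> bool" where
  "weak_contraction V E l \<phi> C \<longleftrightarrow>
     C \<subseteq> E \<and> \<not> connected_graph V C \<and>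
     (\<forall>u\<in>V. \<forall>v\<in>V. dist_graph V E (contracted_length l C) u v = 0 \<or>
        dist_graph V E (contracted_length l C) u v \<ge> \<phi> (dist_graph V E l u v))"

text \<open>The vertices of \<open>G/C\<close> are the connected components of \<open>(V, C)\<close>.  As its edges form a set of
  two-element sets of components, loops are deleted and parallel edges are identified.\<close>

definition component :: "'a set \<Rightarrow> 'a set set \<Rightarrow> 'a \<Rightarrow> 'a set" where
  "component V C u = {v. \<exists>p. path V C u p v}"

definition contract_edges :: "'a set \<Rightarrow> 'a set set \<Rightarrow> 'a set set \<Rightarrow> 'a set set set" where
  "contract_edges V E C =
     {{component V C u, component V C v} | u v. {u, v} \<in> E \<and> component V C u \<noteq> component V C v}"

definition contraction_value :: "'a set \<Rightarrow> 'a set set \<Rightarrow> 'a set set \<Rightarrow> int" where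
  "contraction_value V E C = int (card E) - int (card (contract_edges V E C))"

definition optimal_weak_contraction ::
  "'a set \<Rightarrow> 'a set set \<Rightarrow> ('a set \<Rightarrow> real) \<Rightarrow> (real \<Rightarrow> real) \<Rightarrow> 'a set set \<Rightarrow> bool" where
  "optimal_weak_contraction V E l \<phi> C \<longleftrightarrow>
     weak_contraction V E l \<phi> C \<and>
     (\<forall>C'. weak_contraction V E l \<phi> C' \<longrightarrow> contraction_value V E C' \<le> contraction_value V E C)"


section \<open>Real RAM\<close>

text \<open>
  The machine model is a real RAM, programmed in a structured language.  The memory consists of
  named arrays of natural numbers and named arrays of real numbers; scalar variables are arrays
  used at index 0 only.  Each program mentions finitely many arrays.
  The integer unit only adds, (truncatedly) subtracts and compares, and there is no conversion
  between reals and naturals, in particular no rounding; this rules out the well-known abuses of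
  unit-cost arithmetic.  Real constants in programs are rational.
\<close>

type_synonym aname = string

datatype nexp =
    NConst nat
  | NGet aname nexp
  | NPlus nexp nexp
  | NMinus nexp nexp

datatype rexp =
    RConst rat
  | RGet aname nexp
  | RPlus rexp rexp
  | RMinus rexp rexp
  | RTimes rexp rexp
  | RDivide rexp rexp

datatype bexp =
    NLess nexp nexp
  | RLess rexp rexp
  | BNot bexp
  | BAnd bexp bexp

datatype com =
    Skip
  | NSet aname nexp nexp
  | RSet aname nexp rexp
  | Seq com com
  | Cond bexp com com
  | While bexp com

record state =
  nmem :: "aname \<Rightarrow> nat \<Rightarrow> nat"
  rmem :: "aname \<Rightarrow> nat \<Rightarrow> real"

fun nval :: "nexp \<Rightarrow> state \<Rightarrow> nat" where
  "nval (NConst k) s = k"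
| "nval (NGet a i) s = nmem s a (nval i s)"
| "nval (NPlus x y) s = nval x s + nval y s"
| "nval (NMinus x y) s = nval x s - nval y s"

fun rval :: "rexp \<Rightarrow> state \<Rightarrow> real" where
  "rval (RConst q) s = of_rat q"
| "rval (RGet a i) s = rmem s a (nval i s)"
| "rval (RPlus x y) s = rval x s + rval y s"
| "rval (RMinus x y) s = rval x s - rval y s"
| "rval (RTimes x y) s = rval x s * rval y s"
| "rval (RDivide x y) s = rval x s / rval y s"

fun bval :: "bexp \<Rightarrow> state \<Rightarrow> bool" where
  "bval (NLess x y) s \<longleftrightarrow> nval x s < nval y s"
| "bval (RLess x y) s \<longleftrightarrow> rval x s < rval y s"
| "bval (BNot b) s \<longleftrightarrow> \<not> bval b s"
| "bval (BAnd b b') s \<longleftrightarrow> bval b s \<and> bval b' s"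

definition nset :: "aname \<Rightarrow> nat \<Rightarrow> nat \<Rightarrow> state \<Rightarrow> state" where
  "nset a i x s = s\<lparr>nmem := (nmem s)(a := (nmem s a)(i := x))\<rparr>"

definition rset :: "aname \<Rightarrow> nat \<Rightarrow> real \<Rightarrow> state \<Rightarrow> state" where
  "rset a i x s = s\<lparr>rmem := (rmem s)(a := (rmem s a)(i := x))\<rparr>"

text \<open>\<open>exec c s t s'\<close>: started in state \<open>s\<close>, program \<open>c\<close> halts in state \<open>s'\<close> after \<open>t\<close> steps.
  A step is an assignment or the evaluation of a test.  The expressions are part of the program,
  so that each of them performs a number of elementary operations that is independent of the
  input.\<close>

inductive exec :: "com \<Rightarrow> state \<Rightarrow> nat \<Rightarrow> state \<Rightarrow> bool" where
  Skip: "exec Skip s 0 s"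
| NSet: "exec (NSet a i x) s 1 (nset a (nval i s) (nval x s) s)"
| RSet: "exec (RSet a i x) s 1 (rset a (nval i s) (rval x s) s)"
| Seq: "exec c1 s t1 s' \<Longrightarrow> exec c2 s' t2 s'' \<Longrightarrow> exec (Seq c1 c2) s (t1 + t2) s''"
| CondTrue: "bval b s \<Longrightarrow> exec c1 s t s' \<Longrightarrow> exec (Cond b c1 c2) s (1 + t) s'"
| CondFalse: "\<not> bval b s \<Longrightarrow> exec c2 s t s' \<Longrightarrow> exec (Cond b c1 c2) s (1 + t) s'"
| WhileFalse: "\<not> bval b s \<Longrightarrow> exec (While b c) s 1 s"
| WhileTrue: "bval b s \<Longrightarrow> exec c s t1 s' \<Longrightarrow> exec (While b c) s' t2 s'' \<Longrightarrow>
    exec (While b c) s (1 + t1 + t2) s''"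

inductive_cases Skip_execE: "exec Skip s t s'"
inductive_cases NSet_execE: "exec (NSet a i x) s t s'"
inductive_cases RSet_execE: "exec (RSet a i x) s t s'"
inductive_cases Seq_execE: "exec (Seq c1 c2) s t s'"
inductive_cases Cond_execE: "exec (Cond b c1 c2) s t s'"
inductive_cases While_execE: "exec (While b c) s t s'"

lemma exec_deterministic:
  "exec c s t s' \<Longrightarrow> exec c s u s'' \<Longrightarrow> t = u \<and> s' = s''"
proof (induction arbitrary: u s'' rule: exec.induct)
  case (Skip s)
  then show ?case by (auto elim: Skip_execE)
next
  case (NSet a i x s)
  then show ?case by (auto elim: NSet_execE)
next
  case (RSet a i x s)
  then show ?case by (auto elim: RSet_execE)
next
  case (Seq c1 s t1 s1 c2 t2 s2)
  from Seq.prems obtain u1 u2 r where "exec c1 s u1 r" "exec c2 r u2 s''" "u = u1 + u2"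
    by (rule Seq_execE)
  with Seq.IH show ?case by metis
next
  case (CondTrue b s c1 t s' c2)
  from CondTrue.prems CondTrue.hyps obtain u1 where "exec c1 s u1 s''" "u = 1 + u1"
    by (elim Cond_execE) simp_all
  with CondTrue.IH show ?case by metis
next
  case (CondFalse b s c2 t s' c1)
  from CondFalse.prems CondFalse.hyps obtain u1 where "exec c2 s u1 s''" "u = 1 + u1"
    by (elim Cond_execE) simp_all
  with CondFalse.IH show ?case by metis
next
  case (WhileFalse b s c)
  from WhileFalse.prems show ?case by (rule While_execE) (use WhileFalse.hyps in simp_all)
next
  case (WhileTrue b s c t1 s1 t2 s2)
  from WhileTrue.prems obtain u1 u2 r
    where "exec c s u1 r" "exec (While b c) r u2 s''" "u = 1 + u1 + u2"
    by (rule While_execE) (use WhileTrue.hyps(1) in simp_all)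
  with WhileTrue.IH show ?case by metis
qed


section \<open>Encoding of instances and solutions\<close>

text \<open>The edges are given to the machine as a list of their end points, in arbitrary order and
  orientation.\<close>

definition edge_of :: "nat \<times> nat \<Rightarrow> nat set" where
  "edge_of e = {fst e, snd e}"

definition edge_list :: "(nat \<times> nat) list \<Rightarrow> nat set set \<Rightarrow> bool" where
  "edge_list es E \<longleftrightarrow> distinct (map edge_of es) \<and> set (map edge_of es) = E"

definition input_state ::
  "nat \<Rightarrow> (nat \<times> nat) list \<Rightarrow> (nat set \<Rightarrow> real) \<Rightarrow> real \<Rightarrow> real \<Rightarrow> state" where
  "input_state n es l \<alpha> \<beta> =
     \<lparr>nmem = (\<lambda>_ _. 0)
        (''n'' := (\<lambda>_. 0)(0 := n),
         ''src'' := (\<lambda>i. if i < length es then fst (es ! i) else 0),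
         ''dst'' := (\<lambda>i. if i < length es then snd (es ! i) else 0)),
      rmem = (\<lambda>_ _. 0)
        (''len'' := (\<lambda>i. if i < length es then l (edge_of (es ! i)) else 0),
         ''alpha'' := (\<lambda>_. 0)(0 := \<alpha>),
         ''beta'' := (\<lambda>_. 0)(0 := \<beta>))\<rparr>"

definition output_edges :: "(nat \<times> nat) list \<Rightarrow> state \<Rightarrow> nat set set" where
  "output_edges es s = {edge_of (es ! i) | i. i < length es \<and> nmem s ''out'' i \<noteq> 0}"

end

theory Submission
  imports Defs
begin

text \<open>
  On a tree, a proper subset \<open>C\<close> of the edges is a weak contraction iff every path that is not
  contained in \<open>C\<close> has weight at most \<open>\<beta>\<close>, where edges in \<open>C\<close> weigh \<open>l e / \<alpha>\<close> and the others
  \<open>l e / \<alpha> - l e\<close>.  For a rooted tree this depends on \<open>C\<close> only through \<open>maxA\<close>, the largest weight of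
  a path from the root inside \<open>C\<close>, and \<open>maxB\<close>, the largest weight of the other paths from the root.
  As \<open>maxA\<close> is \<open>1 / \<alpha>\<close> times the distance of the root to some vertex, a table that stores for every
  vertex \<open>u\<close> and every \<open>k\<close> the least \<open>maxB\<close> among the sets of \<open>k\<close> edges with this value of \<open>maxA\<close> has
  \<open>O(n\<^sup>2)\<close> entries.  Joining two rooted trees by an edge combines all pairs of entries in time
  \<open>O(n\<^sup>4)\<close>, and \<open>n - 1\<close> such joins build the tree.  Each entry points to the two entries it was
  combined from, so that an optimal set is read off in the end.
\<close>

section \<open>Total correctness with time bounds\<close>

text \<open>The weights come from rewriting the contraction condition as: distance over \<alpha>
  minus contracted distance is at most \<beta>. Path sums in a tree are additive in the edge
  function, so the left side is again a path sum. Two maxima per tree are needed because a pair is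
  exempt only if its whole path is contracted: where two halves meet at a join, the sum of two
  contracted halves is free, while the other three sums are bounded. All conditions are monotone in
  the two maxima. Hence entries may hold upper bounds instead of exact values, and one entry per key
  is enough. The machine shapes the rest. It cannot multiply naturals, so addresses are looked up in
  a table of multiples of \<open>n\<close>. It has no infinity, so a missing maximum is replaced by
  a finite value that is small enough. It has no recursion, so the tree is rebuilt by undoing a
  growth order, and the solution is read off in one sweep along descending pointers.\<close>

definition runs :: "com \<Rightarrow> state \<Rightarrow> nat \<Rightarrow> (state \<Rightarrow> bool) \<Rightarrow> bool" where
  "runs c s T Q \<longleftrightarrow> (\<exists>t s'. exec c s t s' \<and> t \<le> T \<and> Q s')"

fun nwrites :: "com \<Rightarrow> aname set" where
  "nwrites Skip = {}"
| "nwrites (NSet a i x) = {a}"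
| "nwrites (RSet a i x) = {}"
| "nwrites (Seq c d) = nwrites c \<union> nwrites d"
| "nwrites (Cond b c d) = nwrites c \<union> nwrites d"
| "nwrites (While b c) = nwrites c"

fun rwrites :: "com \<Rightarrow> aname set" where
  "rwrites Skip = {}"
| "rwrites (NSet a i x) = {}"
| "rwrites (RSet a i x) = {a}"
| "rwrites (Seq c d) = rwrites c \<union> rwrites d"
| "rwrites (Cond b c d) = rwrites c \<union> rwrites d"
| "rwrites (While b c) = rwrites c"

lemma nmem_nset [simp]: "nmem (nset a i x s) = (nmem s)(a := (nmem s a)(i := x))"
  and nmem_rset [simp]: "nmem (rset a i r s) = nmem s"
  and rmem_nset [simp]: "rmem (nset a i x s) = rmem s"
  and rmem_rset [simp]: "rmem (rset a i r s) = (rmem s)(a := (rmem s a)(i := r))"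
  by (simp_all add: nset_def rset_def)

text \<open>A frame condition read off the program text: invariants mention only what matters to
  them, and unchanged arrays are recovered through \<open>exec_agree\<close>.\<close>

definition agree :: "com \<Rightarrow> state \<Rightarrow> state \<Rightarrow> bool" where
  "agree c s s' \<longleftrightarrow> (\<forall>a. a \<notin> nwrites c \<longrightarrow> nmem s' a = nmem s a) \<and>
     (\<forall>a. a \<notin> rwrites c \<longrightarrow> rmem s' a = rmem s a)"

lemma agree_nmem: "agree c s s' \<Longrightarrow> a \<notin> nwrites c \<Longrightarrow> nmem s' a = nmem s a"
  and agree_rmem: "agree c s s' \<Longrightarrow> a \<notin> rwrites c \<Longrightarrow> rmem s' a = rmem s a"
  by (auto simp: agree_def)

lemma exec_agree: "exec c s t s' \<Longrightarrow> agree c s s'"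
  by (induction rule: exec.induct) (auto simp: agree_def)

lemma runs_mono:
  "runs c s T Q \<Longrightarrow> T \<le> T' \<Longrightarrow> (\<And>s'. Q s' \<Longrightarrow> agree c s s' \<Longrightarrow> Q' s') \<Longrightarrow> runs c s T' Q'"
  unfolding runs_def using exec_agree le_trans by blast

lemma runs_Skip: "Q s \<Longrightarrow> runs Skip s T Q"
  unfolding runs_def using exec.Skip by blast

lemma runs_NSet: "1 \<le> T \<Longrightarrow> Q (nset a (nval i s) (nval x s) s) \<Longrightarrow> runs (NSet a i x) s T Q"
  unfolding runs_def using exec.NSet by blast

lemma runs_RSet: "1 \<le> T \<Longrightarrow> Q (rset a (nval i s) (rval x s) s) \<Longrightarrow> runs (RSet a i x) s T Q"
  unfolding runs_def using exec.RSet by blast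

text \<open>The frame fact \<open>agree c s s'\<close> is handed to the second program for free, so
  a specification of \<open>c\<close> need not list what \<open>c\<close> leaves alone.\<close>

lemma runs_Seq:
  assumes "runs c s T1 (\<lambda>s'. agree c s s' \<longrightarrow> runs d s' T2 Q)" "T1 + T2 \<le> T"
  shows "runs (Seq c d) s T Q"
proof -
  obtain t1 s' where 1: "exec c s t1 s'" "t1 \<le> T1" "runs d s' T2 Q"
    using assms(1) exec_agree unfolding runs_def by blast
  then obtain t2 s'' where "exec d s' t2 s''" "t2 \<le> T2" "Q s''"
    unfolding runs_def by blast
  with 1 assms(2) show ?thesis
    unfolding runs_def by (intro exI[of _ "t1 + t2"] exI[of _ s'']) (auto intro: exec.Seq)
qed

lemma runs_NSet_Seq:
  "runs d (nset a (nval i s) (nval x s) s) T2 Q \<Longrightarrow> 1 + T2 \<le> T \<Longrightarrow> runs (Seq (NSet a i x) d) s T Q"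
  by (rule runs_Seq[where ?T1.0 = 1]) (simp_all add: runs_NSet)

lemma runs_RSet_Seq:
  "runs d (rset a (nval i s) (rval x s) s) T2 Q \<Longrightarrow> 1 + T2 \<le> T \<Longrightarrow> runs (Seq (RSet a i x) d) s T Q"
  by (rule runs_Seq[where ?T1.0 = 1]) (simp_all add: runs_RSet)

lemma runs_Cond:
  assumes "bval b s \<Longrightarrow> runs c s T Q" "\<not> bval b s \<Longrightarrow> runs d s T Q" "T + 1 \<le> T'"
  shows "runs (Cond b c d) s T' Q"
proof (cases "bval b s")
  case True
  then obtain t s' where "exec c s t s'" "t \<le> T" "Q s'"
    using assms(1) unfolding runs_def by blast
  with True assms(3) show ?thesis
    unfolding runs_def by (intro exI[of _ "1 + t"] exI[of _ s'])
      (auto intro: exec.CondTrue simp del: One_nat_def plus_1_eq_Suc)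
next
  case False
  then obtain t s' where "exec d s t s'" "t \<le> T" "Q s'"
    using assms(2) unfolding runs_def by blast
  with False assms(3) show ?thesis
    unfolding runs_def by (intro exI[of _ "1 + t"] exI[of _ s'])
      (auto intro: exec.CondFalse simp del: One_nat_def plus_1_eq_Suc)
qed

abbreviation nvar :: "aname \<Rightarrow> nexp" where
  "nvar x \<equiv> NGet x (NConst 0)"

abbreviation rvar :: "aname \<Rightarrow> rexp" where
  "rvar x \<equiv> RGet x (NConst 0)"

abbreviation nlet :: "aname \<Rightarrow> nexp \<Rightarrow> com" where
  "nlet x \<equiv> NSet x (NConst 0)"

abbreviation rlet :: "aname \<Rightarrow> rexp \<Rightarrow> com" where
  "rlet x \<equiv> RSet x (NConst 0)"

definition For :: "aname \<Rightarrow> nexp \<Rightarrow> com \<Rightarrow> com" where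
  "For x b c = Seq (nlet x (NConst 0))
     (While (NLess (nvar x) b) (Seq c (nlet x (NPlus (nvar x) (NConst 1)))))"

lemma nwrites_For [simp]: "nwrites (For x b c) = insert x (nwrites c)"
  and rwrites_For [simp]: "rwrites (For x b c) = rwrites c"
  by (auto simp: For_def)

text \<open>The invariant is stated for the state after the counter has been set, as the increment
  belongs to the round. The bound is evaluated anew in every test, hence the premise that it stays
  \<open>N\<close>. A round costs its body plus a test and an increment; the initial assignment and
  the last test add 2.\<close>

lemma runs_For:
  assumes x: "x \<notin> nwrites c"
    and init: "I 0 (nset x 0 0 s0)"
    and bound: "\<And>k s. I k s \<Longrightarrow> agree (For x b c) s0 s \<Longrightarrow> k \<le> N \<Longrightarrow> nval b s = N"
    and body: "\<And>k s. \<lbrakk>k < N; I k s; nmem s x 0 = k; agree (For x b c) s0 s\<rbrakk> \<Longrightarrow>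
      runs c s T (\<lambda>s'. agree c s s' \<longrightarrow> I (Suc k) (nset x 0 (Suc k) s'))"
    and post: "\<And>s. \<lbrakk>I N s; nmem s x 0 = N; agree (For x b c) s0 s\<rbrakk> \<Longrightarrow> Q s"
    and time: "N * (T + 2) + 2 \<le> T'"
  shows "runs (For x b c) s0 T' Q"
proof -
  let ?w = "While (NLess (nvar x) b) (Seq c (NSet x (NConst 0) (NPlus (nvar x) (NConst 1))))"
  have loop: "\<exists>t s'. exec ?w s t s' \<and> t \<le> m * (T + 2) + 1 \<and> Q s'"
    if "m = N - k" "k \<le> N" "I k s" "nmem s x 0 = k" "agree (For x b c) s0 s" for m k s
    using that
  proof (induction m arbitrary: k s)
    case 0
    then have "k = N" by simp
    moreover have "nval b s = N" using 0 bound by blast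
    ultimately show ?case
      using 0 post[of s] exec.WhileFalse[of "NLess (nvar x) b" s]
      by (intro exI[of _ 1] exI[of _ s]) auto
  next
    case (Suc m)
    then have k: "k < N" by simp
    obtain t1 s1 where s1: "exec c s t1 s1" "t1 \<le> T" "I (Suc k) (nset x 0 (Suc k) s1)"
      using body[OF k Suc.prems(3-5)] exec_agree unfolding runs_def by blast
    let ?s2 = "nset x 0 (Suc k) s1"
    have ag: "agree c s s1" using s1 exec_agree by blast
    have "nmem s1 x 0 = k" using ag x Suc.prems by (simp add: agree_def)
    then have e1: "exec (NSet x (NConst 0) (NPlus (nvar x) (NConst 1))) s1 1 ?s2"
      using exec.NSet[of x "NConst 0" "NPlus (nvar x) (NConst 1)" s1] by simp
    have ag2: "agree (For x b c) s0 ?s2"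
      using ag Suc.prems(5) by (auto simp: agree_def)
    have "\<exists>t s'. exec ?w ?s2 t s' \<and> t \<le> m * (T + 2) + 1 \<and> Q s'"
      using Suc.prems(1) k s1(3) ag2 by (intro Suc.IH[of "Suc k"]) auto
    then obtain t2 s' where s': "exec ?w ?s2 t2 s'" "t2 \<le> m * (T + 2) + 1" "Q s'" by blast
    have b: "bval (NLess (nvar x) b) s"
      using bound[OF Suc.prems(3,5)] k Suc.prems(4) by simp
    have "exec ?w s (1 + (t1 + 1) + t2) s'"
      by (rule exec.WhileTrue[OF b exec.Seq[OF s1(1) e1] s'(1)])
    then show ?case using s' s1(2) by (intro exI[of _ "1 + (t1 + 1) + t2"] exI[of _ s']) auto
  qed
  have "agree (For x b c) s0 (nset x 0 0 s0)" by (simp add: agree_def)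
  then obtain t s' where "exec ?w (nset x 0 0 s0) t s'" "t \<le> N * (T + 2) + 1" "Q s'"
    using loop[of N 0 "nset x 0 0 s0"] init by auto
  moreover have "exec (NSet x (NConst 0) (NConst 0)) s0 1 (nset x 0 0 s0)"
    using exec.NSet[of x "NConst 0" "NConst 0" s0] by simp
  ultimately have "exec (For x b c) s0 (1 + t) s'" "1 + t \<le> T'" "Q s'"
    unfolding For_def using time by (blast intro: exec.Seq, simp_all)
  then show ?thesis unfolding runs_def by blast
qed

section \<open>Binary decompositions of trees\<close>

text \<open>\<open>Join t1 t2\<close> hangs the root of \<open>t2\<close> below that of
  \<open>t1\<close> by a new edge and keeps the root of \<open>t1\<close>. A vertex with many
  children is joined to them one at a time, so every step of the dynamic program merges just two
  tables.\<close>

datatype 'a btree = Leaf 'a | Join "'a btree" "'a btree"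

fun broot :: "'a btree \<Rightarrow> 'a" where
  "broot (Leaf v) = v"
| "broot (Join t1 t2) = broot t1"

fun verts :: "'a btree \<Rightarrow> 'a set" where
  "verts (Leaf v) = {v}"
| "verts (Join t1 t2) = verts t1 \<union> verts t2"

abbreviation join_edge :: "'a btree \<Rightarrow> 'a btree \<Rightarrow> 'a set" where
  "join_edge t1 t2 \<equiv> {broot t1, broot t2}"

fun edges :: "'a btree \<Rightarrow> 'a set set" where
  "edges (Leaf v) = {}"
| "edges (Join t1 t2) = insert (join_edge t1 t2) (edges t1 \<union> edges t2)"

fun wf_btree :: "'a btree \<Rightarrow> bool" where
  "wf_btree (Leaf v) \<longleftrightarrow> True"
| "wf_btree (Join t1 t2) \<longleftrightarrow> wf_btree t1 \<and> wf_btree t2 \<and> verts t1 \<inter> verts t2 = {}"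

text \<open>The path sum of an arbitrary, possibly negative edge function. One notion serves for
  lengths, contracted lengths, weights and indicator functions of edges.\<close>

fun tdist :: "('a set \<Rightarrow> real) \<Rightarrow> 'a btree \<Rightarrow> 'a \<Rightarrow> 'a \<Rightarrow> real" where
  "tdist f (Leaf w) u v = 0"
| "tdist f (Join t1 t2) u v =
     (if u \<in> verts t1 then
        if v \<in> verts t1 then tdist f t1 u v
        else tdist f t1 u (broot t1) + f (join_edge t1 t2) + tdist f t2 (broot t2) v
      else
        if v \<in> verts t1 then tdist f t2 u (broot t2) + f (join_edge t1 t2) + tdist f t1 (broot t1) v
        else tdist f t2 u v)"

lemma broot_in_verts [simp]: "broot t \<in> verts t"
  by (induction t) auto

lemma finite_verts [simp]: "finite (verts t)"
  by (induction t) auto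

lemma finite_edges [simp]: "finite (edges t)"
  by (induction t) auto

lemma edges_verts: "e \<in> edges t \<Longrightarrow> e \<subseteq> verts t \<and> e \<noteq> {}"
  by (induction t) auto

lemma edges_disjoint:
  assumes "verts t1 \<inter> verts t2 = {}"
  shows "edges t1 \<inter> edges t2 = {}" "join_edge t1 t2 \<notin> edges t1" "join_edge t1 t2 \<notin> edges t2"
  using assms broot_in_verts[of t1] broot_in_verts[of t2] edges_verts[of _ t1] edges_verts[of _ t2]
  by blast+

lemma card_verts: "wf_btree t \<Longrightarrow> card (verts t) = Suc (card (edges t))"
proof (induction t)
  case (Join t1 t2)
  then show ?case
    using edges_disjoint[of t1 t2] by (auto simp: card_Un_disjoint)
qed auto

lemma tdist_self [simp]: "tdist f t u u = 0"
  by (induction t) auto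

lemma tdist_sym: "tdist f t u v = tdist f t v u"
  by (induction t arbitrary: u v) auto

lemma tdist_nonneg: "(\<And>e. e \<in> edges t \<Longrightarrow> f e \<ge> 0) \<Longrightarrow> tdist f t u v \<ge> 0"
  by (induction t arbitrary: u v) auto

lemma tdist_triangle:
  assumes "\<And>e. e \<in> edges t \<Longrightarrow> f e \<ge> 0"
  shows "tdist f t u w \<le> tdist f t u v + tdist f t v w"
  using assms
proof (induction t arbitrary: u v w)
  case (Join t1 t2)
  have IH: "tdist f t1 u w \<le> tdist f t1 u v + tdist f t1 v w"
    "tdist f t2 u w \<le> tdist f t2 u v + tdist f t2 v w" for u v w
    using Join by auto
  have "f (join_edge t1 t2) \<ge> 0" using Join.prems by auto
  moreover have "tdist f t1 u v \<ge> 0" "tdist f t2 u v \<ge> 0" for u v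
    using Join.prems by (auto intro!: tdist_nonneg)
  ultimately show ?case
    \<comment> \<open>A detour over the bridge passes both roots and splits there; the first two
      instances treat \<open>v\<close> on the side opposite to \<open>u\<close> and
      \<open>w\<close>.\<close>
    using IH(1)[of u w "broot t1"] IH(2)[of u w "broot t2"]
      IH(1)[of u w v] IH(2)[of u w v]
      IH(1)[of u "broot t1" v] IH(2)[of u "broot t2" v]
      IH(1)[of "broot t1" w v] IH(2)[of "broot t2" w v]
    by (simp add: add_nonneg_nonneg add_increasing add_increasing2) (smt (verit, best))
qed auto

text \<open>Together with \<open>tdist_divide\<close> this turns distance over \<alpha> minus
  contracted distance into the path sum of a single edge function.\<close>

lemma tdist_diff: "tdist (\<lambda>e. f e - g e) t u v = tdist f t u v - tdist g t u v"
  by (induction t arbitrary: u v) auto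

lemma tdist_divide: "tdist (\<lambda>e. f e / c) t u v = tdist f t u v / c"
  by (induction t arbitrary: u v) (auto simp: add_divide_distrib)

subsection \<open>Paths\<close>

lemma path_length_Nil [simp]: "path_length f [] = 0"
  and path_length_single [simp]: "path_length f [x] = 0"
  and path_length_Cons [simp]: "path_length f (x # y # p) = f {x, y} + path_length f (y # p)"
  by (simp_all add: path_length_def)

lemma path_length_append:
  "p \<noteq> [] \<Longrightarrow> q \<noteq> [] \<Longrightarrow>
   path_length f (p @ q) = path_length f p + f {last p, hd q} + path_length f q"
proof (induction p rule: induct_list012)
  case (2 x)
  then show ?case by (cases q) auto
qed auto

lemma path_length_rev: "path_length f (rev p) = path_length f p"
proof (induction p)
  case (Cons x p)
  then show ?case
    using path_length_append[of "rev p" "[x]" f] by (cases p) (auto simp: insert_commute)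
qed simp

lemma path_length_nonneg:
  "successively (\<lambda>x y. {x, y} \<in> E) p \<Longrightarrow> (\<And>e. e \<in> E \<Longrightarrow> f e \<ge> 0) \<Longrightarrow> path_length f p \<ge> 0"
  by (induction p rule: induct_list012) auto

lemma path_length_eq_0:
  "successively (\<lambda>x y. {x, y} \<in> E) p \<Longrightarrow> (\<And>e. e \<in> E \<Longrightarrow> f e \<ge> 0) \<Longrightarrow>
   path_length f p = 0 \<longleftrightarrow> successively (\<lambda>x y. {x, y} \<in> E \<and> f {x, y} = 0) p"
proof (induction p rule: induct_list012)
  case (3 x y zs)
  then have "path_length f (y # zs) \<ge> 0" "f {x, y} \<ge> 0"
    using path_length_nonneg[of E "y # zs" f] by auto
  then have "path_length f (x # y # zs) = 0 \<longleftrightarrow> f {x, y} = 0 \<and> path_length f (y # zs) = 0"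
    by (simp add: add_nonneg_eq_0_iff)
  with 3 show ?case by auto
qed auto

lemma path_rev: "path V E u p v \<Longrightarrow> path V E v (rev p) u"
  by (auto simp: path_def hd_rev last_rev insert_commute)

lemma path_mono: "path V E u p v \<Longrightarrow> V \<subseteq> V' \<Longrightarrow> E \<subseteq> E' \<Longrightarrow> path V' E' u p v"
  by (auto simp: path_def intro: successively_mono)

lemma path_append:
  assumes "path V1 E1 u p a" "path V2 E2 b q v" "V1 \<inter> V2 = {}" "{a, b} \<in> E"
    "V1 \<union> V2 \<subseteq> V" "E1 \<union> E2 \<subseteq> E"
  shows "path V E u (p @ q) v"
  using assms unfolding path_def successively_append_iff
  by (auto intro: successively_mono)

text \<open>The bridge is the only edge that leaves \<open>V1\<close>, and taking it would visit
  \<open>b\<close>.\<close>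

lemma successively_stay:
  assumes "successively (\<lambda>x y. {x, y} \<in> insert {a, b} (E1 \<union> E2)) p"
    "\<And>e. e \<in> E1 \<Longrightarrow> e \<subseteq> V1" "\<And>e. e \<in> E2 \<Longrightarrow> e \<subseteq> V2"
    "V1 \<inter> V2 = {}" "a \<in> V1" "b \<in> V2" "b \<notin> set p" "p \<noteq> [] \<Longrightarrow> hd p \<in> V1"
  shows "set p \<subseteq> V1 \<and> successively (\<lambda>x y. {x, y} \<in> E1) p"
  using assms
proof (induction p rule: induct_list012)
  case (3 x y zs)
  have "{x, y} \<notin> E2" "{x, y} \<noteq> {a, b}"
    using 3(4-10) 3(5)[of "{x, y}"] by (auto simp: doubleton_eq_iff)
  then have "{x, y} \<in> E1" using 3 by auto
  moreover from this have "y \<in> V1" using 3(4)[of "{x, y}"] by auto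
  ultimately show ?case using 3 by auto
qed auto

text \<open>The path is cut at its first visit of \<open>b\<close>. The vertex before it must be
  \<open>a\<close>, as only the bridge enters \<open>V2\<close>, and the rest cannot come back,
  since that would visit \<open>a\<close> a second time.\<close>

lemma path_bridge:
  assumes "path (V1 \<union> V2) (insert {a, b} (E1 \<union> E2)) u p v"
    "\<And>e. e \<in> E1 \<Longrightarrow> e \<subseteq> V1" "\<And>e. e \<in> E2 \<Longrightarrow> e \<subseteq> V2"
    "V1 \<inter> V2 = {}" "a \<in> V1" "b \<in> V2" "u \<in> V1"
  shows "v \<in> V1 \<and> path V1 E1 u p v \<or>
    v \<in> V2 \<and> (\<exists>p1 p2. p = p1 @ p2 \<and> path V1 E1 u p1 a \<and> path V2 E2 b p2 v)"
proof (cases "b \<in> set p")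
  case False
  then have "set p \<subseteq> V1 \<and> successively (\<lambda>x y. {x, y} \<in> E1) p"
    using assms by (intro successively_stay[of a b E1 E2 p V1 V2]) (auto simp: path_def)
  then show ?thesis using assms(1) last_in_set[of p] by (auto simp: path_def)
next
  case True
  then obtain p1 q where p: "p = p1 @ b # q" "b \<notin> set p1" by (meson split_list_first)
  have ne: "p1 \<noteq> []" using p assms by (auto simp: path_def)
  have suc: "successively (\<lambda>x y. {x, y} \<in> insert {a, b} (E1 \<union> E2)) p1"
    "successively (\<lambda>x y. {x, y} \<in> insert {a, b} (E1 \<union> E2)) (b # q)"
    "{last p1, b} \<in> insert {a, b} (E1 \<union> E2)"
    using assms(1) p ne by (auto simp: path_def successively_append_iff)
  have 1: "set p1 \<subseteq> V1 \<and> successively (\<lambda>x y. {x, y} \<in> E1) p1"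
    using assms suc p ne by (intro successively_stay[of a b E1 E2 p1 V1 V2]) (auto simp: path_def)
  then have l: "last p1 \<in> V1" using ne by auto
  then have la: "last p1 = a" 
    using suc(3) assms(2,3)[of "{last p1, b}"] assms(4-6) by (auto simp: doubleton_eq_iff)
  then have "a \<in> set p1" using ne by auto
  then have "a \<notin> set (b # q)" using assms(1) p by (auto simp: path_def)
  then have 2: "set (b # q) \<subseteq> V2 \<and> successively (\<lambda>x y. {x, y} \<in> E2) (b # q)"
    using assms suc by (intro successively_stay[of b a E2 E1 "b # q" V2 V1])
      (auto simp: insert_commute Un_commute)
  have "last (b # q) = v" using assms(1) p by (auto simp: path_def)
  moreover from this have "v \<in> V2" using 2 last_in_set[of "b # q"] by auto
  ultimately show ?thesis
    using 1 2 p ne la assms(1) unfolding path_def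
    by (intro disjI2 conjI exI[of _ p1] exI[of _ "b # q"]) auto
qed

text \<open>This stands in for uniqueness of paths: all paths between two vertices have the same
  length, for every \<open>f\<close>. They are cut at the bridge; a path from \<open>t2\<close> to
  \<open>t1\<close> is reversed first.\<close>

lemma path_length_tdist:
  "wf_btree t \<Longrightarrow> path (verts t) (edges t) u p v \<Longrightarrow> path_length f p = tdist f t u v"
proof (induction t arbitrary: u p v)
  case (Leaf w)
  then have "p = [w]"
    by (cases p rule: remdups_adj.cases) (auto simp: path_def)
  then show ?case by simp
next
  case (Join t1 t2)
  let ?V1 = "verts t1" let ?V2 = "verts t2"
  have u: "u \<in> ?V1 \<or> u \<in> ?V2" and v: "v \<in> ?V1 \<or> v \<in> ?V2" and disj: "?V1 \<inter> ?V2 = {}"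
    using Join.prems hd_in_set[of p] last_in_set[of p] by (auto simp: path_def)
  have fwd: "path_length f p = tdist f (Join t1 t2) u v"
    if "path (?V1 \<union> ?V2) (edges (Join t1 t2)) u p v" "u \<in> ?V1" for u p v
  proof -
    have "v \<in> ?V1 \<and> path ?V1 (edges t1) u p v \<or> v \<in> ?V2 \<and>
      (\<exists>p1 p2. p = p1 @ p2 \<and> path ?V1 (edges t1) u p1 (broot t1) \<and>
        path ?V2 (edges t2) (broot t2) p2 v)"
      using that disj by (intro path_bridge) (auto dest: edges_verts)
    then show ?thesis
    proof (elim disjE conjE exE)
      fix p1 p2
      assume *: "v \<in> ?V2" "p = p1 @ p2" "path ?V1 (edges t1) u p1 (broot t1)"
        "path ?V2 (edges t2) (broot t2) p2 v"
      then have "path_length f p = path_length f p1 + f (join_edge t1 t2) + path_length f p2"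
        by (subst *(2), subst path_length_append) (auto simp: path_def)
      with * show ?thesis using Join that disj by auto
    qed (use Join that in auto)
  qed
  have bwd: "path_length f p = tdist f (Join t1 t2) u v"
    if "path (?V1 \<union> ?V2) (edges (Join t1 t2)) u p v" "v \<in> ?V1" for u p v
    using fwd[OF path_rev[OF that(1)] that(2)] by (simp add: path_length_rev tdist_sym)
  show ?case
  proof (cases "u \<in> ?V1 \<or> v \<in> ?V1")
    case True
    then show ?thesis using fwd bwd Join.prems by auto
  next
    case False
    then have uv: "u \<in> ?V2" "v \<in> ?V2" "u \<notin> ?V1" "v \<notin> ?V1" using u v by auto
    have "v \<in> ?V2 \<and> path ?V2 (edges t2) u p v \<or> v \<in> ?V1 \<and>
      (\<exists>p1 p2. p = p1 @ p2 \<and> path ?V2 (edges t2) u p1 (broot t2) \<and>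
        path ?V1 (edges t1) (broot t1) p2 v)"
      using Join.prems disj uv by (intro path_bridge)
        (auto dest: edges_verts simp: insert_commute Un_commute)
    then show ?thesis using uv Join by auto
  qed
qed

lemma btree_path_exists:
  "wf_btree t \<Longrightarrow> u \<in> verts t \<Longrightarrow> v \<in> verts t \<Longrightarrow> \<exists>p. path (verts t) (edges t) u p v"
proof (induction t arbitrary: u v)
  case (Leaf w)
  then show ?case by (auto simp: path_def intro!: exI[of _ "[w]"])
next
  case (Join t1 t2)
  let ?V = "verts (Join t1 t2)" let ?E = "edges (Join t1 t2)"
  have cross: "\<exists>p. path ?V ?E u p v" if uv: "u \<in> verts t1" "v \<in> verts t2" for u v
  proof -
    obtain p q where "path (verts t1) (edges t1) u p (broot t1)"
      "path (verts t2) (edges t2) (broot t2) q v"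
      using Join.IH(1)[of u "broot t1"] Join.IH(2)[of "broot t2" v] Join.prems(1) uv by auto
    then have "path ?V ?E u (p @ q) v"
      by (rule path_append) (use Join.prems in auto)
    then show ?thesis by blast
  qed
  have one: "\<exists>p. path ?V ?E u p v" if "u \<in> verts t1" "v \<in> verts t1" for u v
    using Join.IH(1)[OF _ that] Join.prems(1)
    by (metis path_mono UnCI edges.simps(2) insertI2 subsetI verts.simps(2) wf_btree.simps(2))
  have two: "\<exists>p. path ?V ?E u p v" if "u \<in> verts t2" "v \<in> verts t2" for u v
    using Join.IH(2)[OF _ that] Join.prems(1)
    by (metis path_mono UnCI edges.simps(2) insertI2 subsetI verts.simps(2) wf_btree.simps(2))
  show ?case
    using Join.prems(2,3) cross one two path_rev by (metis UnE verts.simps(2))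
qed

text \<open>The infimum is taken over a one-element set: some path exists, and all of them have the
  same length.\<close>

lemma dist_graph_tdist:
  assumes "wf_btree t" "u \<in> verts t" "v \<in> verts t"
  shows "dist_graph (verts t) (edges t) f u v = tdist f t u v"
proof -
  have "path_length f ` {p. path (verts t) (edges t) u p v} = {tdist f t u v}"
    using btree_path_exists[OF assms] path_length_tdist[OF assms(1)] by auto
  then show ?thesis by (simp add: dist_graph_def)
qed

subsection \<open>Contractions\<close>

text \<open>Distance zero for this length function means being joined inside \<open>C\<close>, so
  connectivity in \<open>(V, C)\<close> becomes a statement on \<open>tdist\<close>.\<close>

definition outside :: "'a set set \<Rightarrow> 'a set \<Rightarrow> real" where
  "outside C e = (if e \<in> C then 0 else 1)"

lemma path_outside_iff:
  assumes "C \<subseteq> E"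
  shows "path V C u p v \<longleftrightarrow> path V E u p v \<and> path_length (outside C) p = 0"
proof -
  have eq: "(\<lambda>x y. {x, y} \<in> E \<and> outside C {x, y} = 0) = (\<lambda>x y. {x, y} \<in> C)"
    using assms by (auto simp: outside_def fun_eq_iff)
  have "path_length (outside C) p = 0 \<longleftrightarrow> successively (\<lambda>x y. {x, y} \<in> C) p"
    if "successively (\<lambda>x y. {x, y} \<in> E) p"
    using path_length_eq_0[OF that, of "outside C"] unfolding eq by (simp add: outside_def)
  moreover have "path V C u p v \<Longrightarrow> path V E u p v" using path_mono[of V C u p v V E] assms by simp
  moreover have "path V F u p v \<Longrightarrow> successively (\<lambda>x y. {x, y} \<in> F) p" for F
    by (simp add: path_def)
  moreover have "path V E u p v \<Longrightarrow> successively (\<lambda>x y. {x, y} \<in> C) p \<Longrightarrow> path V C u p v"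
    by (simp add: path_def)
  ultimately show ?thesis by metis
qed

text \<open>\<open>tdist (outside C) t\<close> is a pseudometric, and two points at distance zero
  have the same distances to all others.\<close>

lemma component_eq_iff:
  assumes "wf_btree t" "u \<in> verts t" "v \<in> verts t" "C \<subseteq> edges t"
  shows "component (verts t) C u = component (verts t) C v \<longleftrightarrow> tdist (outside C) t u v = 0"
    (is "?l \<longleftrightarrow> ?r")
proof -
  let ?V = "verts t"
  have mem: "(\<exists>p. path ?V C x p y) \<longleftrightarrow> tdist (outside C) t x y = 0"
    if "x \<in> ?V" "y \<in> ?V" for x y
  proof -
    show ?thesis
      using btree_path_exists[OF assms(1) that] path_length_tdist[OF assms(1)]
        path_outside_iff[OF assms(4)] by metis
  qed
  have nn: "\<And>x y. tdist (outside C) t x y \<ge> 0"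
    by (intro tdist_nonneg) (auto simp: outside_def)
  have tri: "\<And>x y z. tdist (outside C) t x z \<le> tdist (outside C) t x y + tdist (outside C) t y z"
    by (intro tdist_triangle) (auto simp: outside_def)
  have sub: "y \<in> ?V" if "path ?V C x p y" for x y p
    using that last_in_set[of p] by (auto simp: path_def)
  show ?thesis
  proof
    assume ?l
    have "v \<in> component ?V C v" using mem[of v v] assms by (auto simp: component_def)
    then have "v \<in> component ?V C u" using \<open>?l\<close> by simp
    then show ?r using mem assms by (auto simp: component_def)
  next
    assume ?r
    then have "tdist (outside C) t u w = tdist (outside C) t v w" for w
      using tri[of u w v] tri[of v w u] nn tdist_sym[of "outside C" t u v] by simp
    then have "(\<exists>p. path ?V C u p w) \<longleftrightarrow> (\<exists>p. path ?V C v p w)" for w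
      using mem assms sub by (cases "w \<in> ?V") metis+
    then show ?l by (auto simp: component_def)
  qed
qed

lemma edge_path_length: "wf_btree t \<Longrightarrow> {x, y} \<in> edges t \<Longrightarrow> x \<noteq> y \<Longrightarrow> tdist f t x y = f {x, y}"
  using path_length_tdist[of t x "[x, y]" y f] edges_verts[of "{x, y}" t] by (auto simp: path_def)

lemma edge_two_verts:
  "wf_btree t \<Longrightarrow> e \<in> edges t \<Longrightarrow> \<exists>x y. x \<noteq> y \<and> e = {x, y} \<and> x \<in> verts t \<and> y \<in> verts t"
proof (induction t)
  case (Join t1 t2)
  have "broot t1 \<noteq> broot t2" using Join.prems broot_in_verts[of t1] broot_in_verts[of t2]
    by (auto simp del: broot_in_verts)
  moreover have "e = join_edge t1 t2 \<or> e \<in> edges t1 \<or> e \<in> edges t2" using Join.prems by auto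
  ultimately show ?case
    using Join.IH Join.prems broot_in_verts[of t1] broot_in_verts[of t2]
    by (metis UnI1 UnI2 verts.simps(2) wf_btree.simps(2))
qed auto

text \<open>In a tree no two uncontracted edges become parallel: otherwise the ends of one could be
  joined through \<open>C\<close> and the other edge, which would close a cycle.\<close>

lemma card_contract_edges:
  assumes wf: "wf_btree t" and C: "C \<subseteq> edges t"
  shows "card (contract_edges (verts t) (edges t) C) = card (edges t - C)"
proof -
  let ?c = "component (verts t) C"
  have ends: "x \<in> verts t" "y \<in> verts t" "x \<noteq> y" if "{x, y} \<in> edges t" for x y
    using edge_two_verts[OF wf that] by (auto simp: doubleton_eq_iff)
  have ceq: "?c x = ?c y \<longleftrightarrow> tdist (outside C) t x y = 0" if "x \<in> verts t" "y \<in> verts t" for x y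
    using component_eq_iff[OF wf that C] .
  have edge: "?c x \<noteq> ?c y \<longleftrightarrow> {x, y} \<notin> C" if "{x, y} \<in> edges t" for x y
    using ceq ends[OF that] edge_path_length[OF wf that] by (auto simp: outside_def)
  have "contract_edges (verts t) (edges t) C = (\<lambda>e. ?c ` e) ` (edges t - C)"
  proof (intro equalityI subsetI)
    fix X assume "X \<in> contract_edges (verts t) (edges t) C"
    then show "X \<in> (\<lambda>e. ?c ` e) ` (edges t - C)"
    proof -
      obtain u v where uv: "X = {?c u, ?c v}" "{u, v} \<in> edges t" "?c u \<noteq> ?c v"
        using \<open>X \<in> _\<close> unfolding contract_edges_def by blast
      then show ?thesis using edge[OF uv(2)] by (intro image_eqI[of _ _ "{u, v}"]) auto
    qed
  next
    fix X assume "X \<in> (\<lambda>e. ?c ` e) ` (edges t - C)"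
    then obtain e where e: "e \<in> edges t" "e \<notin> C" "X = ?c ` e" by auto
    then obtain x y where xy: "e = {x, y}" using edge_two_verts[OF wf] by blast
    then have "X = {?c x, ?c y}" "?c x \<noteq> ?c y" using e edge by auto
    then show "X \<in> contract_edges (verts t) (edges t) C"
      using e xy unfolding contract_edges_def mem_Collect_eq
      by (intro exI[of _ x] exI[of _ y]) simp
  qed
  moreover have "inj_on (\<lambda>e. ?c ` e) (edges t - C)"
  proof (rule inj_onI, rule ccontr)
    fix e e' assume e: "e \<in> edges t - C" "e' \<in> edges t - C" "?c ` e = ?c ` e'" "e \<noteq> e'"
    obtain x y where xy: "e = {x, y}" using edge_two_verts[OF wf, of e] e(1) by blast
    \<comment> \<open>The ends of \<open>e'\<close> are named so that \<open>a\<close> falls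
      together with \<open>x\<close> and \<open>b\<close> with \<open>y\<close>.\<close>
    obtain a b where ab: "e' = {a, b}" "?c x = ?c a" "?c y = ?c b"
    proof -
      obtain a b where "e' = {a, b}" using edge_two_verts[OF wf, of e'] e(2) by blast
      moreover from this have "{?c x, ?c y} = {?c a, ?c b}" using e(3) xy by simp
      ultimately show ?thesis
        using that[of a b] that[of b a] unfolding doubleton_eq_iff by (metis insert_commute)
    qed
    have E: "{x, y} \<in> edges t" "{a, b} \<in> edges t" using e xy ab by auto
    \<comment> \<open>\<open>?f\<close> counts passages of \<open>e\<close>. It is at most
      \<open>outside C\<close> because \<open>e\<close> is not in \<open>C\<close>, so moving within
      a component is free, and so is \<open>e'\<close>. The route from \<open>x\<close> over
      \<open>a\<close> and \<open>b\<close> to \<open>y\<close> then costs 0, although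
      \<open>e\<close> itself costs 1.\<close>
    let ?f = "\<lambda>d. if d = e then 1 else 0 :: real"
    have le: "tdist ?f t u v \<le> tdist (outside C) t u v" for u v
    proof -
      have "tdist (\<lambda>d. outside C d - ?f d) t u v \<ge> 0"
        using e by (intro tdist_nonneg) (auto simp: outside_def)
      then show ?thesis by (simp add: tdist_diff)
    qed
    have tri: "tdist ?f t u w \<le> tdist ?f t u v + tdist ?f t v w" for u v w
      by (intro tdist_triangle) auto
    have "tdist ?f t x a \<le> 0" "tdist ?f t b y \<le> 0"
      using le[of x a] le[of b y] ab ceq[of x a] ceq[of y b] ends[OF E(1)] ends[OF E(2)]
        tdist_sym[of "outside C" t y b] by auto
    moreover have "tdist ?f t a b = 0" "tdist ?f t x y = 1"
      using edge_path_length[OF wf E(1), of ?f] edge_path_length[OF wf E(2), of ?f]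
        ends(3)[OF E(1)] ends(3)[OF E(2)] e(4) xy ab(1) by auto
    ultimately show False using tri[of x y a] tri[of a y b] by simp
  qed
  ultimately show ?thesis by (simp add: card_image)
qed

lemma contraction_value_tree:
  assumes "wf_btree t" "C \<subseteq> edges t"
  shows "contraction_value (verts t) (edges t) C = int (card C)"
  using card_contract_edges[OF assms] assms(2) card_mono[OF finite_edges assms(2)]
  by (simp add: contraction_value_def card_Diff_subset finite_subset[OF assms(2)])

text \<open>A missing edge leaves its two ends at \<open>outside\<close>-distance 1, so being
  disconnected just means being a proper subset.\<close>

lemma connected_contraction_iff:
  assumes wf: "wf_btree t" and C: "C \<subseteq> edges t"
  shows "connected_graph (verts t) C \<longleftrightarrow> C = edges t"
proof
  assume conn: "connected_graph (verts t) C"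
  show "C = edges t"
  proof (rule ccontr)
    assume "C \<noteq> edges t"
    then obtain e where e: "e \<in> edges t" "e \<notin> C" using C by blast
    then obtain x y where xy: "e = {x, y}" "x \<noteq> y" "x \<in> verts t" "y \<in> verts t"
      using edge_two_verts[OF wf] by blast
    obtain p where p: "path (verts t) C x p y" using conn xy by (auto simp: connected_graph_def)
    then have "tdist (outside C) t x y = 0"
      using path_length_tdist[OF wf] path_outside_iff[OF C] by metis
    moreover have "tdist (outside C) t x y = 1"
      using edge_path_length[OF wf, of x y] e xy by (simp add: outside_def)
    ultimately show False by simp
  qed
next
  assume "C = edges t"
  then show "connected_graph (verts t) C"
    using btree_path_exists[OF wf] broot_in_verts[of t]
    unfolding connected_graph_def by (metis empty_iff)
qed

lemma weak_contraction_tree: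
  assumes wf: "wf_btree t"
  shows "weak_contraction (verts t) (edges t) l (\<lambda>x. x / \<alpha> - \<beta>) C \<longleftrightarrow>
    C \<subseteq> edges t \<and> C \<noteq> edges t \<and>
    (\<forall>u\<in>verts t. \<forall>v\<in>verts t. tdist (contracted_length l C) t u v = 0 \<or>
       tdist (\<lambda>e. l e / \<alpha> - contracted_length l C e) t u v \<le> \<beta>)"
proof -
  have "(tdist (contracted_length l C) t u v \<ge> tdist l t u v / \<alpha> - \<beta>) \<longleftrightarrow>
      tdist (\<lambda>e. l e / \<alpha> - contracted_length l C e) t u v \<le> \<beta>" for u v
    by (auto simp: tdist_diff[of "\<lambda>e. l e / \<alpha>"] tdist_divide)
  moreover have "(\<forall>u\<in>verts t. \<forall>v\<in>verts t.
      dist_graph (verts t) (edges t) (contracted_length l C) u v = 0 \<or>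
      dist_graph (verts t) (edges t) (contracted_length l C) u v
        \<ge> dist_graph (verts t) (edges t) l u v / \<alpha> - \<beta>) \<longleftrightarrow>
    (\<forall>u\<in>verts t. \<forall>v\<in>verts t. tdist (contracted_length l C) t u v = 0 \<or>
       tdist (contracted_length l C) t u v \<ge> tdist l t u v / \<alpha> - \<beta>)"
    by (intro ball_cong refl) (simp add: dist_graph_tdist[OF wf])
  ultimately show ?thesis
    using connected_contraction_iff[OF wf, of C] unfolding weak_contraction_def by auto
qed

section \<open>The dynamic program\<close>

locale contraction_dp =
  fixes l :: "'a set \<Rightarrow> real" and \<alpha> \<beta> L :: real
  assumes alpha: "\<alpha> \<ge> 1" and beta: "\<beta> \<ge> 0"
begin

definition contr :: "'a set set \<Rightarrow> 'a btree \<Rightarrow> 'a \<Rightarrow> 'a \<Rightarrow> bool" where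
  "contr C t u v \<longleftrightarrow> tdist (contracted_length l C) t u v = 0"

definition weight :: "'a set set \<Rightarrow> 'a btree \<Rightarrow> 'a \<Rightarrow> 'a \<Rightarrow> real" where
  "weight C = tdist (\<lambda>e. l e / \<alpha> - contracted_length l C e)"

definition depth :: "'a btree \<Rightarrow> 'a \<Rightarrow> real" where
  "depth t u = tdist (\<lambda>e. l e / \<alpha>) t (broot t) u"

text \<open>\<open>extA\<close> and \<open>extB\<close> carry the two maxima of the lower tree over
  the joining edge of length \<open>w\<close>; \<open>f\<close> tells whether this edge is
  contracted. If it is not, no contracted path enters the lower tree: the value 0 is that of the
  trivial path, neutral as \<open>maxA\<close> is never negative, and all lower paths count for
  \<open>extB\<close>.\<close>

definition extA :: "bool \<Rightarrow> real \<Rightarrow> real \<Rightarrow> real" where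
  "extA f w a = (if f then a + w / \<alpha> else 0)"

definition extB :: "bool \<Rightarrow> real \<Rightarrow> real \<Rightarrow> real \<Rightarrow> real" where
  "extB f w a b = (if f then b + w / \<alpha> else max a b - (w - w / \<alpha>))"

text \<open>The sum \<open>a + a'\<close> is left free: two contracted halves form a contracted
  path, which is exempt from the bound.\<close>

definition compatible :: "real \<Rightarrow> real \<Rightarrow> real \<Rightarrow> real \<Rightarrow> bool" where
  "compatible a b a' b' \<longleftrightarrow> a + b' \<le> \<beta> \<and> b + a' \<le> \<beta> \<and> b + b' \<le> \<beta>"

text \<open>\<open>maxA\<close> is the maximal weight of a contracted path from the root, and \<open>maxB\<close> that of the other
  paths from the root.  If there are none of the latter, \<open>maxB\<close> is \<open>maxA - L\<close>, which is too small to
  matter when \<open>L\<close> bounds the total length of the tree.\<close>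

fun maxA :: "'a set set \<Rightarrow> 'a btree \<Rightarrow> real" where
  "maxA C (Leaf v) = 0"
| "maxA C (Join t1 t2) =
     max (maxA C t1) (extA (join_edge t1 t2 \<in> C) (l (join_edge t1 t2)) (maxA C t2))"

fun maxB :: "'a set set \<Rightarrow> 'a btree \<Rightarrow> real" where
  "maxB C (Leaf v) = - L"
| "maxB C (Join t1 t2) =
     max (maxB C t1) (extB (join_edge t1 t2 \<in> C) (l (join_edge t1 t2)) (maxA C t2) (maxB C t2))"

fun valid :: "'a set set \<Rightarrow> 'a btree \<Rightarrow> bool" where
  "valid C (Leaf v) \<longleftrightarrow> True"
| "valid C (Join t1 t2) \<longleftrightarrow> valid C t1 \<and> valid C t2 \<and>
     compatible (maxA C t1) (maxB C t1)
       (extA (join_edge t1 t2 \<in> C) (l (join_edge t1 t2)) (maxA C t2))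
       (extB (join_edge t1 t2 \<in> C) (l (join_edge t1 t2)) (maxA C t2) (maxB C t2))"

abbreviation pos_lengths :: "'a btree \<Rightarrow> bool" where
  "pos_lengths t \<equiv> \<forall>e\<in>edges t. l e > 0"

section \<open>Validity of an edge set in terms of the two maxima\<close>

lemma contr_self [simp]: "contr C t u u"
  by (simp add: contr_def)

lemma weight_self [simp]: "weight C t u u = 0"
  by (simp add: weight_def)

lemma contr_sym: "contr C t u v \<longleftrightarrow> contr C t v u"
  by (simp add: contr_def tdist_sym)

lemma weight_sym: "weight C t u v = weight C t v u"
  by (simp add: weight_def tdist_sym)

text \<open>For positive lengths a sum of contracted lengths vanishes only if every summand
  does.\<close>

lemma contr_Join:
  assumes "wf_btree (Join t1 t2)" "pos_lengths (Join t1 t2)"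
  shows "u \<in> verts t1 \<Longrightarrow> v \<in> verts t1 \<Longrightarrow> contr C (Join t1 t2) u v \<longleftrightarrow> contr C t1 u v"
    and "u \<in> verts t2 \<Longrightarrow> v \<in> verts t2 \<Longrightarrow> contr C (Join t1 t2) u v \<longleftrightarrow> contr C t2 u v"
    and "u \<in> verts t1 \<Longrightarrow> v \<in> verts t2 \<Longrightarrow> contr C (Join t1 t2) u v \<longleftrightarrow>
      contr C t1 u (broot t1) \<and> join_edge t1 t2 \<in> C \<and> contr C t2 (broot t2) v"
proof -
  let ?f = "contracted_length l C"
  have "tdist ?f t1 u (broot t1) \<ge> 0" "tdist ?f t2 (broot t2) v \<ge> 0" for u v
    using assms(2) by (auto intro!: tdist_nonneg simp: contracted_length_def less_imp_le)
  moreover have "?f (join_edge t1 t2) \<ge> 0" "?f (join_edge t1 t2) = 0 \<longleftrightarrow> join_edge t1 t2 \<in> C"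
    using assms(2) by (auto simp: contracted_length_def)
  ultimately have "tdist ?f t1 u (broot t1) + ?f (join_edge t1 t2) + tdist ?f t2 (broot t2) v = 0
      \<longleftrightarrow> tdist ?f t1 u (broot t1) = 0 \<and> join_edge t1 t2 \<in> C \<and> tdist ?f t2 (broot t2) v = 0"
    for u v by (smt (verit, best))
  then show "u \<in> verts t1 \<Longrightarrow> v \<in> verts t2 \<Longrightarrow> contr C (Join t1 t2) u v \<longleftrightarrow>
      contr C t1 u (broot t1) \<and> join_edge t1 t2 \<in> C \<and> contr C t2 (broot t2) v"
    using assms(1) by (auto simp: contr_def)
qed (use assms(1) in \<open>auto simp: contr_def\<close>)

lemma weight_Join:
  assumes "wf_btree (Join t1 t2)"
  shows "u \<in> verts t1 \<Longrightarrow> v \<in> verts t1 \<Longrightarrow> weight C (Join t1 t2) u v = weight C t1 u v"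
    and "u \<in> verts t2 \<Longrightarrow> v \<in> verts t2 \<Longrightarrow> weight C (Join t1 t2) u v = weight C t2 u v"
    and "u \<in> verts t1 \<Longrightarrow> v \<in> verts t2 \<Longrightarrow> weight C (Join t1 t2) u v =
      weight C t1 u (broot t1) +
      (l (join_edge t1 t2) / \<alpha> - (if join_edge t1 t2 \<in> C then 0 else l (join_edge t1 t2))) +
      weight C t2 (broot t2) v"
  using assms by (auto simp: weight_def contracted_length_def)

lemma root_Join:
  assumes "wf_btree (Join t1 t2)" "pos_lengths (Join t1 t2)"
  shows "u \<in> verts t1 \<Longrightarrow> contr C (Join t1 t2) (broot t1) u \<longleftrightarrow> contr C t1 (broot t1) u"
    and "u \<in> verts t2 \<Longrightarrow> contr C (Join t1 t2) (broot t1) u \<longleftrightarrow>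
      join_edge t1 t2 \<in> C \<and> contr C t2 (broot t2) u"
    and "u \<in> verts t1 \<Longrightarrow> weight C (Join t1 t2) (broot t1) u = weight C t1 (broot t1) u"
    and "u \<in> verts t2 \<Longrightarrow> weight C (Join t1 t2) (broot t1) u = weight C t2 (broot t2) u +
      (l (join_edge t1 t2) / \<alpha> - (if join_edge t1 t2 \<in> C then 0 else l (join_edge t1 t2)))"
  by (simp_all add: contr_Join[OF assms] weight_Join[OF assms(1)])

lemma depth_Join:
  assumes "wf_btree (Join t1 t2)"
  shows "u \<in> verts t1 \<Longrightarrow> depth (Join t1 t2) u = depth t1 u"
    and "u \<in> verts t2 \<Longrightarrow> depth (Join t1 t2) u = depth t2 u + l (join_edge t1 t2) / \<alpha>"
  using assms by (auto simp: depth_def)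

lemma depth_nonneg: "pos_lengths t \<Longrightarrow> depth t u \<ge> 0"
  unfolding depth_def using alpha by (intro tdist_nonneg) (auto intro: less_imp_le)

lemma ball_verts_Join:
  "(\<forall>u\<in>verts (Join t1 t2). P u) \<longleftrightarrow> (\<forall>u\<in>verts t1. P u) \<and> (\<forall>u\<in>verts t2. P u)"
  by auto

text \<open>Describing a maximum by its upper bounds avoids maxima over sets and lets later proofs
  fix one path at a time.\<close>

lemma maxA_le_iff:
  "wf_btree t \<Longrightarrow> pos_lengths t \<Longrightarrow>
   maxA C t \<le> x \<longleftrightarrow> (\<forall>u\<in>verts t. contr C t (broot t) u \<longrightarrow> weight C t (broot t) u \<le> x)"
proof (induction t arbitrary: x)
  case (Leaf v)
  then show ?case by (auto simp: weight_def)
next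
  case (Join t1 t2)
  let ?e = "join_edge t1 t2"
  have IH: "maxA C t1 \<le> y \<longleftrightarrow>
      (\<forall>u\<in>verts t1. contr C t1 (broot t1) u \<longrightarrow> weight C t1 (broot t1) u \<le> y)"
    "maxA C t2 \<le> y \<longleftrightarrow>
      (\<forall>u\<in>verts t2. contr C t2 (broot t2) u \<longrightarrow> weight C t2 (broot t2) u \<le> y)" for y
    using Join by auto
  \<comment> \<open>The root contributes weight 0, so every upper bound is nonnegative and absorbs
    the 0 that \<open>extA\<close> yields for an uncontracted edge.\<close>
  have "maxA C t1 \<le> x \<Longrightarrow> 0 \<le> x" using IH(1)[of x] by (metis broot_in_verts contr_self weight_self)
  then have "maxA C (Join t1 t2) \<le> x \<longleftrightarrow> maxA C t1 \<le> x \<and> (?e \<in> C \<longrightarrow> maxA C t2 \<le> x - l ?e / \<alpha>)"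
    by (auto simp: extA_def)
  also have "\<dots> \<longleftrightarrow> (\<forall>u\<in>verts (Join t1 t2). contr C (Join t1 t2) (broot (Join t1 t2)) u \<longrightarrow>
      weight C (Join t1 t2) (broot (Join t1 t2)) u \<le> x)"
    unfolding IH ball_verts_Join by (auto simp: root_Join[OF Join.prems] le_diff_eq)
  finally show ?case .
qed

text \<open>The condition on \<open>maxA C t - L\<close> is what the placeholder \<open>- L\<close>
  at the leaves turns into: along contracted edges it grows by the same increments as
  \<open>maxA\<close>.\<close>

lemma maxB_le_iff:
  "wf_btree t \<Longrightarrow> pos_lengths t \<Longrightarrow> L \<ge> 0 \<Longrightarrow>
   maxB C t \<le> x \<longleftrightarrow> maxA C t - L \<le> x \<and>
     (\<forall>u\<in>verts t. \<not> contr C t (broot t) u \<longrightarrow> weight C t (broot t) u \<le> x)"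
proof (induction t arbitrary: x)
  case (Leaf v)
  then show ?case by (auto simp: weight_def)
next
  case (Join t1 t2)
  let ?e = "join_edge t1 t2"
  have IH: "maxB C t1 \<le> y \<longleftrightarrow> maxA C t1 - L \<le> y \<and>
      (\<forall>u\<in>verts t1. \<not> contr C t1 (broot t1) u \<longrightarrow> weight C t1 (broot t1) u \<le> y)"
    "maxB C t2 \<le> y \<longleftrightarrow> maxA C t2 - L \<le> y \<and>
      (\<forall>u\<in>verts t2. \<not> contr C t2 (broot t2) u \<longrightarrow> weight C t2 (broot t2) u \<le> y)" for y
    using Join by auto
  have A2: "maxA C t2 \<le> y \<longleftrightarrow>
      (\<forall>u\<in>verts t2. contr C t2 (broot t2) u \<longrightarrow> weight C t2 (broot t2) u \<le> y)" for y
    using Join.prems by (intro maxA_le_iff) auto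
  have A1: "maxA C t1 \<ge> 0"
    using maxA_le_iff[of t1 C "maxA C t1"] Join.prems
    by (metis UnI1 broot_in_verts contr_self dual_order.refl edges.simps(2) insertI2 weight_self
        wf_btree.simps(2))
  show ?case
  proof (cases "?e \<in> C")
    case True
    then have "maxB C (Join t1 t2) \<le> x \<longleftrightarrow> maxB C t1 \<le> x \<and> maxB C t2 \<le> x - l ?e / \<alpha>"
      by (auto simp: extB_def)
    also have "\<dots> \<longleftrightarrow> maxA C (Join t1 t2) - L \<le> x \<and>
        (\<forall>u\<in>verts t1. \<not> contr C t1 (broot t1) u \<longrightarrow> weight C t1 (broot t1) u \<le> x) \<and>
        (\<forall>u\<in>verts t2. \<not> contr C t2 (broot t2) u \<longrightarrow> weight C t2 (broot t2) u \<le> x - l ?e / \<alpha>)"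
      using True unfolding IH by (auto simp: extA_def)
    finally show ?thesis
      unfolding ball_verts_Join using True
      by (auto simp: root_Join[OF Join.prems(1,2)] le_diff_eq)
  next
    case False
    let ?y = "x + (l ?e - l ?e / \<alpha>)"
    have "maxB C (Join t1 t2) \<le> x \<longleftrightarrow> maxB C t1 \<le> x \<and> maxA C t2 \<le> ?y \<and> maxB C t2 \<le> ?y"
      using False by (auto simp: extB_def)
    also have "\<dots> \<longleftrightarrow> maxA C (Join t1 t2) - L \<le> x \<and>
        (\<forall>u\<in>verts t1. \<not> contr C t1 (broot t1) u \<longrightarrow> weight C t1 (broot t1) u \<le> x) \<and>
        (\<forall>u\<in>verts t2. weight C t2 (broot t2) u \<le> ?y)"
    proof -
      \<comment> \<open>Behind an uncontracted edge the placeholder of \<open>t2\<close> is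
        swallowed by \<open>maxA C t2\<close>, as \<open>L \<ge> 0\<close>, and both kinds of paths
        count alike.\<close>
      have "maxA C t2 \<le> ?y \<and> maxB C t2 \<le> ?y \<longleftrightarrow> (\<forall>u\<in>verts t2. weight C t2 (broot t2) u \<le> ?y)"
        unfolding IH(2) using \<open>L \<ge> 0\<close> A2[of ?y] by force
      moreover have "maxA C (Join t1 t2) = maxA C t1" using False A1 by (simp add: extA_def)
      ultimately show ?thesis using IH(1)[of x] by auto
    qed
    finally show ?thesis
      unfolding ball_verts_Join using False
      by (auto simp: root_Join[OF Join.prems(1,2)] diff_le_eq le_diff_eq add_diff_eq diff_add_eq)
  qed
qed

lemma maxA_nonneg: "wf_btree t \<Longrightarrow> pos_lengths t \<Longrightarrow> maxA C t \<ge> 0"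
  using maxA_le_iff[of t C "maxA C t"] by (metis broot_in_verts contr_self order.refl weight_self)

text \<open>As \<alpha> \<ge> 1, an edge weighs at most its length. This later shows that the
  placeholder never violates \<open>compatible\<close>.\<close>

lemma maxA_le_sum: "wf_btree t \<Longrightarrow> pos_lengths t \<Longrightarrow> maxA C t \<le> sum l (edges t)"
proof (induction t)
  case (Join t1 t2)
  let ?e = "join_edge t1 t2"
  have "sum l (edges (Join t1 t2)) = l ?e + sum l (edges t1) + sum l (edges t2)"
    using edges_disjoint[of t1 t2] Join.prems(1) by (simp add: sum.union_disjoint)
  moreover have "maxA C t1 \<le> sum l (edges t1)" "maxA C t2 \<le> sum l (edges t2)" "0 < l ?e"
    using Join by auto
  moreover have "0 \<le> maxA C t1" "0 \<le> maxA C t2" using Join.prems by (auto intro: maxA_nonneg)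
  moreover have "l ?e / \<alpha> \<le> l ?e" using \<open>0 < l ?e\<close> alpha by (simp add: divide_le_eq)
  ultimately show ?case by (auto simp: extA_def)
qed simp

text \<open>Pairs within one subtree are covered by induction. A pair across the join splits into
  two paths to the roots, and the worst pairs are those that attain the maxima; the combinations of
  contracted and other halves, without the exempt one, give \<open>compatible\<close>.\<close>

lemma valid_iff:
  assumes "wf_btree t" "pos_lengths t" "sum l (edges t) \<le> L"
  shows "valid C t \<longleftrightarrow> (\<forall>u\<in>verts t. \<forall>v\<in>verts t. contr C t u v \<or> weight C t u v \<le> \<beta>)"
  using assms
proof (induction t)
  case (Leaf v)
  then show ?case by (auto simp: contr_def)
next
  case (Join t1 t2)
  let ?e = "join_edge t1 t2" let ?w = "l ?e"
  let ?A1 = "maxA C t1" let ?A2 = "maxA C t2" let ?B1 = "maxB C t1" let ?B2 = "maxB C t2"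
  let ?Z1 = "contr C t1 (broot t1)" let ?W1 = "weight C t1 (broot t1)"
  let ?Z2 = "contr C t2 (broot t2)" let ?W2 = "weight C t2 (broot t2)"
  note wf = Join.prems(1) and pos = Join.prems(2)
  have sum: "sum l (edges (Join t1 t2)) = ?w + sum l (edges t1) + sum l (edges t2)"
    using edges_disjoint[of t1 t2] wf by (simp add: sum.union_disjoint)
  have wfs: "wf_btree t1" "wf_btree t2" "pos_lengths t1" "pos_lengths t2" "0 < ?w"
    using wf pos by auto
  have nn: "0 \<le> sum l (edges t1)" "0 \<le> sum l (edges t2)"
    using wfs by (auto intro!: sum_nonneg simp: less_imp_le)
  have L: "L \<ge> 0" "sum l (edges t1) \<le> L" "sum l (edges t2) \<le> L"
    using Join.prems(3) sum nn wfs by linarith+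
  have wa: "?w / \<alpha> \<le> ?w" "0 \<le> ?w / \<alpha>" using wfs alpha by (auto simp: divide_le_eq)
  have A: "0 \<le> ?A1" "0 \<le> ?A2" "?A1 + ?A2 + ?w \<le> L"
    using maxA_nonneg maxA_le_sum[of t1 C] maxA_le_sum[of t2 C] wfs Join.prems(3) sum by auto
  note A1 = maxA_le_iff[OF wfs(1,3)] and A2 = maxA_le_iff[OF wfs(2,4)]
  note B1 = maxB_le_iff[OF wfs(1,3) L(1)] and B2 = maxB_le_iff[OF wfs(2,4) L(1)]
  let ?P = "\<lambda>u v. contr C (Join t1 t2) u v \<or> weight C (Join t1 t2) u v \<le> \<beta>"
  let ?V1 = "verts t1" let ?V2 = "verts t2"
  have psym: "?P u v \<longleftrightarrow> ?P v u" for u v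
    using contr_sym weight_sym by metis
  have IH1: "valid C t1 \<longleftrightarrow> (\<forall>u\<in>?V1. \<forall>v\<in>?V1. ?P u v)"
    using Join.IH(1)[OF wfs(1,3) L(2)] contr_Join(1)[OF wf pos] weight_Join(1)[OF wf] by simp
  have IH2: "valid C t2 \<longleftrightarrow> (\<forall>u\<in>?V2. \<forall>v\<in>?V2. ?P u v)"
    using Join.IH(2)[OF wfs(2,4) L(3)] contr_Join(2)[OF wf pos] weight_Join(2)[OF wf] by simp
  have cross: "compatible ?A1 ?B1 (extA (?e \<in> C) ?w ?A2) (extB (?e \<in> C) ?w ?A2 ?B2) \<longleftrightarrow>
      (\<forall>u\<in>?V1. \<forall>v\<in>?V2. ?P u v)" if v1: "valid C t1"
  proof (cases "?e \<in> C")
    case True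
    have "compatible ?A1 ?B1 (?A2 + ?w / \<alpha>) (?B2 + ?w / \<alpha>) \<longleftrightarrow>
        (\<forall>u\<in>?V1. \<forall>v\<in>?V2. ?Z1 u \<and> ?Z2 v \<or> ?W1 u + ?w / \<alpha> + ?W2 v \<le> \<beta>)" (is "?l \<longleftrightarrow> ?r")
    proof
      assume ?l
      then have c: "?A1 + ?B2 + ?w / \<alpha> \<le> \<beta>" "?B1 + ?A2 + ?w / \<alpha> \<le> \<beta>" "?B1 + ?B2 + ?w / \<alpha> \<le> \<beta>"
        by (auto simp: compatible_def algebra_simps)
      show ?r
      proof (intro ballI)
        fix u v assume uv: "u \<in> ?V1" "v \<in> ?V2"
        have "?Z1 u \<Longrightarrow> ?W1 u \<le> ?A1" "\<not> ?Z1 u \<Longrightarrow> ?W1 u \<le> ?B1"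
          "?Z2 v \<Longrightarrow> ?W2 v \<le> ?A2" "\<not> ?Z2 v \<Longrightarrow> ?W2 v \<le> ?B2"
          using uv A1[of C ?A1] A2[of C ?A2] B1[of C ?B1] B2[of C ?B2] by auto
        then show "?Z1 u \<and> ?Z2 v \<or> ?W1 u + ?w / \<alpha> + ?W2 v \<le> \<beta>"
          using c by linarith
      qed
    next
      assume r: ?r
      \<comment> \<open>A sum of two maxima is bounded by fixing one path at a time:
        \<open>B2\<close> replaces the maximum over \<open>t2\<close> by a single \<open>v\<close>,
        and \<open>A1\<close> then the one over \<open>t1\<close>.\<close>
      have 1: "?B2 \<le> \<beta> - ?w / \<alpha> - ?A1"
      proof (subst B2, intro conjI ballI impI)
        \<comment> \<open>The placeholder case: \<open>?A1 + ?A2 + ?w \<le> L\<close> makes the sum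
          at most 0, hence at most \<beta>.\<close>
        show "?A2 - L \<le> \<beta> - ?w / \<alpha> - ?A1" using A wa beta by linarith
        fix v assume v: "v \<in> ?V2" "\<not> ?Z2 v"
        have "?A1 \<le> \<beta> - ?w / \<alpha> - ?W2 v"
          by (subst A1) (use r v in force)
        then show "?W2 v \<le> \<beta> - ?w / \<alpha> - ?A1" by linarith
      qed
      have 2: "?B1 \<le> \<beta> - ?w / \<alpha> - ?A2"
      proof (subst B1, intro conjI ballI impI)
        show "?A1 - L \<le> \<beta> - ?w / \<alpha> - ?A2" using A wa beta by linarith
        fix u assume u: "u \<in> ?V1" "\<not> ?Z1 u"
        have "?A2 \<le> \<beta> - ?w / \<alpha> - ?W1 u"
          by (subst A2) (use r u in force)
        then show "?W1 u \<le> \<beta> - ?w / \<alpha> - ?A2" by linarith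
      qed
      have 3: "?B1 \<le> \<beta> - ?w / \<alpha> - ?B2"
      proof (subst B1, intro conjI ballI impI)
        show "?A1 - L \<le> \<beta> - ?w / \<alpha> - ?B2" using 1 L by linarith
        fix u assume u: "u \<in> ?V1" "\<not> ?Z1 u"
        have "?B2 \<le> \<beta> - ?w / \<alpha> - ?W1 u"
        proof (subst B2, intro conjI ballI impI)
          have "?A2 \<le> \<beta> - ?w / \<alpha> - ?W1 u"
            by (subst A2) (use r u in force)
          then show "?A2 - L \<le> \<beta> - ?w / \<alpha> - ?W1 u" using L by linarith
        qed (use r u in force)
        then show "?W1 u \<le> \<beta> - ?w / \<alpha> - ?B2" by linarith
      qed
      from 1 2 3 show ?l by (simp add: compatible_def algebra_simps)
    qed
    then show ?thesis
      using True contr_Join(3)[OF wf pos] weight_Join(3)[OF wf]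
        contr_sym[of C t1 _ "broot t1"] weight_sym[of C t1 _ "broot t1"]
      by (simp add: extA_def extB_def)
  next
    case False
    let ?k = "?w - ?w / \<alpha>"
    have "compatible ?A1 ?B1 0 (max ?A2 ?B2 - ?k) \<longleftrightarrow>
        (\<forall>u\<in>?V1. \<forall>v\<in>?V2. ?W1 u + ?W2 v \<le> \<beta> + ?k)" (is "?l \<longleftrightarrow> ?r")
    proof
      assume ?l
      then have c: "?A1 + max ?A2 ?B2 \<le> \<beta> + ?k" "?B1 + max ?A2 ?B2 \<le> \<beta> + ?k"
        by (auto simp: compatible_def algebra_simps)
      show ?r
      proof (intro ballI)
        fix u v assume uv: "u \<in> ?V1" "v \<in> ?V2"
        have "?Z1 u \<Longrightarrow> ?W1 u \<le> ?A1" "\<not> ?Z1 u \<Longrightarrow> ?W1 u \<le> ?B1"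
          "?Z2 v \<Longrightarrow> ?W2 v \<le> ?A2" "\<not> ?Z2 v \<Longrightarrow> ?W2 v \<le> ?B2"
          using uv A1[of C ?A1] A2[of C ?A2] B1[of C ?B1] B2[of C ?B2] by auto
        then show "?W1 u + ?W2 v \<le> \<beta> + ?k" using c by linarith
      qed
    next
      assume r: ?r
      \<comment> \<open>With the joining edge outside \<open>C\<close> no pair across it is exempt,
        so only the maximum over all paths of \<open>t2\<close> matters, contracted or not.\<close>
      have X: "max ?A2 ?B2 \<le> y \<longleftrightarrow> (\<forall>v\<in>?V2. ?W2 v \<le> y)" for y
        using A2[of C y] B2[of C y] L by force
      have 1: "?A1 + max ?A2 ?B2 \<le> \<beta> + ?k"
      proof -
        have "max ?A2 ?B2 \<le> \<beta> + ?k - ?A1"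
        proof (subst X, intro ballI)
          fix v assume v: "v \<in> ?V2"
          have "?A1 \<le> \<beta> + ?k - ?W2 v" by (subst A1) (use r v in force)
          then show "?W2 v \<le> \<beta> + ?k - ?A1" by linarith
        qed
        then show ?thesis by linarith
      qed
      have 2: "?B1 \<le> \<beta> + ?k - max ?A2 ?B2"
      proof (subst B1, intro conjI ballI impI)
        show "?A1 - L \<le> \<beta> + ?k - max ?A2 ?B2" using 1 L by linarith
        fix u assume u: "u \<in> ?V1" "\<not> ?Z1 u"
        have "max ?A2 ?B2 \<le> \<beta> + ?k - ?W1 u" by (subst X) (use r u in force)
        then show "?W1 u \<le> \<beta> + ?k - max ?A2 ?B2" by linarith
      qed
      \<comment> \<open>As \<open>extA\<close> is 0 here, the middle condition of
        \<open>compatible\<close> concerns \<open>t1\<close> alone. It follows from the validity of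
        \<open>t1\<close>, applied to pairs that contain its root, which is why \<open>cross\<close>
        assumes \<open>v1\<close>.\<close>
      have 3: "?B1 \<le> \<beta>"
      proof (subst B1, intro conjI ballI impI)
        show "?A1 - L \<le> \<beta>" using A wa wfs beta by linarith
        fix u assume u: "u \<in> ?V1" "\<not> ?Z1 u"
        then show "?W1 u \<le> \<beta>"
          using v1 Join.IH(1)[OF wfs(1,3) L(2)] broot_in_verts[of t1] by blast
      qed
      from 1 2 3 show ?l by (simp add: compatible_def)
    qed
    moreover have "?P u v \<longleftrightarrow> ?W1 u + ?W2 v \<le> \<beta> + ?k" if "u \<in> ?V1" "v \<in> ?V2" for u v
      using that False contr_Join(3)[OF wf pos that] weight_Join(3)[OF wf that]
        weight_sym[of C t1 u "broot t1"] by auto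
    ultimately show ?thesis using False by (simp add: extA_def extB_def)
  qed
  have "(\<forall>u\<in>verts (Join t1 t2). \<forall>v\<in>verts (Join t1 t2). ?P u v) \<longleftrightarrow>
      (\<forall>u\<in>?V1. \<forall>v\<in>?V1. ?P u v) \<and> (\<forall>u\<in>?V2. \<forall>v\<in>?V2. ?P u v) \<and>
      (\<forall>u\<in>?V1. \<forall>v\<in>?V2. ?P u v) \<and> (\<forall>v\<in>?V2. \<forall>u\<in>?V1. ?P v u)"
    unfolding ball_verts_Join by blast
  also have "(\<forall>v\<in>?V2. \<forall>u\<in>?V1. ?P v u) \<longleftrightarrow> (\<forall>u\<in>?V1. \<forall>v\<in>?V2. ?P u v)"
    using psym by blast
  finally show ?case
    unfolding valid.simps IH1[symmetric] IH2[symmetric] using cross by argo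
qed

lemma weak_contraction_iff_valid:
  assumes "wf_btree t" "pos_lengths t" "sum l (edges t) \<le> L"
  shows "weak_contraction (verts t) (edges t) l (\<lambda>x. x / \<alpha> - \<beta>) C \<longleftrightarrow>
    C \<subseteq> edges t \<and> C \<noteq> edges t \<and> valid C t"
  using weak_contraction_tree[OF assms(1)] valid_iff[OF assms] by (simp add: contr_def weight_def)

lemma restrict_cong:
  assumes "\<And>e. e \<in> edges t \<Longrightarrow> e \<in> C \<longleftrightarrow> e \<in> C'"
  shows "maxA C t = maxA C' t" "maxB C t = maxB C' t" "valid C t = valid C' t"
proof -
  have "maxA C t = maxA C' t \<and> maxB C t = maxB C' t \<and> valid C t = valid C' t"
    using assms by (induction t) auto
  then show "maxA C t = maxA C' t" "maxB C t = maxB C' t" "valid C t = valid C' t" by auto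
qed

subsection \<open>Tables\<close>

text \<open>A table has entries for pairs \<open>(u, k)\<close> with \<open>P u k\<close>, where \<open>u\<close> stands for the bound \<open>depth t u\<close>
  on \<open>maxA\<close> and \<open>k\<close> is the number of contracted edges.  The value \<open>b u k\<close> bounds \<open>maxB\<close>.\<close>

definition table :: "'a btree \<Rightarrow> ('a \<Rightarrow> nat \<Rightarrow> bool) \<Rightarrow> ('a \<Rightarrow> nat \<Rightarrow> real) \<Rightarrow>
    ('a \<Rightarrow> nat \<Rightarrow> real) \<Rightarrow> ('a \<Rightarrow> nat \<Rightarrow> 'a set set) \<Rightarrow> bool" where
  "table t P a b S \<longleftrightarrow>
     (\<forall>u k. P u k \<longrightarrow> u \<in> verts t \<and> a u k = depth t u \<and> S u k \<subseteq> edges t \<and> card (S u k) = k \<and>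
        valid (S u k) t \<and> maxA (S u k) t \<le> a u k \<and> maxB (S u k) t \<le> b u k) \<and>
     (\<forall>C. C \<subseteq> edges t \<longrightarrow> valid C t \<longrightarrow>
        (\<exists>u. P u (card C) \<and> a u (card C) \<le> maxA C t \<and> b u (card C) \<le> maxB C t))"

lemma table_sound:
  assumes "table t P a b S" "P u k"
  shows "u \<in> verts t" "a u k = depth t u" "S u k \<subseteq> edges t" "card (S u k) = k"
    "valid (S u k) t" "maxA (S u k) t \<le> a u k" "maxB (S u k) t \<le> b u k"
  using conjunct1[OF assms(1)[unfolded table_def], rule_format, OF assms(2)] by blast+

lemma table_complete:
  assumes "table t P a b S" "C \<subseteq> edges t" "valid C t"
  shows "\<exists>u. P u (card C) \<and> a u (card C) \<le> maxA C t \<and> b u (card C) \<le> maxB C t"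
  using conjunct2[OF assms(1)[unfolded table_def], rule_format, OF assms(2,3)] .

lemma table_Leaf:
  "table (Leaf v) (\<lambda>u k. u = v \<and> k = 0) (\<lambda>_ _. 0) (\<lambda>_ _. - L) (\<lambda>_ _. {})"
  by (auto simp: table_def depth_def)

text \<open>Memory outside of \<open>P\<close> holds arbitrary values, so agreement is asked for on
  \<open>P\<close> only.\<close>

lemma table_mono:
  assumes "table t P a b S" "\<And>u k. P u k \<longleftrightarrow> P' u k"
    "\<And>u k. P u k \<Longrightarrow> a' u k = a u k \<and> b' u k = b u k \<and> S' u k = S u k"
  shows "table t P' a' b' S'"
proof -
  have PP: "P' = P" using assms(2) by (auto simp: fun_eq_iff)
  show ?thesis
    unfolding table_def PP
  proof (rule conjI; intro allI impI)
    fix u k assume P: "P u k"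
    show "u \<in> verts t \<and> a' u k = depth t u \<and> S' u k \<subseteq> edges t \<and> card (S' u k) = k \<and>
        valid (S' u k) t \<and> maxA (S' u k) t \<le> a' u k \<and> maxB (S' u k) t \<le> b' u k"
      using table_sound[OF assms(1) P] assms(3)[OF P] by simp
  next
    fix C assume "C \<subseteq> edges t" "valid C t"
    then obtain u where "P u (card C)" "a u (card C) \<le> maxA C t" "b u (card C) \<le> maxB C t"
      using table_complete[OF assms(1)] by blast
    then show "\<exists>u. P u (card C) \<and> a' u (card C) \<le> maxA C t \<and> b' u (card C) \<le> maxB C t"
      using assms(3) by (intro exI[of _ u]) simp
  qed
qed

lemma table_card_less:
  assumes "wf_btree t" "table t P a b S" "P u k"
  shows "k < card (verts t)"
proof -
  have "S u k \<subseteq> edges t" "card (S u k) = k" using table_sound[OF assms(2,3)] by blast+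
  then have "k \<le> card (edges t)" by (metis card_mono finite_edges)
  then show ?thesis using card_verts[OF assms(1)] by simp
qed

text \<open>The new key is the vertex whose depth in the joined tree is the new bound on
  \<open>maxA\<close>. A vertex of the lower tree can win only over a contracted edge, where its
  depth has grown by exactly \<open>w / \<alpha>\<close>.\<close>

definition combined where
  "combined w q a1 b1 a2 b2 = (case q of (u1, k1, u2, k2, f) \<Rightarrow>
     let x = extA f w (a2 u2 k2); y = extB f w (a2 u2 k2) (b2 u2 k2) in
     (compatible (a1 u1 k1) (b1 u1 k1) x y,
      if a1 u1 k1 < x then u2 else u1, k1 + k2 + of_bool f, max (a1 u1 k1) x, max (b1 u1 k1) y))"

text \<open>The state of the table of \<open>Join t1 t2\<close> when the combinations in \<open>Q\<close> have been processed\<close>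

definition merging where
  "merging t1 t2 P1 a1 b1 S1 P2 a2 b2 S2 Q P a b S \<longleftrightarrow>
     (\<forall>u k. P u k \<longrightarrow> (\<exists>u1 k1 u2 k2 f. P1 u1 k1 \<and> P2 u2 k2 \<and>
        combined (l (join_edge t1 t2)) (u1, k1, u2, k2, f) a1 b1 a2 b2 = (True, u, k, a u k, b u k) \<and>
        S u k = S1 u1 k1 \<union> S2 u2 k2 \<union> (if f then {join_edge t1 t2} else {}))) \<and>
     (\<forall>u1 k1 u2 k2 f u k x y. (u1, k1, u2, k2, f) \<in> Q \<longrightarrow> P1 u1 k1 \<longrightarrow> P2 u2 k2 \<longrightarrow>
        combined (l (join_edge t1 t2)) (u1, k1, u2, k2, f) a1 b1 a2 b2 = (True, u, k, x, y) \<longrightarrow>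
        P u k \<and> b u k \<le> y)"

lemma ext_mono:
  "a \<le> a' \<Longrightarrow> extA f w a \<le> extA f w a'"
  "a \<le> a' \<Longrightarrow> b \<le> b' \<Longrightarrow> extB f w a b \<le> extB f w a' b'"
  by (auto simp: extA_def extB_def)

lemma compatible_antimono:
  "compatible a b x y \<Longrightarrow> a' \<le> a \<Longrightarrow> b' \<le> b \<Longrightarrow> x' \<le> x \<Longrightarrow> y' \<le> y \<Longrightarrow> compatible a' b' x' y'"
  by (auto simp: compatible_def)

text \<open>Completeness rests on monotonicity: the restrictions of a valid \<open>C\<close> to the
  two trees have entries at least as good as themselves, so the combination of these entries is
  again compatible and at least as good as \<open>C\<close>.\<close>

lemma table_Join:
  assumes wf: "wf_btree (Join t1 t2)" and pos: "pos_lengths (Join t1 t2)"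
    and T1: "table t1 P1 a1 b1 S1" and T2: "table t2 P2 a2 b2 S2"
    and M: "merging t1 t2 P1 a1 b1 S1 P2 a2 b2 S2 Q P a b S"
    and Q: "\<And>u1 k1 u2 k2 f. P1 u1 k1 \<Longrightarrow> P2 u2 k2 \<Longrightarrow> (u1, k1, u2, k2, f) \<in> Q"
  shows "table (Join t1 t2) P a b S"
proof -
  let ?e = "join_edge t1 t2" let ?w = "l ?e"
  have disj: "edges t1 \<inter> edges t2 = {}" "?e \<notin> edges t1" "?e \<notin> edges t2"
    using edges_disjoint[of t1 t2] wf by auto
  have wpos: "0 \<le> ?w / \<alpha>" using pos alpha by simp
  have sound: "u \<in> verts (Join t1 t2) \<and> a u k = depth (Join t1 t2) u \<and> S u k \<subseteq> edges (Join t1 t2) \<and>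
      card (S u k) = k \<and> valid (S u k) (Join t1 t2) \<and> maxA (S u k) (Join t1 t2) \<le> a u k \<and>
      maxB (S u k) (Join t1 t2) \<le> b u k" if Puk: "P u k" for u k
  proof -
    obtain u1 k1 u2 k2 f where p: "P1 u1 k1" "P2 u2 k2"
      "combined ?w (u1, k1, u2, k2, f) a1 b1 a2 b2 = (True, u, k, a u k, b u k)"
      "S u k = S1 u1 k1 \<union> S2 u2 k2 \<union> (if f then {?e} else {})"
      using conjunct1[OF M[unfolded merging_def], rule_format, OF Puk] by blast
    let ?C = "S u k" let ?x = "extA f ?w (a2 u2 k2)"
    let ?y = "extB f ?w (a2 u2 k2) (b2 u2 k2)"
    have c: "compatible (a1 u1 k1) (b1 u1 k1) ?x ?y" "u = (if a1 u1 k1 < ?x then u2 else u1)"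
      "k = k1 + k2 + of_bool f" "a u k = max (a1 u1 k1) ?x" "b u k = max (b1 u1 k1) ?y"
      using p(3) by (auto simp: combined_def Let_def)
    have s1: "u1 \<in> verts t1" "a1 u1 k1 = depth t1 u1" "S1 u1 k1 \<subseteq> edges t1" "card (S1 u1 k1) = k1"
      "valid (S1 u1 k1) t1" "maxA (S1 u1 k1) t1 \<le> a1 u1 k1" "maxB (S1 u1 k1) t1 \<le> b1 u1 k1"
      using table_sound[OF T1 p(1)] by blast+
    have s2: "u2 \<in> verts t2" "a2 u2 k2 = depth t2 u2" "S2 u2 k2 \<subseteq> edges t2" "card (S2 u2 k2) = k2"
      "valid (S2 u2 k2) t2" "maxA (S2 u2 k2) t2 \<le> a2 u2 k2" "maxB (S2 u2 k2) t2 \<le> b2 u2 k2"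
      using table_sound[OF T2 p(2)] by blast+
    have e: "?e \<in> ?C \<longleftrightarrow> f" using p(4) s1(3) s2(3) disj by auto
    have r1: "maxA ?C t1 = maxA (S1 u1 k1) t1" "maxB ?C t1 = maxB (S1 u1 k1) t1"
      "valid ?C t1 = valid (S1 u1 k1) t1"
      by (use restrict_cong[of t1 ?C "S1 u1 k1"] p(4) s2(3) disj in force)+
    have r2: "maxA ?C t2 = maxA (S2 u2 k2) t2" "maxB ?C t2 = maxB (S2 u2 k2) t2"
      "valid ?C t2 = valid (S2 u2 k2) t2"
      by (use restrict_cong[of t2 ?C "S2 u2 k2"] p(4) s1(3) disj in force)+
    have x: "extA f ?w (maxA ?C t2) \<le> ?x" "extB f ?w (maxA ?C t2) (maxB ?C t2) \<le> ?y"
      using s2 r2 by (auto intro: ext_mono)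
    have "card ?C = k"
    proof -
      have fin: "finite (S1 u1 k1)" "finite (S2 u2 k2)"
        using s1(3) s2(3) finite_edges finite_subset by blast+
      have "S1 u1 k1 \<inter> S2 u2 k2 = {}" "?e \<notin> S1 u1 k1 \<union> S2 u2 k2"
        using s1(3) s2(3) disj by auto
      then show ?thesis using fin p(4) c(3) s1(4) s2(4) by (simp add: card_Un_disjoint)
    qed
    moreover have "a u k = depth (Join t1 t2) u"
    proof (cases "a1 u1 k1 < ?x")
      case True
      \<comment> \<open>\<open>a1\<close> is a depth, hence nonnegative, whereas \<open>?x\<close>
        is 0 for an uncontracted edge.\<close>
      have "f" using True s1(2) depth_nonneg[of t1 u1] pos by (auto simp: extA_def split: if_splits)
      then show ?thesis
        using True c s2(1,2) depth_Join(2)[OF wf, of u2] by (simp add: extA_def)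
    qed (use c s1(1,2) depth_Join(1)[OF wf, of u1] in simp)
    moreover have "valid ?C (Join t1 t2)"
      using s1 s2 r1 r2 e compatible_antimono[OF c(1) _ _ x] by auto
    moreover have "?C \<subseteq> edges (Join t1 t2)" using p(4) s1(3) s2(3) by auto
    ultimately show ?thesis using c s1 s2 r1 r2 e x by auto
  qed
  have complete: "\<exists>u. P u (card C) \<and> a u (card C) \<le> maxA C (Join t1 t2) \<and>
      b u (card C) \<le> maxB C (Join t1 t2)"
    if C: "C \<subseteq> edges (Join t1 t2)" "valid C (Join t1 t2)" for C
  proof -
    let ?C1 = "C \<inter> edges t1" let ?C2 = "C \<inter> edges t2" let ?f = "?e \<in> C"
    have r1: "maxA ?C1 t1 = maxA C t1" "maxB ?C1 t1 = maxB C t1" "valid ?C1 t1 = valid C t1"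
      using restrict_cong[of t1 ?C1 C] by simp_all
    have r2: "maxA ?C2 t2 = maxA C t2" "maxB ?C2 t2 = maxB C t2" "valid ?C2 t2 = valid C t2"
      using restrict_cong[of t2 ?C2 C] by simp_all
    have "valid ?C1 t1" "valid ?C2 t2" using C r1 r2 by auto
    then obtain u1 u2 where
      u1: "P1 u1 (card ?C1)" "a1 u1 (card ?C1) \<le> maxA C t1" "b1 u1 (card ?C1) \<le> maxB C t1" and
      u2: "P2 u2 (card ?C2)" "a2 u2 (card ?C2) \<le> maxA C t2" "b2 u2 (card ?C2) \<le> maxB C t2"
      using table_complete[OF T1, of ?C1] table_complete[OF T2, of ?C2] r1 r2 by auto
    let ?k1 = "card ?C1" let ?k2 = "card ?C2"
    let ?x = "extA ?f ?w (a2 u2 ?k2)" let ?y = "extB ?f ?w (a2 u2 ?k2) (b2 u2 ?k2)"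
    let ?u = "if a1 u1 ?k1 < ?x then u2 else u1"
    have x: "?x \<le> extA ?f ?w (maxA C t2)" "?y \<le> extB ?f ?w (maxA C t2) (maxB C t2)"
      using u2 by (auto intro: ext_mono)
    have comp: "compatible (a1 u1 ?k1) (b1 u1 ?k1) ?x ?y"
      using C(2) compatible_antimono[OF _ u1(2,3) x] by simp
    have k: "card C = ?k1 + ?k2 + of_bool ?f"
    proof -
      have "C = ?C1 \<union> ?C2 \<union> (if ?f then {?e} else {})" using C(1) by auto
      then have "card C = card (?C1 \<union> ?C2 \<union> (if ?f then {?e} else {}))" by simp
      also have "\<dots> = card (?C1 \<union> ?C2) + of_bool ?f"
        using disj by (subst card_Un_disjoint) auto
      also have "card (?C1 \<union> ?C2) = ?k1 + ?k2"
        using disj by (subst card_Un_disjoint) auto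
      finally show ?thesis .
    qed
    have "combined ?w (u1, ?k1, u2, ?k2, ?f) a1 b1 a2 b2 =
        (True, ?u, card C, max (a1 u1 ?k1) ?x, max (b1 u1 ?k1) ?y)"
      using comp k by (simp add: combined_def Let_def)
    then have P: "P ?u (card C)" and b: "b ?u (card C) \<le> max (b1 u1 ?k1) ?y"
      using M Q[OF u1(1) u2(1), of ?f] u1(1) u2(1) unfolding merging_def by blast+
    have d1: "u1 \<in> verts t1" "a1 u1 ?k1 = depth t1 u1" 
      using table_sound[OF T1 u1(1)] by blast+
    have d2: "u2 \<in> verts t2" "a2 u2 ?k2 = depth t2 u2" 
      using table_sound[OF T2 u2(1)] by blast+
    \<comment> \<open>The entry under this key may stem from another combination, since
      \<open>merging\<close> compares \<open>b\<close> only. Its bound \<open>a\<close> is the same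
      nevertheless, being the depth of the key vertex.\<close>
    have "depth (Join t1 t2) ?u = max (a1 u1 ?k1) ?x"
    proof (cases "a1 u1 ?k1 < ?x")
      case True
      have "?f" using True d1(2) depth_nonneg[of t1 u1] pos by (auto simp: extA_def split: if_splits)
      then show ?thesis
        using True d2 depth_Join(2)[OF wf, of u2] by (simp add: extA_def)
    qed (use d1 depth_Join(1)[OF wf, of u1] in simp)
    then have "a ?u (card C) = max (a1 u1 ?k1) ?x" using sound[OF P] by simp
    then have "a ?u (card C) \<le> maxA C (Join t1 t2)" using u1(2) x(1) by auto
    moreover have "b ?u (card C) \<le> maxB C (Join t1 t2)" using b u1(3) x(2) by auto
    ultimately show ?thesis using P by blast
  qed
  show ?thesis unfolding table_def using sound complete by blast
qed

lemma merging_skip: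
  assumes "merging t1 t2 P1 a1 b1 S1 P2 a2 b2 S2 Q P a b S"
    "\<And>u k x y. P1 u1 k1 \<Longrightarrow> P2 u2 k2 \<Longrightarrow>
      combined (l (join_edge t1 t2)) (u1, k1, u2, k2, f) a1 b1 a2 b2 = (True, u, k, x, y) \<Longrightarrow>
      P u k \<and> b u k \<le> y"
  shows "merging t1 t2 P1 a1 b1 S1 P2 a2 b2 S2 (insert (u1, k1, u2, k2, f) Q) P a b S"
  using assms unfolding merging_def by blast

text \<open>Overwriting by a value \<open>y\<close> that is not larger keeps all earlier
  combinations dominated, and the new combination becomes the witness of its entry.\<close>

lemma merging_update:
  assumes M: "merging t1 t2 P1 a1 b1 S1 P2 a2 b2 S2 Q P a b S"
    and p: "P1 u1 k1" "P2 u2 k2"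
      "combined (l (join_edge t1 t2)) (u1, k1, u2, k2, f) a1 b1 a2 b2 = (True, u, k, x, y)"
    and better: "P u k \<Longrightarrow> y \<le> b u k"
    and new: "P' u k" "a' u k = x" "b' u k = y"
      "S' u k = S1 u1 k1 \<union> S2 u2 k2 \<union> (if f then {join_edge t1 t2} else {})"
    and old: "\<And>u' k'. (u', k') \<noteq> (u, k) \<Longrightarrow> P' u' k' = P u' k'"
      "\<And>u' k'. (u', k') \<noteq> (u, k) \<Longrightarrow> P u' k' \<Longrightarrow>
        a' u' k' = a u' k' \<and> b' u' k' = b u' k' \<and> S' u' k' = S u' k'"
  shows "merging t1 t2 P1 a1 b1 S1 P2 a2 b2 S2 (insert (u1, k1, u2, k2, f) Q) P' a' b' S'"
  unfolding merging_def
proof (intro conjI allI impI)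
  fix u' k' assume P': "P' u' k'"
  show "\<exists>u1 k1 u2 k2 f. P1 u1 k1 \<and> P2 u2 k2 \<and>
        combined (l (join_edge t1 t2)) (u1, k1, u2, k2, f) a1 b1 a2 b2 =
          (True, u', k', a' u' k', b' u' k') \<and>
        S' u' k' = S1 u1 k1 \<union> S2 u2 k2 \<union> (if f then {join_edge t1 t2} else {})"
  proof (cases "(u', k') = (u, k)")
    case True
    then have "u' = u" "k' = k" by auto
    show ?thesis unfolding \<open>u' = u\<close> \<open>k' = k\<close> new using p
      by (intro exI[of _ u1] exI[of _ k1] exI[of _ u2] exI[of _ k2] exI[of _ f]) simp
  next
    case False
    then have "P u' k'" "a' u' k' = a u' k'" "b' u' k' = b u' k'" "S' u' k' = S u' k'"
      using old P' by auto
    then show ?thesis using M unfolding merging_def by presburger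
  qed
next
  fix v1 j1 v2 j2 g u' k' x' y'
  assume *: "(v1, j1, v2, j2, g) \<in> insert (u1, k1, u2, k2, f) Q" "P1 v1 j1" "P2 v2 j2"
    "combined (l (join_edge t1 t2)) (v1, j1, v2, j2, g) a1 b1 a2 b2 = (True, u', k', x', y')"
  have "P' u' k' \<and> b' u' k' \<le> y'"
  proof (cases "(v1, j1, v2, j2, g) = (u1, k1, u2, k2, f)")
    case True
    then have "u' = u" "k' = k" "y' = y" using *(4) p(3) by auto
    then show ?thesis using new by simp
  next
    case False
    then have q: "P u' k'" "b u' k' \<le> y'" using M * unfolding merging_def by blast+
    show ?thesis
    proof (cases "(u', k') = (u, k)")
      case True
      then show ?thesis using q better new by force
    next
      case False
      then show ?thesis using q old by auto
    qed
  qed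
  then show "P' u' k'" "b' u' k' \<le> y'" by auto
qed

end

section \<open>Growing a tree\<close>

definition visited :: "(nat \<Rightarrow> nat) \<Rightarrow> nat \<Rightarrow> nat set" where
  "visited oc j = insert 0 (oc ` {..<j})"

text \<open>A graph search from vertex 0: step \<open>j\<close> attaches the new vertex
  \<open>oc j\<close> to the old vertex \<open>op j\<close>.\<close>

definition grown :: "nat \<Rightarrow> nat set set \<Rightarrow> (nat \<Rightarrow> nat) \<Rightarrow> (nat \<Rightarrow> nat) \<Rightarrow> nat \<Rightarrow> bool" where
  "grown n E op oc m \<longleftrightarrow> (\<forall>j<m. op j \<in> visited oc j \<and> oc j \<notin> visited oc j \<and> oc j < n \<and>
     {op j, oc j} \<in> E)"

lemma visited_0 [simp]: "visited oc 0 = {0}"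
  and visited_Suc: "visited oc (Suc j) = insert (oc j) (visited oc j)"
  by (auto simp: visited_def lessThan_Suc)

lemma visited_cong: "(\<And>i. i < j \<Longrightarrow> oc i = oc' i) \<Longrightarrow> visited oc j = visited oc' j"
  by (auto simp: visited_def)

lemma visited_mono: "i \<le> j \<Longrightarrow> visited oc i \<subseteq> visited oc j"
  by (auto simp: visited_def)

lemma finite_visited [simp]: "finite (visited oc j)"
  by (simp add: visited_def)

lemma visited_less: "0 < n \<Longrightarrow> grown n E op oc m \<Longrightarrow> visited oc m \<subseteq> {..<n}"
  by (auto simp: visited_def grown_def)

lemma card_visited: "grown n E op oc m \<Longrightarrow> card (visited oc m) = Suc m"
proof (induction m)
  case (Suc m)
  then have "grown n E op oc m" "oc m \<notin> visited oc m" by (auto simp: grown_def)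
  then show ?case using Suc by (simp add: visited_Suc)
qed simp

lemma grown_cong:
  assumes "\<And>i. i < m \<Longrightarrow> op i = op' i \<and> oc i = oc' i"
  shows "grown n E op oc m = grown n E op' oc' m"
proof -
  have "visited oc j = visited oc' j" if "j < m" for j
    using that assms by (intro visited_cong) auto
  then show ?thesis using assms unfolding grown_def by auto
qed

lemma crossing_edge:
  assumes "connected_graph V E" "u \<in> V" "u \<in> W" "\<not> V \<subseteq> W"
  shows "\<exists>x y. x \<in> W \<and> y \<notin> W \<and> y \<in> V \<and> {x, y} \<in> E"
proof -
  obtain v where v: "v \<in> V" "v \<notin> W" using assms by auto
  then obtain p where "path V E u p v" using assms by (auto simp: connected_graph_def)
  then have "p \<noteq> []" "hd p \<in> W" "last p \<notin> W" "set p \<subseteq> V" "successively (\<lambda>x y. {x, y} \<in> E) p"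
    using assms v by (auto simp: path_def)
  then show ?thesis
  proof (induction p rule: induct_list012)
    case (3 x y zs)
    then show ?case by (cases "y \<in> W") auto
  qed auto
qed

text \<open>The joins are performed in the reverse order of the growth, so that the tree below a vertex
  is complete when it is joined to the tree of its parent.\<close>

primrec forest :: "(nat \<Rightarrow> nat) \<Rightarrow> (nat \<Rightarrow> nat) \<Rightarrow> nat \<Rightarrow> nat \<Rightarrow> nat \<Rightarrow> nat btree" where
  "forest op oc m 0 = Leaf"
| "forest op oc m (Suc j) = (let r = m - Suc j; f = forest op oc m j in
     f(op r := Join (f (op r)) (f (oc r))))"

lemma forest_Suc:
  "forest op oc m (Suc j) = (forest op oc m j)
     (op (m - Suc j) := Join (forest op oc m j (op (m - Suc j))) (forest op oc m j (oc (m - Suc j))))"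
  by (simp add: Let_def)

declare forest.simps(2) [simp del]

text \<open>Undoing growth step \<open>r\<close> takes \<open>oc r\<close> from the roots, which
  shrink to \<open>visited oc r\<close>. The value of \<open>forest\<close> at \<open>oc r\<close>
  is stale from then on, and nothing is claimed about it.\<close>

lemma forest_props:
  assumes "grown n E op oc m" "j \<le> m"
  shows "(\<forall>v\<in>visited oc (m - j). broot (forest op oc m j v) = v \<and> wf_btree (forest op oc m j v)) \<and>
    (\<forall>v\<in>visited oc (m - j). \<forall>w\<in>visited oc (m - j). v \<noteq> w \<longrightarrow>
       verts (forest op oc m j v) \<inter> verts (forest op oc m j w) = {}) \<and>
    (\<Union>v\<in>visited oc (m - j). verts (forest op oc m j v)) = visited oc m \<and>
    (\<Union>v\<in>visited oc (m - j). edges (forest op oc m j v)) = {{op r, oc r} | r. m - j \<le> r \<and> r < m}"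
  using assms(2)
proof (induction j)
  case (Suc j)
  let ?r = "m - Suc j" and ?f = "forest op oc m j"
  let ?p = "op ?r" and ?c = "oc ?r" and ?W = "visited oc (m - Suc j)"
  have r: "m - j = Suc ?r" "?r < m" using Suc.prems by auto
  have pc: "?p \<in> ?W" "?c \<notin> ?W" using assms(1) r(2) by (auto simp: grown_def)
  have vis: "visited oc (m - j) = insert ?c ?W" by (simp add: r visited_Suc)
  note H = Suc.IH[OF Suc_leD[OF Suc.prems], unfolded vis, unfolded r(1)]
  note IH = conjunct1[OF H] conjunct1[OF conjunct2[OF H]]
    conjunct1[OF conjunct2[OF conjunct2[OF H]]] conjunct2[OF conjunct2[OF conjunct2[OF H]]]
  let ?g = "?f(?p := Join (?f ?p) (?f ?c))"
  have "?p \<noteq> ?c" using pc by auto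
  then have dpc: "verts (?f ?p) \<inter> verts (?f ?c) = {}" using IH(2) pc by auto
  have 1: "\<forall>v\<in>?W. broot (?g v) = v \<and> wf_btree (?g v)"
    using IH(1) pc dpc by auto
  have 2: "\<forall>v\<in>?W. \<forall>w\<in>?W. v \<noteq> w \<longrightarrow> verts (?g v) \<inter> verts (?g w) = {}"
  proof (intro ballI impI)
    fix v w assume vw: "v \<in> ?W" "w \<in> ?W" "v \<noteq> w"
    then have "verts (?f v) \<inter> verts (?f w) = {}" "verts (?f v) \<inter> verts (?f ?c) = {}"
      "verts (?f w) \<inter> verts (?f ?c) = {}"
      using IH(2) pc by (metis insertI1 insertI2)+
    then show "verts (?g v) \<inter> verts (?g w) = {}" using vw by auto
  qed
  have 3: "(\<Union>v\<in>?W. verts (?g v)) = visited oc m"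
  proof -
    have "(\<Union>v\<in>?W. verts (?g v)) = (\<Union>v\<in>insert ?c ?W. verts (?f v))"
      using pc by (auto split: if_splits)
    then show ?thesis using IH(3) by simp
  qed
  have 4: "(\<Union>v\<in>?W. edges (?g v)) = {{op r, oc r} | r. ?r \<le> r \<and> r < m}"
  proof -
    have "(\<Union>v\<in>?W. edges (?g v)) = insert {?p, ?c} (\<Union>v\<in>insert ?c ?W. edges (?f v))"
      using pc IH(1) by (auto split: if_splits)
    also have "\<dots> = {{op r, oc r} | r. ?r \<le> r \<and> r < m}"
    proof -
      have "?r \<le> r \<and> r < m \<longleftrightarrow> r = ?r \<or> Suc ?r \<le> r \<and> r < m" for r using r(2) by auto
      then show ?thesis unfolding IH(4) setcompr_eq_image by (simp add: Collect_disj_eq image_Un)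
    qed
    finally show ?thesis .
  qed
  show ?case unfolding forest_Suc using 1 2 3 4 by simp
qed auto

lemma
  assumes "grown n E op oc m" "j \<le> m" "v \<in> visited oc (m - j)"
  shows forest_root: "broot (forest op oc m j v) = v"
    and forest_wf: "wf_btree (forest op oc m j v)"
    and forest_verts: "verts (forest op oc m j v) \<subseteq> visited oc m"
    and forest_edges: "edges (forest op oc m j v) \<subseteq> E"
    and forest_disjoint: "w \<in> visited oc (m - j) \<Longrightarrow> v \<noteq> w \<Longrightarrow>
      verts (forest op oc m j v) \<inter> verts (forest op oc m j w) = {}"
proof -
  note F = forest_props[OF assms(1,2)]
  note F2 = conjunct2[OF F] note F3 = conjunct2[OF F2]
  show "broot (forest op oc m j v) = v" "wf_btree (forest op oc m j v)"
    using conjunct1[OF F] assms(3) by simp_all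
  show "verts (forest op oc m j v) \<subseteq> visited oc m"
    unfolding conjunct1[OF F3, symmetric] by (rule UN_upper[OF assms(3)])
  have "edges (forest op oc m j v) \<subseteq> {{op r, oc r} | r. m - j \<le> r \<and> r < m}"
    unfolding conjunct2[OF F3, symmetric] by (rule UN_upper[OF assms(3)])
  also have "\<dots> \<subseteq> E" using assms(1) by (auto simp: grown_def)
  finally show "edges (forest op oc m j v) \<subseteq> E" .
  show "w \<in> visited oc (m - j) \<Longrightarrow> v \<noteq> w \<Longrightarrow>
      verts (forest op oc m j v) \<inter> verts (forest op oc m j w) = {}"
    using conjunct1[OF F2] assms(3) by simp
qed

lemma visited_all:
  assumes "0 < n" "grown n E op oc (n - 1)"
  shows "visited oc (n - 1) = {..<n}"
  using visited_less[OF assms] card_visited[OF assms(2)] assms(1)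
  by (intro card_subset_eq) auto

text \<open>A further edge of \<open>E\<close> would close a cycle with the path between its ends in
  the spanning tree \<open>t\<close>.\<close>

lemma tree_edges_unique:
  assumes "tree V E" "wf_btree t" "verts t = V" "edges t \<subseteq> E"
  shows "edges t = E"
proof (rule ccontr)
  assume "edges t \<noteq> E"
  then obtain e where e: "e \<in> E" "e \<notin> edges t" using assms(4) by auto
  then obtain x y where xy: "e = {x, y}" "x \<noteq> y" "x \<in> V" "y \<in> V"
    using assms(1) by (fastforce simp: tree_def simple_graph_def)
  then obtain p where p: "path V (edges t) x p y"
    using btree_path_exists[OF assms(2), of x y] assms(3) by auto
  \<comment> \<open>The ends differ and the edge between them is not in \<open>t\<close>, so the
    path has an inner vertex.\<close>
  have "length p \<ge> 3"
  proof (rule ccontr)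
    assume "\<not> 3 \<le> length p"
    then have "p = [] \<or> (\<exists>a. p = [a]) \<or> (\<exists>a b. p = [a, b])"
      by (cases p rule: remdups_adj.cases) (auto simp: not_le less_Suc_eq_le)
    then show False using p xy e by (auto simp: path_def)
  qed
  moreover have "path V E x p y" using path_mono[OF p order.refl assms(4)] .
  ultimately have "cycle V E p"
    using xy e by (auto simp: cycle_def path_def insert_commute)
  then show False using assms(1) by (auto simp: tree_def)
qed

lemma grown_tree:
  assumes "tree {..<n} E" "grown n E op oc (n - 1)"
  defines "t \<equiv> forest op oc (n - 1) (n - 1) 0"
  shows "wf_btree t" "verts t = {..<n}" "edges t = E"
proof -
  have n: "0 < n" using assms(1) by (auto simp: tree_def connected_graph_def)
  note F = forest_props[OF assms(2) order.refl]
  show wf: "wf_btree t" using F by (simp add: t_def)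
  show V: "verts t = {..<n}" using F visited_all[OF n assms(2)] by (simp add: t_def)
  have "edges t \<subseteq> E" unfolding t_def by (rule forest_edges[OF assms(2)]) auto
  then show "edges t = E" by (rule tree_edges_unique[OF assms(1) wf V])
qed

lemma grown_extend:
  assumes "tree {..<n} E" "grown n E op oc j" "j < n - 1"
  shows "\<exists>x y. x \<in> visited oc j \<and> y \<notin> visited oc j \<and> y < n \<and> {x, y} \<in> E"
proof -
  have n: "0 < n" using assms(3) by simp
  have "\<not> {..<n} \<subseteq> visited oc j"
  proof
    assume "{..<n} \<subseteq> visited oc j"
    then have "n \<le> card (visited oc j)" by (metis card_lessThan card_mono finite_visited)
    then show False using card_visited[OF assms(2)] assms(3) by simp
  qed
  then show ?thesis
    using crossing_edge[of "{..<n}" E 0 "visited oc j"] assms(1) n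
    by (auto simp: tree_def visited_def)
qed

lemma grown_exists: "tree {..<n} E \<Longrightarrow> m \<le> n - 1 \<Longrightarrow> \<exists>op oc. grown n E op oc m"
proof (induction m)
  case (Suc m)
  then obtain op oc where g: "grown n E op oc m" by auto
  then obtain x y where xy: "x \<in> visited oc m" "y \<notin> visited oc m" "y < n" "{x, y} \<in> E"
    using grown_extend[OF Suc.prems(1) g] Suc.prems(2) by auto
  have "grown n E (op(m := x)) (oc(m := y)) m" using g by (subst grown_cong) auto
  moreover have "visited (oc(m := y)) m = visited oc m" by (intro visited_cong) auto
  ultimately have "grown n E (op(m := x)) (oc(m := y)) (Suc m)"
    using xy unfolding grown_def by (auto simp: less_Suc_eq)
  then show ?case by blast
qed (auto simp: grown_def)

lemma card_tree:
  assumes "tree {..<n} E"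
  shows "card E = n - 1"
proof -
  obtain op oc where g: "grown n E op oc (n - 1)" using grown_exists[OF assms, of "n - 1"] by auto
  note t = grown_tree[OF assms g]
  show ?thesis using card_verts[OF t(1)] t by simp
qed

section \<open>Solutions stored by back pointers\<close>

text \<open>Table \<open>i\<close> occupies a block of \<open>n * n\<close> cells that starts at
  \<open>slot n i 0 0\<close>. Leaves have the ids below \<open>n\<close>, and the join of round
  \<open>j\<close> has id \<open>n + j\<close>. The cells double as nodes of the graph of back
  pointers.\<close>

definition slot :: "nat \<Rightarrow> nat \<Rightarrow> nat \<Rightarrow> nat \<Rightarrow> nat" where
  "slot n i u k = (i * n + u) * n + k"

lemma slot_less:
  assumes "i < j" "u < n" "k < n"
  shows "slot n i u k < slot n j 0 0"
proof -
  have "i * n + u < Suc i * n" using assms by simp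
  then have 1: "i * n + u < j * n" using assms(1) by (meson Suc_leI mult_le_mono1 order_less_le_trans)
  have "(i * n + u) * n + k < Suc (i * n + u) * n" using assms(3) by simp
  also have "\<dots> \<le> j * n * n" using 1 by (intro mult_le_mono1) simp
  finally show ?thesis by (simp add: slot_def)
qed

lemma slot_ge: "slot n i 0 0 \<le> slot n i u k"
  by (simp add: slot_def add_mult_distrib)

lemma slot_mono: "i \<le> j \<Longrightarrow> slot n i 0 0 \<le> slot n j 0 0"
  by (simp add: slot_def)

lemma slot_inj:
  assumes "slot n i u k = slot n i u' k'" "k < n" "k' < n"
  shows "u = u' \<and> k = k'"
proof -
  have "(i * n + u) * n + k = (i * n + u') * n + k'" using assms(1) by (simp add: slot_def)
  then have "((i * n + u) * n + k) div n = ((i * n + u') * n + k') div n" by simp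
  then have "u = u'" using assms(2,3) by simp
  then show ?thesis using assms(1) by (simp add: slot_def)
qed

text \<open>Back pointers descend, except at node 0; the test is there for termination only.\<close>

function dag :: "(nat \<Rightarrow> nat) \<Rightarrow> (nat \<Rightarrow> nat) \<Rightarrow> (nat \<Rightarrow> nat) \<Rightarrow> nat \<Rightarrow> nat set" where
  "dag nl nr ne x =
     (if nl x < x \<and> nr x < x then dag nl nr ne (nl x) \<union> dag nl nr ne (nr x) else {}) \<union>
     (if ne x = 0 then {} else {ne x - 1})"
  by auto
termination by (relation "measure (\<lambda>(nl, nr, ne, x). x)") auto

declare dag.simps [simp del]

lemma dag_0 [simp]: "ne 0 = 0 \<Longrightarrow> dag nl nr ne 0 = {}"
  by (subst dag.simps) simp

lemma dag_cong:
  "(\<And>y. y \<le> x \<Longrightarrow> nl y = nl' y \<and> nr y = nr' y \<and> ne y = ne' y) \<Longrightarrow>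
   dag nl nr ne x = dag nl' nr' ne' x"
proof (induction x rule: less_induct)
  case (less x)
  have "dag nl nr ne y = dag nl' nr' ne' y" if "y < x" for y
    using that less by auto
  then show ?case
    using less.prems[of x] by (subst (1 2) dag.simps) auto
qed

section \<open>The program\<close>

text \<open>The machine cannot multiply natural numbers, so multiples of \<open>n\<close> are
  tabulated by repeated addition.\<close>

definition add_row :: com where
  "add_row = NSet ''row'' (NPlus (nvar ''i'') (NConst 1)) (NPlus (NGet ''row'' (nvar ''i'')) (nvar ''n''))"

text \<open>Two passes, since the length \<open>2 * n * n\<close> of the second is read from the
  result of the first. So many multiples are needed because an address looks up \<open>row\<close>
  twice, the second time at \<open>i * n + u\<close> with \<open>i < 2 * n\<close>.\<close>

definition init_rows :: com where
  "init_rows = Seq (For ''i'' (NPlus (nvar ''n'') (nvar ''n'')) add_row)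
     (Seq (nlet ''m'' (NGet ''row'' (NPlus (nvar ''n'') (nvar ''n''))))
       (For ''i'' (nvar ''m'') add_row))"

definition sum_lengths :: com where
  "sum_lengths = For ''i'' (nvar ''n'')
     (rlet ''lsum'' (RPlus (rvar ''lsum'') (RGet ''len'' (nvar ''i''))))"

definition is_crossing :: "aname \<Rightarrow> aname \<Rightarrow> bexp" where
  "is_crossing a b = BAnd (NLess (NConst 0) (NGet ''vis'' (NGet a (nvar ''i''))))
     (BNot (NLess (NConst 0) (NGet ''vis'' (NGet b (nvar ''i'')))))"

definition record_edge :: "aname \<Rightarrow> aname \<Rightarrow> com" where
  "record_edge a b = Seq (NSet ''op'' (nvar ''j'') (NGet a (nvar ''i'')))
     (Seq (NSet ''oc'' (nvar ''j'') (NGet b (nvar ''i''))) (NSet ''oe'' (nvar ''j'') (nvar ''i'')))"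

text \<open>The scan overwrites earlier finds and keeps the last crossing edge; any would
  do.\<close>

definition find_crossing :: com where
  "find_crossing = For ''i'' (nvar ''n'')
     (Cond (is_crossing ''src'' ''dst'') (record_edge ''src'' ''dst'')
       (Cond (is_crossing ''dst'' ''src'') (record_edge ''dst'' ''src'') Skip))"

definition grow :: com where
  "grow = Seq (nlet ''vis'' (NConst 1))
     (For ''j'' (NMinus (nvar ''n'') (NConst 1))
       (Seq find_crossing (NSet ''vis'' (NGet ''oc'' (nvar ''j'')) (NConst 1))))"

definition slot_exp :: "nexp \<Rightarrow> nexp \<Rightarrow> nexp \<Rightarrow> nexp" where
  "slot_exp i u k = NPlus (NGet ''row'' (NPlus (NGet ''row'' i) u)) k"

text \<open>\<open>av\<close>, \<open>nl\<close>, \<open>nr\<close> and \<open>ne\<close> stay at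
  their initial 0: a leaf has depth 0, no edge, and pointers to node 0, whose solution is
  empty.\<close>

definition init_leaves :: com where
  "init_leaves = For ''i'' (nvar ''n'') (Seq (NSet ''cur'' (nvar ''i'') (nvar ''i''))
     (Seq (NSet ''ptr'' (slot_exp (nvar ''i'') (nvar ''i'') (NConst 0)) (NConst 1))
       (RSet ''bv'' (slot_exp (nvar ''i'') (nvar ''i'') (NConst 0))
         (RMinus (RConst 0) (rvar ''lsum'')))))"

text \<open>Each level of nesting raises the power of \<open>n\<close> by one and the constant by 4.
  This is how 44 grows to 60 over the four merging loops, and 67 to 71 over all rounds.\<close>

lemma loop_time: "1 \<le> n \<Longrightarrow> N \<le> n \<Longrightarrow> N * (K * n ^ i + 2) + 2 \<le> (K + 4) * n ^ Suc i" for n :: nat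
proof -
  assume n: "1 \<le> n" "N \<le> n"
  have "N * (K * n ^ i + 2) + 2 \<le> n * (K * n ^ i + 2) + 2"
    using n(2) by (intro add_right_mono mult_le_mono1)
  also have "\<dots> = K * n ^ Suc i + 2 * n + 2" by (simp add: algebra_simps)
  also have "\<dots> \<le> K * n ^ Suc i + 4 * n ^ Suc i"
  proof -
    have "n \<le> n ^ Suc i" using n by (simp add: self_le_power)
    then show ?thesis using n(1) by linarith
  qed
  finally show ?thesis by (simp add: algebra_simps)
qed

lemma agree_refl: "agree c s s"
  by (simp add: agree_def)

lemma agree_nset: "a \<in> nwrites c \<Longrightarrow> agree c s s' \<Longrightarrow> agree c s (nset a i x s')"
  by (auto simp: agree_def)

lemma agree_trans:
  "agree c s s' \<Longrightarrow> agree d s' s'' \<Longrightarrow> nwrites d \<subseteq> nwrites c \<Longrightarrow> rwrites d \<subseteq> rwrites c \<Longrightarrow>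
   agree c s s''"
  unfolding agree_def by (metis subsetD)

section \<open>The preparatory phases: addresses, total length, growth order\<close>

definition rows :: "nat \<Rightarrow> state \<Rightarrow> bool" where
  "rows n s \<longleftrightarrow> (\<forall>x\<le>2 * n * n. nmem s ''row'' x = x * n)"

lemma runs_add_row:
  assumes s: "nmem s ''n'' 0 = n" "nmem s ''row'' 0 = 0"
    and b: "\<And>s'. agree (For ''i'' b add_row) s s' \<Longrightarrow> nval b s' = N"
  shows "runs (For ''i'' b add_row) s (N * 3 + 2) (\<lambda>s'. \<forall>x\<le>N. nmem s' ''row'' x = x * n)"
proof (rule runs_For[where I = "\<lambda>k s'. \<forall>x\<le>k. nmem s' ''row'' x = x * n" and T = 1])
  fix k s'
  assume *: "k < N" "\<forall>x\<le>k. nmem s' ''row'' x = x * n" "nmem s' ''i'' 0 = k"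
    "agree (For ''i'' b add_row) s s'"
  have "nmem s' ''n'' 0 = n" using agree_nmem[OF *(4), of "''n''"] s by (simp add: add_row_def)
  then show "runs add_row s' 1 (\<lambda>s''. agree add_row s' s'' \<longrightarrow>
      (\<forall>x\<le>Suc k. nmem (nset ''i'' 0 (Suc k) s'') ''row'' x = x * n))"
    using * unfolding add_row_def by (intro runs_NSet) (auto simp: le_Suc_eq)
qed (use assms in \<open>auto simp: add_row_def\<close>)

lemma runs_init_rows:
  assumes "nmem s ''n'' 0 = n" "nmem s ''row'' 0 = 0" "1 \<le> n"
  shows "runs init_rows s (17 * n ^ 2) (rows n)"
proof -
  have 1: "runs (For ''i'' (NPlus (nvar ''n'') (nvar ''n'')) add_row) s ((2 * n) * 3 + 2)
      (\<lambda>s'. \<forall>x\<le>2 * n. nmem s' ''row'' x = x * n)"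
    using assms by (intro runs_add_row) (auto simp: agree_def add_row_def)
  have "runs init_rows s (((2 * n) * 3 + 2) + (1 + ((2 * n * n) * 3 + 2))) (rows n)"
    unfolding init_rows_def
  proof (rule runs_Seq[OF runs_mono[OF 1 order.refl]], intro impI)
    fix s1 assume s1: "\<forall>x\<le>2 * n. nmem s1 ''row'' x = x * n"
      "agree (For ''i'' (NPlus (nvar ''n'') (nvar ''n'')) add_row) s s1"
    have n1: "nmem s1 ''n'' 0 = n" using agree_nmem[OF s1(2), of "''n''"] assms
      by (simp add: add_row_def)
    let ?s2 = "nset ''m'' 0 (2 * n * n) s1"
    have 2: "runs (For ''i'' (nvar ''m'') add_row) ?s2 ((2 * n * n) * 3 + 2)
        (\<lambda>s'. \<forall>x\<le>2 * n * n. nmem s' ''row'' x = x * n)"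
      using s1(1) n1 by (intro runs_add_row) (auto simp: agree_def add_row_def)
    show "runs (Seq (nlet ''m'' (NGet ''row'' (NPlus (nvar ''n'') (nvar ''n''))))
        (For ''i'' (nvar ''m'') add_row)) s1 (1 + ((2 * n * n) * 3 + 2)) (rows n)"
      by (intro runs_Seq[where ?T1.0 = 1 and ?T2.0 = "(2 * n * n) * 3 + 2"] runs_NSet)
        (use 2 n1 s1(1) in \<open>simp_all add: mult_2 rows_def[abs_def]\<close>)
  qed simp_all
  moreover have "((2 * n) * 3 + 2) + (1 + ((2 * n * n) * 3 + 2)) \<le> 17 * n ^ 2"
  proof -
    have "n \<le> n * n" "1 \<le> n * n" using assms(3) by auto
    then show ?thesis unfolding power2_eq_square by linarith
  qed
  ultimately show ?thesis by (rule runs_mono)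
qed

lemma nval_slot_exp:
  assumes "rows n s" "nval i s < 2 * n" "nval u s < n"
  shows "nval (slot_exp i u k) s = slot n (nval i s) (nval u s) (nval k s)"
proof -
  have "nval i s * n + nval u s < Suc (nval i s) * n" using assms(3) by simp
  also have "\<dots> \<le> 2 * n * n" using assms(2) by (intro mult_le_mono1) simp
  finally have "nval i s * n + nval u s \<le> 2 * n * n" by simp
  moreover have "nval i s \<le> 2 * n * n" using assms(2) by (cases n) auto
  ultimately show ?thesis using assms(1) by (simp add: slot_exp_def slot_def rows_def)
qed

lemma rows_agree: "rows n s \<Longrightarrow> agree c s s' \<Longrightarrow> ''row'' \<notin> nwrites c \<Longrightarrow> rows n s'"
  by (simp add: rows_def agree_def)

lemma rows_nset: "a \<noteq> ''row'' \<Longrightarrow> rows n (nset a i x s) \<longleftrightarrow> rows n s"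
  by (simp add: rows_def)

locale contraction_instance =
  fixes n :: nat and E :: "nat set set" and l :: "nat set \<Rightarrow> real" and \<alpha> \<beta> :: real
    and es :: "(nat \<times> nat) list"
  assumes tree: "tree {..<n} E" and pos: "\<forall>e\<in>E. l e > 0" and \<alpha>: "\<alpha> \<ge> 1" and \<beta>: "\<beta> \<ge> 0"
    and es: "edge_list es E"
begin

text \<open>\<open>L\<close> becomes the total length, which meets the bound in
  \<open>valid_iff\<close> with equality and which the program accumulates in
  \<open>lsum\<close>.\<close>

sublocale contraction_dp l \<alpha> \<beta> "sum l E"
  using \<alpha> \<beta> by unfold_locales

definition given :: "state \<Rightarrow> bool" where
  "given s \<longleftrightarrow> nmem s ''n'' 0 = n \<and>
     nmem s ''src'' = (\<lambda>i. if i < length es then fst (es ! i) else 0) \<and>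
     nmem s ''dst'' = (\<lambda>i. if i < length es then snd (es ! i) else 0) \<and>
     rmem s ''len'' = (\<lambda>i. if i < length es then l (edge_of (es ! i)) else 0) \<and>
     rmem s ''alpha'' 0 = \<alpha> \<and> rmem s ''beta'' 0 = \<beta>"

lemma given_agree:
  "given s \<Longrightarrow> agree c s s' \<Longrightarrow> {''n'', ''src'', ''dst''} \<inter> nwrites c = {} \<Longrightarrow>
   {''len'', ''alpha'', ''beta''} \<inter> rwrites c = {} \<Longrightarrow> given s'"
  by (simp add: given_def agree_def)

lemma n_pos: "1 \<le> n"
  using tree by (auto simp: tree_def connected_graph_def Suc_le_eq)

lemma finite_E: "finite E"
proof -
  have "E \<subseteq> Pow {..<n}" using tree by (auto simp: tree_def simple_graph_def)
  then show ?thesis by (rule finite_subset) simp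
qed

lemma length_es: "length es = n - 1"
  using es card_tree[OF tree] by (metis distinct_card edge_list_def length_map)

lemma edge_of_mem: "i < length es \<Longrightarrow> edge_of (es ! i) \<in> E"
  using es by (auto simp: edge_list_def)

lemma edge_index: "e \<in> E \<Longrightarrow> \<exists>i<length es. edge_of (es ! i) = e"
  using es unfolding edge_list_def by (metis in_set_conv_nth length_map nth_map)

lemma sum_lengths_eq: "(\<Sum>i<n. if i < length es then l (edge_of (es ! i)) else 0) = sum l E"
proof -
  have "(\<Sum>i<n. if i < length es then l (edge_of (es ! i)) else 0) = (\<Sum>i<length es. l (edge_of (es ! i)))"
    by (rule sum.mono_neutral_cong_right) (use length_es in auto)
  also have "\<dots> = sum_list (map l (map edge_of es))"
    by (simp add: sum_list_sum_nth atLeast0LessThan)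
  also have "\<dots> = sum l E"
    using es unfolding edge_list_def by (metis sum_list_distinct_conv_sum_set)
  finally show ?thesis .
qed

lemma runs_sum_lengths:
  assumes "given s" "rmem s ''lsum'' 0 = 0"
  shows "runs sum_lengths s (5 * n) (\<lambda>s'. rmem s' ''lsum'' 0 = sum l E)"
  unfolding sum_lengths_def
proof (rule runs_For[where T = 1 and N = n and
      I = "\<lambda>k s'. rmem s' ''lsum'' 0 = (\<Sum>i<k. if i < length es then l (edge_of (es ! i)) else 0)"])
  let ?c = "rlet ''lsum'' (RPlus (rvar ''lsum'') (RGet ''len'' (nvar ''i'')))"
  fix k s'
  assume *: "k < n" "rmem s' ''lsum'' 0 = (\<Sum>i<k. if i < length es then l (edge_of (es ! i)) else 0)"
    "nmem s' ''i'' 0 = k" "agree (For ''i'' (nvar ''n'') ?c) s s'"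
  have "given s'" by (rule given_agree[OF assms(1) *(4)]) simp_all
  then show "runs ?c s' 1 (\<lambda>s''. agree ?c s' s'' \<longrightarrow> rmem (nset ''i'' 0 (Suc k) s'') ''lsum'' 0 =
      (\<Sum>i<Suc k. if i < length es then l (edge_of (es ! i)) else 0))"
    using * by (intro runs_RSet) (simp_all add: given_def)
qed (use assms n_pos sum_lengths_eq in \<open>auto simp: agree_def given_def\<close>)

definition recorded :: "state \<Rightarrow> nat \<Rightarrow> bool" where
  "recorded s j \<longleftrightarrow> nmem s ''op'' j \<in> visited (nmem s ''oc'') j \<and>
     nmem s ''oc'' j \<notin> visited (nmem s ''oc'') j \<and> nmem s ''oc'' j < n \<and>
     nmem s ''oe'' j < length es \<and>
     edge_of (es ! (nmem s ''oe'' j)) = {nmem s ''op'' j, nmem s ''oc'' j}"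

definition order :: "state \<Rightarrow> nat \<Rightarrow> bool" where
  "order s m \<longleftrightarrow> (\<forall>j<m. recorded s j)"

lemma order_grown: "order s m \<Longrightarrow> grown n E (nmem s ''op'') (nmem s ''oc'') m"
  unfolding order_def grown_def recorded_def using edge_of_mem by metis

lemma recorded_cong:
  assumes "\<And>i. i \<le> j \<Longrightarrow> nmem s ''op'' i = nmem s' ''op'' i \<and> nmem s ''oc'' i = nmem s' ''oc'' i \<and>
    nmem s ''oe'' i = nmem s' ''oe'' i"
  shows "recorded s j = recorded s' j"
proof -
  have "visited (nmem s ''oc'') j = visited (nmem s' ''oc'') j"
    using assms by (intro visited_cong) auto
  then show ?thesis using assms[of j] by (simp add: recorded_def)
qed

lemma edge_ends_less: "i < length es \<Longrightarrow> fst (es ! i) < n \<and> snd (es ! i) < n"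
  using edge_of_mem[of i] tree by (fastforce simp: tree_def simple_graph_def edge_of_def doubleton_eq_iff)

lemma runs_find_crossing:
  assumes g: "given s" and j: "nmem s ''j'' 0 = j" "j < n - 1" and o: "order s j"
    and v: "\<And>v. 0 < nmem s ''vis'' v \<longleftrightarrow> v \<in> visited (nmem s ''oc'') j"
  shows "runs find_crossing s (9 * n) (\<lambda>s'. order s' (Suc j) \<and>
    visited (nmem s' ''oc'') j = visited (nmem s ''oc'') j)"
proof -
  let ?W = "visited (nmem s ''oc'') j"
  let ?body = "Cond (is_crossing ''src'' ''dst'') (record_edge ''src'' ''dst'')
       (Cond (is_crossing ''dst'' ''src'') (record_edge ''dst'' ''src'') Skip)"
  define same where "same s' \<longleftrightarrow> (\<forall>i<j. nmem s' ''op'' i = nmem s ''op'' i \<and>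
      nmem s' ''oc'' i = nmem s ''oc'' i \<and> nmem s' ''oe'' i = nmem s ''oe'' i)" for s' :: state
  define found where "found s' \<longleftrightarrow> nmem s' ''op'' j \<in> ?W \<and> nmem s' ''oc'' j \<notin> ?W \<and>
      nmem s' ''oc'' j < n \<and> nmem s' ''oe'' j < length es \<and>
      edge_of (es ! (nmem s' ''oe'' j)) = {nmem s' ''op'' j, nmem s' ''oc'' j}" for s' :: state
  define cross where "cross i \<longleftrightarrow> i < length es \<and> (fst (es ! i) \<in> ?W) \<noteq> (snd (es ! i) \<in> ?W)" for i
  \<comment> \<open>The loop also inspects index \<open>n - 1\<close>, behind the last edge. Both
    ends read 0 there, and as vertex 0 is visited this is no crossing.\<close>
  have zero: "0 \<in> ?W" by (simp add: visited_def)
  have time: "n * (5 + 2) + 2 \<le> 9 * n" using n_pos by simp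
  have find: "runs find_crossing s (9 * n) (\<lambda>s'. same s' \<and> ((\<exists>i<n. cross i) \<longrightarrow> found s'))"
    unfolding find_crossing_def
  proof (rule runs_For[where T = 5 and N = n and
        I = "\<lambda>k s'. same s' \<and> ((\<exists>i<k. cross i) \<longrightarrow> found s')"])
    fix k s' assume *: "k < n" "same s' \<and> ((\<exists>i<k. cross i) \<longrightarrow> found s')" "nmem s' ''i'' 0 = k"
      "agree (For ''i'' (nvar ''n'') ?body) s s'"
    have g': "given s'" by (rule given_agree[OF g *(4)]) (simp_all add: record_edge_def)
    have v': "0 < nmem s' ''vis'' x \<longleftrightarrow> x \<in> ?W" for x
      using agree_nmem[OF *(4), of "''vis''"] v by (simp add: record_edge_def)
    have j': "nmem s' ''j'' 0 = j"
      using agree_nmem[OF *(4), of "''j''"] j by (simp add: record_edge_def)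
    have c1: "bval (is_crossing ''src'' ''dst'') s' \<longleftrightarrow>
        k < length es \<and> fst (es ! k) \<in> ?W \<and> snd (es ! k) \<notin> ?W"
      using g' v' *(3) zero by (auto simp: is_crossing_def given_def)
    have c2: "bval (is_crossing ''dst'' ''src'') s' \<longleftrightarrow>
        k < length es \<and> snd (es ! k) \<in> ?W \<and> fst (es ! k) \<notin> ?W"
      using g' v' *(3) zero by (auto simp: is_crossing_def given_def)
    have upd: "runs (record_edge a b) s' 3 (\<lambda>s''. same s'' \<and> found s'')"
      if "nmem s' a k \<in> ?W" "nmem s' b k \<notin> ?W" "nmem s' b k < n" "k < length es"
        "edge_of (es ! k) = {nmem s' a k, nmem s' b k}" "a \<in> {''src'', ''dst''}" "b \<in> {''src'', ''dst''}"
      for a b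
      unfolding record_edge_def
      by (rule runs_NSet_Seq[where ?T2.0 = 2], rule runs_NSet_Seq[where ?T2.0 = 1],
          rule runs_NSet)
        (use that * j' in \<open>auto simp: same_def found_def\<close>)
    have "runs ?body s' 5 (\<lambda>s''. same s'' \<and> ((\<exists>i<Suc k. cross i) \<longrightarrow> found s''))"
    proof (rule runs_Cond[where T = 4])
      assume "bval (is_crossing ''src'' ''dst'') s'"
      then have "runs (record_edge ''src'' ''dst'') s' 3 (\<lambda>s''. same s'' \<and> found s'')"
        using c1 g' edge_ends_less[of k] by (intro upd) (auto simp: given_def edge_of_def)
      then show "runs (record_edge ''src'' ''dst'') s' 4
          (\<lambda>s''. same s'' \<and> ((\<exists>i<Suc k. cross i) \<longrightarrow> found s''))"
        by (rule runs_mono) auto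
    next
      assume n1: "\<not> bval (is_crossing ''src'' ''dst'') s'"
      show "runs (Cond (is_crossing ''dst'' ''src'') (record_edge ''dst'' ''src'') Skip) s' 4
          (\<lambda>s''. same s'' \<and> ((\<exists>i<Suc k. cross i) \<longrightarrow> found s''))"
      proof (rule runs_Cond[where T = 3])
        assume "bval (is_crossing ''dst'' ''src'') s'"
        then have "runs (record_edge ''dst'' ''src'') s' 3 (\<lambda>s''. same s'' \<and> found s'')"
          using c2 g' edge_ends_less[of k]
          by (intro upd) (auto simp: given_def edge_of_def insert_commute)
        then show "runs (record_edge ''dst'' ''src'') s' 3
            (\<lambda>s''. same s'' \<and> ((\<exists>i<Suc k. cross i) \<longrightarrow> found s''))"
          by (rule runs_mono) auto
      next
        assume "\<not> bval (is_crossing ''dst'' ''src'') s'"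
        then have "\<not> cross k" using n1 c1 c2 by (auto simp: cross_def)
        then show "runs Skip s' 3 (\<lambda>s''. same s'' \<and> ((\<exists>i<Suc k. cross i) \<longrightarrow> found s''))"
          using *(2) by (intro runs_Skip) (auto simp: less_Suc_eq)
      qed simp
    qed simp
    then show "runs ?body s' 5 (\<lambda>s''. agree ?body s' s'' \<longrightarrow> same (nset ''i'' 0 (Suc k) s'') \<and>
        ((\<exists>i<Suc k. cross i) \<longrightarrow> found (nset ''i'' 0 (Suc k) s'')))"
      by (rule runs_mono) (auto simp: same_def found_def)
  qed (use g time in \<open>auto simp: same_def given_def agree_def record_edge_def\<close>)
  \<comment> \<open>The tree is connected and not yet exhausted, so the scan cannot fail.\<close>
  obtain x y where xy: "x \<in> ?W" "y \<notin> ?W" "{x, y} \<in> E"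
    using grown_extend[OF tree order_grown[OF o] j(2)] by blast
  then obtain i where i: "i < length es" "edge_of (es ! i) = {x, y}" using edge_index by blast
  then have "cross i" using xy by (auto simp: cross_def edge_of_def doubleton_eq_iff)
  moreover have "i < n" using i length_es by simp
  ultimately have ex: "\<exists>i<n. cross i" by blast
  show ?thesis
  proof (rule runs_mono[OF find order.refl], intro conjI)
    fix s' assume s': "same s' \<and> ((\<exists>i<n. cross i) \<longrightarrow> found s')"
    then show vis: "visited (nmem s' ''oc'') j = ?W"
      by (intro visited_cong) (auto simp: same_def)
    have "recorded s' i" if "i < j" for i
      using o that s' recorded_cong[of i s s'] by (auto simp: order_def same_def)
    moreover have "recorded s' j" using s' ex vis by (simp add: found_def recorded_def)
    ultimately show "order s' (Suc j)" by (auto simp: order_def less_Suc_eq)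
  qed
qed

lemma runs_grow:
  assumes g: "given s" and v: "\<And>v. nmem s ''vis'' v = 0"
  shows "runs grow s (17 * n ^ 2) (\<lambda>s'. order s' (n - 1))"
proof -
  let ?body = "Seq find_crossing (NSet ''vis'' (NGet ''oc'' (nvar ''j'')) (NConst 1))"
  let ?b = "NMinus (nvar ''n'') (NConst 1)"
  let ?s1 = "nset ''vis'' 0 1 s"
  let ?I = "\<lambda>k s'. order s' k \<and> (\<forall>v. 0 < nmem s' ''vis'' v \<longleftrightarrow> v \<in> visited (nmem s' ''oc'') k)"
  have g1: "given ?s1" using g by (simp add: given_def)
  have loop: "runs (For ''j'' ?b ?body) ?s1 (14 * n ^ 2) (\<lambda>s'. order s' (n - 1))"
  proof (rule runs_For[where T = "10 * n ^ 1" and N = "n - 1" and I = ?I])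
    fix k s' assume *: "k < n - 1" "?I k s'" "nmem s' ''j'' 0 = k" "agree (For ''j'' ?b ?body) ?s1 s'"
    have g': "given s'"
      by (rule given_agree[OF g1 *(4)]) (simp_all add: find_crossing_def record_edge_def)
    have F: "runs find_crossing s' (9 * n) (\<lambda>s''. order s'' (Suc k) \<and>
        visited (nmem s'' ''oc'') k = visited (nmem s' ''oc'') k)"
      using g' * by (intro runs_find_crossing) auto
    show "runs ?body s' (10 * n ^ 1) (\<lambda>s''. agree ?body s' s'' \<longrightarrow>
        ?I (Suc k) (nset ''j'' 0 (Suc k) s''))"
    proof (rule runs_Seq[where ?T2.0 = 1, OF runs_mono[OF F order.refl]], rule impI)
      fix s'' assume s'': "order s'' (Suc k) \<and>
        visited (nmem s'' ''oc'') k = visited (nmem s' ''oc'') k" "agree find_crossing s' s''"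
      have vis: "nmem s'' ''vis'' = nmem s' ''vis''" "nmem s'' ''j'' = nmem s' ''j''"
        using agree_nmem[OF s''(2), of "''vis''"] agree_nmem[OF s''(2), of "''j''"]
        by (simp_all add: find_crossing_def record_edge_def)
      have rec: "order (nset ''j'' 0 (Suc k) (nset ''vis'' x 1 s'')) (Suc k)" for x
        using s''(1) recorded_cong[of _ s'' "nset ''j'' 0 (Suc k) (nset ''vis'' x 1 s'')"]
        by (auto simp: order_def)
      show "runs (NSet ''vis'' (NGet ''oc'' (nvar ''j'')) (NConst 1)) s'' 1
          (\<lambda>s''. agree ?body s' s'' \<longrightarrow> ?I (Suc k) (nset ''j'' 0 (Suc k) s''))"
        using s''(1) vis *(2,3) rec by (intro impI runs_NSet) (auto simp: visited_Suc)
    qed (use n_pos in auto)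
  next
    show "(n - 1) * (10 * n ^ 1 + 2) + 2 \<le> 14 * n ^ 2"
      using loop_time[of n "n - 1" 10 1] n_pos by (simp add: power2_eq_square)
  next
    show "?I 0 (nset ''j'' 0 0 ?s1)" using v by (simp add: order_def)
  next
    fix k s' assume "agree (For ''j'' ?b ?body) ?s1 s'"
    from agree_nmem[OF this, of "''n''"] show "nval ?b s' = n - 1"
      using g by (simp add: given_def find_crossing_def record_edge_def)
  qed (simp_all add: find_crossing_def record_edge_def)
  have "1 + 14 * n ^ 2 \<le> 17 * n ^ 2" using n_pos by (simp add: Suc_le_eq)
  then show ?thesis
    unfolding grow_def using loop
    by (intro runs_Seq[where ?T1.0 = 1 and ?T2.0 = "14 * n ^ 2"] runs_NSet) simp_all
qed

end

section \<open>Merging two tables\<close>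

definition slot1 :: nexp where "slot1 = nvar ''s1''"
definition slot2 :: nexp where "slot2 = nvar ''s2''"

definition weight_exp :: rexp where
  "weight_exp = RGet ''len'' (nvar ''e'')"

definition scaled_exp :: rexp where
  "scaled_exp = RDivide weight_exp (rvar ''alpha'')"

definition extend :: "bool \<Rightarrow> com" where
  "extend f = (if f
     then Seq (rlet ''x'' (RPlus (RGet ''av'' slot2) scaled_exp))
       (rlet ''y'' (RPlus (RGet ''bv'' slot2) scaled_exp))
     else Seq (rlet ''x'' (RConst 0))
       (Seq (Cond (RLess (RGet ''av'' slot2) (RGet ''bv'' slot2))
              (rlet ''y'' (RGet ''bv'' slot2)) (rlet ''y'' (RGet ''av'' slot2)))
         (rlet ''y'' (RMinus (rvar ''y'') (RMinus weight_exp scaled_exp)))))"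

definition compatible_exp :: bexp where
  "compatible_exp = BAnd (BNot (RLess (rvar ''beta'') (RPlus (RGet ''av'' slot1) (rvar ''y''))))
     (BAnd (BNot (RLess (rvar ''beta'') (RPlus (RGet ''bv'' slot1) (rvar ''x''))))
       (BNot (RLess (rvar ''beta'') (RPlus (RGet ''bv'' slot1) (rvar ''y'')))))"

definition choose_slot :: "bool \<Rightarrow> com" where
  "choose_slot f = Seq (Cond (RLess (RGet ''av'' slot1) (rvar ''x''))
       (Seq (rlet ''a'' (rvar ''x'')) (nlet ''u'' (nvar ''u2'')))
       (Seq (rlet ''a'' (RGet ''av'' slot1)) (nlet ''u'' (nvar ''u1''))))
     (Seq (Cond (RLess (RGet ''bv'' slot1) (rvar ''y''))
            (rlet ''b'' (rvar ''y'')) (rlet ''b'' (RGet ''bv'' slot1)))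
       (nlet ''s'' (slot_exp (nvar ''id'') (nvar ''u'')
          (NPlus (NPlus (nvar ''k1'') (nvar ''k2'')) (NConst (of_bool f))))))"

definition better_exp :: bexp where
  "better_exp = BNot (BAnd (NLess (NConst 0) (NGet ''ptr'' (nvar ''s'')))
     (BNot (RLess (rvar ''b'') (RGet ''bv'' (nvar ''s'')))))"

text \<open>\<open>ptr\<close> is merely a flag for the presence of an entry. Edge indices are
  shifted by one in \<open>ne\<close>, so that 0 stands for no edge.\<close>

definition store :: "bool \<Rightarrow> com" where
  "store f = Seq (NSet ''ptr'' (nvar ''s'') (NConst 1))
     (Seq (RSet ''av'' (nvar ''s'') (rvar ''a''))
     (Seq (RSet ''bv'' (nvar ''s'') (rvar ''b''))
     (Seq (NSet ''nl'' (nvar ''s'') slot1)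
     (Seq (NSet ''nr'' (nvar ''s'') slot2)
       (NSet ''ne'' (nvar ''s'')
         (if f then NPlus (nvar ''e'') (NConst 1) else NConst 0))))))"

definition address :: com where
  "address = Seq (nlet ''s1'' (slot_exp (nvar ''lc'') (nvar ''u1'') (nvar ''k1'')))
     (nlet ''s2'' (slot_exp (nvar ''rc'') (nvar ''u2'') (nvar ''k2'')))"

definition merge_step :: "bool \<Rightarrow> com" where
  "merge_step f = Seq address
     (Cond (BAnd (NLess (NConst 0) (NGet ''ptr'' slot1)) (NLess (NConst 0) (NGet ''ptr'' slot2)))
       (Seq (extend f)
         (Cond compatible_exp
           (Seq (choose_slot f) (Cond better_exp (store f) Skip))
           Skip))
       Skip)"

definition merge_loop :: com where
  "merge_loop = For ''u1'' (nvar ''n'') (For ''k1'' (nvar ''n'')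
     (For ''u2'' (nvar ''n'') (For ''k2'' (nvar ''n'')
       (Seq (merge_step False) (merge_step True)))))"

lemmas merge_defs = merge_loop_def merge_step_def address_def store_def choose_slot_def
  extend_def compatible_exp_def better_exp_def

lemma nwrites_merge_loop: "nwrites merge_loop =
    {''u1'', ''k1'', ''u2'', ''k2'', ''s1'', ''s2'', ''u'', ''s'', ''ptr'', ''nl'', ''nr'', ''ne''}"
  and rwrites_merge_loop: "rwrites merge_loop = {''x'', ''y'', ''a'', ''b'', ''av'', ''bv''}"
  by (auto simp: merge_defs)

text \<open>This serves only to bound the writes of a merge step that precede \<open>store\<close>.\<close>

definition temps :: com where
  "temps = Seq address (Seq (extend True) (choose_slot True))"

lemma nwrites_temps: "nwrites temps = {''s1'', ''s2'', ''u'', ''s''}"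
  and rwrites_temps: "rwrites temps = {''x'', ''y'', ''a'', ''b''}"
  by (auto simp: merge_defs temps_def)

lemma nwrites_extend: "nwrites (extend f) = {}"
  and rwrites_extend: "rwrites (extend f) = {''x'', ''y''}"
  and nwrites_choose_slot: "nwrites (choose_slot f) = {''u'', ''s''}"
  and rwrites_choose_slot: "rwrites (choose_slot f) = {''a'', ''b''}"
  and nwrites_address: "nwrites address = {''s1'', ''s2''}"
  and rwrites_address: "rwrites address = {}"
  by (auto simp: merge_defs)

text \<open>For nested loops whose only purpose is to treat every combination of indices:
  \<open>Q\<close> collects what has been processed, and the bound has the shape of
  \<open>loop_time\<close>.\<close>

lemma runs_For_collect:
  assumes "x \<notin> nwrites c" "x \<noteq> ''n''" "''n'' \<notin> nwrites c"
    and n: "nmem s0 ''n'' 0 = n" "1 \<le> n"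
    and inv: "\<And>Q k s. Inv Q s \<Longrightarrow> Inv Q (nset x 0 k s)"
    and init: "Inv Q0 s0"
    and body: "\<And>Q k s. \<lbrakk>k < n; Inv Q s; nmem s x 0 = k; agree (For x (nvar ''n'') c) s0 s\<rbrakk> \<Longrightarrow>
      runs c s (K * n ^ i) (Inv (Q \<union> R k))"
  shows "runs (For x (nvar ''n'') c) s0 ((K + 4) * n ^ Suc i) (Inv (Q0 \<union> (\<Union>k<n. R k)))"
proof (rule runs_For[where N = n and T = "K * n ^ i" and I = "\<lambda>k. Inv (Q0 \<union> (\<Union>j<k. R j))"])
  fix k s
  assume *: "k < n" "Inv (Q0 \<union> (\<Union>j<k. R j)) s" "nmem s x 0 = k" "agree (For x (nvar ''n'') c) s0 s"
  have "(Q0 \<union> (\<Union>j<k. R j)) \<union> R k = Q0 \<union> (\<Union>j<Suc k. R j)" by (auto simp: lessThan_Suc)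
  with body[OF *] have "runs c s (K * n ^ i) (Inv (Q0 \<union> (\<Union>j<Suc k. R j)))" by simp
  then show "runs c s (K * n ^ i) (\<lambda>s'. agree c s s' \<longrightarrow>
      Inv (Q0 \<union> (\<Union>j<Suc k. R j)) (nset x 0 (Suc k) s'))"
    by (rule runs_mono) (auto intro: inv)
next
  show "n * (K * n ^ i + 2) + 2 \<le> (K + 4) * n ^ Suc i" by (rule loop_time) (use n in auto)
next
  fix k s assume "agree (For x (nvar ''n'') c) s0 s"
  then show "nval (nvar ''n'') s = n" using assms by (simp add: agree_def)
qed (use assms in auto)

section \<open>Tables and back pointers in memory\<close>

context contraction_instance
begin

text \<open>Under this condition a write at or above \<open>M\<close> changes the solution of no
  node but the one written, because all nodes, wherever they are, refer to cells below
  \<open>M\<close>.\<close>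

definition lower :: "nat \<Rightarrow> state \<Rightarrow> bool" where
  "lower M s \<longleftrightarrow> (\<forall>x. nmem s ''nl'' x < M \<and> nmem s ''nr'' x < M)"

text \<open>Node 0 points to itself and carries no edge. It is the entry of leaf 0 and serves as the
  empty solution for all leaves.\<close>

definition descending :: "state \<Rightarrow> bool" where
  "descending s \<longleftrightarrow> (\<forall>x>0. nmem s ''nl'' x < x \<and> nmem s ''nr'' x < x) \<and>
     nmem s ''nl'' 0 = 0 \<and> nmem s ''nr'' 0 = 0 \<and> nmem s ''ne'' 0 = 0 \<and>
     (\<forall>x. nmem s ''ne'' x \<le> length es)"

definition indices :: "state \<Rightarrow> nat \<Rightarrow> nat set" where
  "indices s = dag (nmem s ''nl'') (nmem s ''nr'') (nmem s ''ne'')"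

definition solution :: "state \<Rightarrow> nat \<Rightarrow> nat set set" where
  "solution s x = (\<lambda>i. edge_of (es ! i)) ` indices s x"

text \<open>The range checks make an address within a block determine the pair.\<close>

abbreviation present :: "state \<Rightarrow> nat \<Rightarrow> nat \<Rightarrow> nat \<Rightarrow> bool" where
  "present s i u k \<equiv> u < n \<and> k < n \<and> 0 < nmem s ''ptr'' (slot n i u k)"

abbreviation boundA :: "state \<Rightarrow> nat \<Rightarrow> nat \<Rightarrow> nat \<Rightarrow> real" where
  "boundA s i u k \<equiv> rmem s ''av'' (slot n i u k)"

abbreviation boundB :: "state \<Rightarrow> nat \<Rightarrow> nat \<Rightarrow> nat \<Rightarrow> real" where
  "boundB s i u k \<equiv> rmem s ''bv'' (slot n i u k)"

abbreviation solution_at :: "state \<Rightarrow> nat \<Rightarrow> nat \<Rightarrow> nat \<Rightarrow> nat set set" where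
  "solution_at s i u k \<equiv> solution s (slot n i u k)"

definition table_at :: "state \<Rightarrow> nat \<Rightarrow> nat btree \<Rightarrow> bool" where
  "table_at s i t \<longleftrightarrow> table t (present s i) (boundA s i) (boundB s i) (solution_at s i)"

definition same_below :: "nat \<Rightarrow> state \<Rightarrow> state \<Rightarrow> bool" where
  "same_below M s s' \<longleftrightarrow> (\<forall>x<M. nmem s' ''ptr'' x = nmem s ''ptr'' x \<and>
     nmem s' ''nl'' x = nmem s ''nl'' x \<and> nmem s' ''nr'' x = nmem s ''nr'' x \<and>
     nmem s' ''ne'' x = nmem s ''ne'' x \<and>
     rmem s' ''av'' x = rmem s ''av'' x \<and> rmem s' ''bv'' x = rmem s ''bv'' x)"

lemma indices_below: "same_below M s s' \<Longrightarrow> x < M \<Longrightarrow> indices s' x = indices s x"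
  unfolding indices_def by (rule dag_cong) (auto simp: same_below_def)

text \<open>Block \<open>i\<close> lies below block \<open>j\<close>, and solutions are collected
  along strictly descending pointers, so nothing at or above block \<open>j\<close> is
  consulted.\<close>

lemma table_at_below:
  assumes "table_at s i t" "same_below (slot n j 0 0) s s'" "i < j"
  shows "table_at s' i t"
  unfolding table_at_def
proof (rule table_mono[OF assms(1)[unfolded table_at_def]])
  have eq: "x < slot n j 0 0" if "x = slot n i u k" "u < n" "k < n" for x u k
    using slot_less[OF assms(3) that(2,3)] that(1) by simp
  show "present s i u k \<longleftrightarrow> present s' i u k" for u k
    using eq[of "slot n i u k" u k] assms(2) by (auto simp: same_below_def)
  show "boundA s' i u k = boundA s i u k \<and> boundB s' i u k = boundB s i u k \<and>
      solution_at s' i u k = solution_at s i u k" if "present s i u k" for u k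
    using eq[of "slot n i u k" u k] assms(2) indices_below[OF assms(2)] that
    by (auto simp: same_below_def solution_def)
qed

lemma runs_extend:
  assumes "given s"
  shows "runs (extend f) s 5 (\<lambda>s'.
    rmem s' ''x'' 0 = extA f (rmem s ''len'' (nmem s ''e'' 0)) (rmem s ''av'' (nmem s ''s2'' 0)) \<and>
    rmem s' ''y'' 0 = extB f (rmem s ''len'' (nmem s ''e'' 0)) (rmem s ''av'' (nmem s ''s2'' 0))
      (rmem s ''bv'' (nmem s ''s2'' 0)))"
proof (cases f)
  case True
  then show ?thesis
    using assms unfolding extend_def
    by (auto intro!: runs_Seq[where ?T1.0 = 1 and ?T2.0 = 1] runs_RSet
        simp: extA_def extB_def slot2_def scaled_exp_def weight_exp_def given_def)
next
  case False
  let ?w = "rmem s ''len'' (nmem s ''e'' 0)" let ?s2 = "nmem s ''s2'' 0"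
  let ?max = "Cond (RLess (RGet ''av'' slot2) (RGet ''bv'' slot2))
    (rlet ''y'' (RGet ''bv'' slot2)) (rlet ''y'' (RGet ''av'' slot2))"
  let ?rest = "Seq ?max (rlet ''y'' (RMinus (rvar ''y'') (RMinus weight_exp scaled_exp)))"
  let ?Q = "\<lambda>s'. rmem s' ''x'' 0 = 0 \<and>
    rmem s' ''y'' 0 = extB f ?w (rmem s ''av'' ?s2) (rmem s ''bv'' ?s2)"
  let ?s1 = "rset ''x'' 0 0 s"
  have 1: "runs ?max ?s1 2 (\<lambda>s'. rmem s' ''y'' 0 = max (rmem s ''av'' ?s2) (rmem s ''bv'' ?s2))"
    by (rule runs_Cond[where T = 1]; (rule runs_RSet)?) (auto simp: slot2_def)
  have 2: "runs ?rest ?s1 3 ?Q"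
    by (rule runs_Seq[where ?T2.0 = 1, OF runs_mono[OF 1 order.refl]], rule impI, rule runs_RSet)
      (use False assms in \<open>auto simp: extB_def scaled_exp_def weight_exp_def given_def agree_def\<close>)
  have "runs (Seq (rlet ''x'' (RConst 0)) ?rest) s 5 ?Q"
    by (rule runs_RSet_Seq[where ?T2.0 = 3]) (use 2 in simp_all)
  then show ?thesis using False by (simp add: extend_def extA_def)
qed

lemma runs_choose_slot:
  assumes "rows n s" "nmem s ''id'' 0 < 2 * n" "nmem s ''u1'' 0 < n" "nmem s ''u2'' 0 < n"
  defines "s1 \<equiv> nmem s ''s1'' 0"
  defines "v \<equiv> if rmem s ''av'' s1 < rmem s ''x'' 0 then nmem s ''u2'' 0 else nmem s ''u1'' 0"
  shows "runs (choose_slot f) s 6 (\<lambda>s'. rmem s' ''a'' 0 = max (rmem s ''av'' s1) (rmem s ''x'' 0) \<and>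
    rmem s' ''b'' 0 = max (rmem s ''bv'' s1) (rmem s ''y'' 0) \<and>
    nmem s' ''s'' 0 =
      slot n (nmem s ''id'' 0) v (nmem s ''k1'' 0 + nmem s ''k2'' 0 + of_bool f))"
proof -
  let ?c1 = "Cond (RLess (RGet ''av'' slot1) (rvar ''x''))
       (Seq (rlet ''a'' (rvar ''x'')) (nlet ''u'' (nvar ''u2'')))
       (Seq (rlet ''a'' (RGet ''av'' slot1)) (nlet ''u'' (nvar ''u1'')))"
  let ?c2 = "Cond (RLess (RGet ''bv'' slot1) (rvar ''y''))
            (rlet ''b'' (rvar ''y'')) (rlet ''b'' (RGet ''bv'' slot1))"
  let ?P1 = "\<lambda>s'. rmem s' ''a'' 0 = max (rmem s ''av'' s1) (rmem s ''x'' 0) \<and> nmem s' ''u'' 0 = v"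
  let ?P2 = "\<lambda>s'. rmem s' ''b'' 0 = max (rmem s ''bv'' s1) (rmem s ''y'' 0)"
  have 1: "runs ?c1 s 3 ?P1"
    by (rule runs_Cond[where T = 2]; (rule runs_Seq[where ?T1.0 = 1 and ?T2.0 = 1], rule runs_RSet)?)
      (auto intro!: runs_NSet simp: slot1_def s1_def v_def)
  show ?thesis
    unfolding choose_slot_def
  proof (rule runs_Seq[where ?T2.0 = 3, OF runs_mono[OF 1 order.refl]], rule impI)
    fix s' assume s': "?P1 s'" "agree ?c1 s s'"
    have mn: "nmem s' b = nmem s b" if "b \<noteq> ''u''" for b
      using s'(2) that by (auto simp: agree_def)
    have mr: "rmem s' c = rmem s c" if "c \<noteq> ''a''" for c
      using s'(2) that by (auto simp: agree_def)
    have 2: "runs ?c2 s' 2 ?P2"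
      by (rule runs_Cond[where T = 1]; (rule runs_RSet)?) (auto simp: slot1_def s1_def mn mr)
    show "runs (Seq ?c2 (nlet ''s'' (slot_exp (nvar ''id'') (nvar ''u'')
          (NPlus (NPlus (nvar ''k1'') (nvar ''k2'')) (NConst (of_bool f)))))) s' 3
        (\<lambda>s'. rmem s' ''a'' 0 = max (rmem s ''av'' s1) (rmem s ''x'' 0) \<and> ?P2 s' \<and> nmem s' ''s'' 0 =
          slot n (nmem s ''id'' 0) v (nmem s ''k1'' 0 + nmem s ''k2'' 0 + of_bool f))"
    proof (rule runs_Seq[where ?T2.0 = 1, OF runs_mono[OF 2 order.refl]], rule impI)
      fix s'' assume s'': "?P2 s''" "agree ?c2 s' s''"
      have m2: "nmem s'' b = nmem s' b" for b
        using s''(2) by (auto simp: agree_def)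
      have mr2: "rmem s'' c = rmem s' c" if "c \<noteq> ''b''" for c
        using s''(2) that by (auto simp: agree_def)
      have "nmem s'' ''u'' 0 = v" using s'(1) m2 by simp
      moreover have "v < n" using assms by (simp add: v_def)
      moreover have "rows n s''" using assms(1) mn m2 by (simp add: rows_def)
      ultimately have "nval (slot_exp (nvar ''id'') (nvar ''u'')
          (NPlus (NPlus (nvar ''k1'') (nvar ''k2'')) (NConst (of_bool f)))) s'' =
          slot n (nmem s ''id'' 0) v (nmem s ''k1'' 0 + nmem s ''k2'' 0 + of_bool f)"
        using assms(2) mn m2 by (subst nval_slot_exp) auto
      then show "runs (nlet ''s'' (slot_exp (nvar ''id'') (nvar ''u'')
          (NPlus (NPlus (nvar ''k1'') (nvar ''k2'')) (NConst (of_bool f))))) s'' 1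
        (\<lambda>s'. rmem s' ''a'' 0 = max (rmem s ''av'' s1) (rmem s ''x'' 0) \<and> ?P2 s' \<and> nmem s' ''s'' 0 =
          slot n (nmem s ''id'' 0) v (nmem s ''k1'' 0 + nmem s ''k2'' 0 + of_bool f))"
        using s''(1) s'(1) mr2 by (intro runs_NSet) auto
    qed simp_all
  qed simp_all
qed

lemma bval_compatible:
  "given s \<Longrightarrow> bval compatible_exp s \<longleftrightarrow> compatible (rmem s ''av'' (nmem s ''s1'' 0))
     (rmem s ''bv'' (nmem s ''s1'' 0)) (rmem s ''x'' 0) (rmem s ''y'' 0)"
  by (auto simp: compatible_exp_def compatible_def slot1_def given_def)

end

section \<open>Correctness of a single merge\<close>

locale merge_instance = contraction_instance n E l \<alpha> \<beta> es
  for n E l \<alpha> \<beta> es +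
  fixes s0 :: state and t1 t2 :: "nat btree" and lc rc id e :: nat
  assumes given0: "given s0" and rows0: "rows n s0"
    and vars0: "nmem s0 ''lc'' 0 = lc" "nmem s0 ''rc'' 0 = rc" "nmem s0 ''id'' 0 = id"
      "nmem s0 ''e'' 0 = e"
    and ids: "lc < id" "rc < id" "id < 2 * n"
    and edge: "e < length es" "edge_of (es ! e) = join_edge t1 t2"
    and tables: "table_at s0 lc t1" "table_at s0 rc t2"
    and wf: "wf_btree (Join t1 t2)" "verts (Join t1 t2) \<subseteq> {..<n}" "edges (Join t1 t2) \<subseteq> E"
    and fresh: "\<forall>x\<ge>slot n id 0 0. nmem s0 ''ptr'' x = 0"
    and lower0: "lower (slot n id 0 0) s0" and desc0: "descending s0"
begin

abbreviation merged :: "(nat \<times> nat \<times> nat \<times> nat \<times> bool) set \<Rightarrow> state \<Rightarrow> bool" where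
  "merged Q s \<equiv> merging t1 t2 (present s0 lc) (boundA s0 lc) (boundB s0 lc) (solution_at s0 lc)
     (present s0 rc) (boundA s0 rc) (boundB s0 rc) (solution_at s0 rc)
     Q (present s id) (boundA s id) (boundB s id) (solution_at s id)"

text \<open>Entries of the new table may be overwritten while it is being filled. This is harmless
  because all pointers, also those of new entries, lead below block \<open>id\<close> into tables
  that stay fixed.\<close>

definition Inv :: "(nat \<times> nat \<times> nat \<times> nat \<times> bool) set \<Rightarrow> state \<Rightarrow> bool" where
  "Inv Q s \<longleftrightarrow> agree merge_loop s0 s \<and> same_below (slot n id 0 0) s0 s \<and>
     lower (slot n id 0 0) s \<and> descending s \<and>
     (\<forall>x\<ge>slot n (Suc id) 0 0. nmem s ''ptr'' x = 0) \<and> merged Q s"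

lemma Inv_cong:
  assumes "Inv Q s" "agree merge_loop s0 s'"
    and "nmem s' ''ptr'' = nmem s ''ptr''" "nmem s' ''nl'' = nmem s ''nl''"
      "nmem s' ''nr'' = nmem s ''nr''" "nmem s' ''ne'' = nmem s ''ne''"
      "rmem s' ''av'' = rmem s ''av''" "rmem s' ''bv'' = rmem s ''bv''"
  shows "Inv Q s'"
  using assms unfolding Inv_def same_below_def lower_def descending_def solution_def[abs_def]
    indices_def by simp

lemma Inv_temps:
  assumes "Inv Q s" "agree temps s s'"
  shows "Inv Q s'"
proof (rule Inv_cong[OF assms(1)])
  show "agree merge_loop s0 s'"
    by (rule agree_trans[of _ _ s, OF _ assms(2)])
      (use assms(1) in \<open>auto simp: Inv_def nwrites_merge_loop rwrites_merge_loop
         nwrites_temps rwrites_temps\<close>)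
qed (use assms(2) in \<open>simp_all add: agree_def nwrites_temps rwrites_temps\<close>)

lemma Inv_nset:
  assumes "Inv Q s" "x \<in> {''u1'', ''k1'', ''u2'', ''k2''}"
  shows "Inv Q (nset x 0 k s)"
proof (rule Inv_cong[OF assms(1)])
  show "agree merge_loop s0 (nset x 0 k s)"
    by (rule agree_nset) (use assms in \<open>auto simp: Inv_def nwrites_merge_loop\<close>)
qed (use assms(2) in auto)

lemma Inv_static:
  assumes "Inv Q s"
  shows "given s" "rows n s" "nmem s ''lc'' 0 = lc" "nmem s ''rc'' 0 = rc" "nmem s ''id'' 0 = id"
    "nmem s ''e'' 0 = e"
proof -
  have ag: "agree merge_loop s0 s" using assms by (simp add: Inv_def)
  show "given s" by (rule given_agree[OF given0 ag])
      (simp_all add: nwrites_merge_loop rwrites_merge_loop)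
  show "rows n s" by (rule rows_agree[OF rows0 ag]) (simp add: nwrites_merge_loop)
  show "nmem s ''lc'' 0 = lc" "nmem s ''rc'' 0 = rc" "nmem s ''id'' 0 = id" "nmem s ''e'' 0 = e"
    using vars0 by (simp_all add: agree_nmem[OF ag] nwrites_merge_loop)
qed

lemma child_slots: "u < n \<Longrightarrow> k < n \<Longrightarrow> slot n lc u k < slot n id 0 0"
  "u < n \<Longrightarrow> k < n \<Longrightarrow> slot n rc u k < slot n id 0 0"
  using slot_less ids by auto

text \<open>The two parts and the joining edge together have fewer edges than the joined tree has
  vertices, so the count stays inside the block.\<close>

lemma combined_less:
  assumes u: "u1 < n" "u2 < n" and p: "present s0 lc u1 k1" "present s0 rc u2 k2"
    and c: "combined w (u1, k1, u2, k2, f) a1 b1 a2 b2 = (True, u, k, x, y)"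
  shows "u < n" "k < n"
proof -
  show "u < n" using c u by (auto simp: combined_def Let_def split: if_splits)
  have "k1 < card (verts t1)" "k2 < card (verts t2)"
    using table_card_less[OF _ tables(1)[unfolded table_at_def] p(1)]
      table_card_less[OF _ tables(2)[unfolded table_at_def] p(2)] wf(1) by auto
  moreover have "card (verts t1) + card (verts t2) \<le> n"
    using card_mono[OF _ wf(2)] wf(1) by (simp add: card_Un_disjoint)
  moreover have "k \<le> k1 + k2 + 1" using c by (auto simp: combined_def Let_def)
  ultimately show "k < n" by linarith
qed

lemma runs_store:
  assumes I: "Inv Q s" and u: "u1 < n" "k1 < n" "u2 < n" "k2 < n"
    and p: "present s0 lc u1 k1" "present s0 rc u2 k2"
    and c: "combined (l (join_edge t1 t2)) (u1, k1, u2, k2, f) (boundA s0 lc) (boundB s0 lc)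
      (boundA s0 rc) (boundB s0 rc) = (True, u, k, x, y)"
    and v: "nmem s ''s1'' 0 = slot n lc u1 k1" "nmem s ''s2'' 0 = slot n rc u2 k2"
      "nmem s ''s'' 0 = slot n id u k" "rmem s ''a'' 0 = x" "rmem s ''b'' 0 = y"
    and better: "present s id u k \<Longrightarrow> y \<le> boundB s id u k"
  shows "runs (store f) s 6 (Inv (insert (u1, k1, u2, k2, f) Q))"
proof -
  let ?M = "slot n id 0 0" let ?s1 = "slot n lc u1 k1" let ?s2 = "slot n rc u2 k2"
  let ?sv = "slot n id u k"
  note static = Inv_static[OF I]
  define s' where "s' = nset ''ne'' ?sv (if f then e + 1 else 0) (nset ''nr'' ?sv ?s2
    (nset ''nl'' ?sv ?s1 (rset ''bv'' ?sv y (rset ''av'' ?sv x (nset ''ptr'' ?sv 1 s)))))"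
  have mem: "nmem s' ''ptr'' = (nmem s ''ptr'')(?sv := 1)" "nmem s' ''nl'' = (nmem s ''nl'')(?sv := ?s1)"
    "nmem s' ''nr'' = (nmem s ''nr'')(?sv := ?s2)"
    "nmem s' ''ne'' = (nmem s ''ne'')(?sv := if f then e + 1 else 0)"
    "rmem s' ''av'' = (rmem s ''av'')(?sv := x)" "rmem s' ''bv'' = (rmem s ''bv'')(?sv := y)"
    by (simp_all add: s'_def)
  have uk: "u < n" "k < n" using combined_less[OF u(1,3) p c] by auto
  have sv: "?M \<le> ?sv" "?sv < slot n (Suc id) 0 0"
    using slot_ge slot_less[of id "Suc id" u n k] uk by auto
  have below: "?s1 < ?M" "?s2 < ?M" using child_slots u by auto
  have sb: "same_below ?M s0 s" "lower ?M s" "descending s" "merged Q s"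
    using I by (auto simp: Inv_def)
  have sb': "same_below ?M s s'" using sv by (auto simp: same_below_def mem)
  then have sb0: "same_below ?M s0 s'" using sb(1) by (simp add: same_below_def)
  have low: "lower ?M s'" using sb(2) below by (auto simp: lower_def mem)
  have desc: "descending s'" using sb(3) below sv edge(1) by (auto simp: descending_def mem)
  have ag: "agree merge_loop s0 s'"
    using I unfolding s'_def
    by (auto simp: Inv_def agree_def nwrites_merge_loop rwrites_merge_loop)
  \<comment> \<open>Both pointers lead below \<open>?M\<close>, where nothing has changed since
    \<open>s0\<close>.\<close>
  have ind_new: "indices s' ?sv = indices s0 ?s1 \<union> indices s0 ?s2 \<union> (if f then {e} else {})"
  proof -
    have "indices s' ?sv = indices s' ?s1 \<union> indices s' ?s2 \<union> (if f then {e} else {})"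
      unfolding indices_def by (subst dag.simps) (use below sv in \<open>auto simp: mem\<close>)
    then show ?thesis using indices_below[OF sb0] below by simp
  qed
  \<comment> \<open>This includes nodes above \<open>?sv\<close>: by \<open>lower\<close> they do
    not refer to \<open>?sv\<close>.\<close>
  have ind_old: "indices s' z = indices s z" if "z \<noteq> ?sv" for z
  proof -
    have "nmem s' ''nl'' z = nmem s ''nl'' z" "nmem s' ''nr'' z = nmem s ''nr'' z"
      "nmem s' ''ne'' z = nmem s ''ne'' z" using that by (simp_all add: mem)
    moreover have "indices s' (nmem s ''nl'' z) = indices s (nmem s ''nl'' z)"
      "indices s' (nmem s ''nr'' z) = indices s (nmem s ''nr'' z)"
      using indices_below[OF sb'] sb(2) by (auto simp: lower_def)
    ultimately show ?thesis unfolding indices_def by (subst (1 2) dag.simps) simp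
  qed
  have inj: "slot n id u' k' = ?sv \<longleftrightarrow> u' = u \<and> k' = k" if "k' < n" for u' k'
    using slot_inj[OF _ that uk(2)] by blast
  have "merged (insert (u1, k1, u2, k2, f) Q) s'"
  proof (rule merging_update[OF sb(4) p c better])
    show "solution_at s' id u k = solution_at s0 lc u1 k1 \<union> solution_at s0 rc u2 k2 \<union>
        (if f then {join_edge t1 t2} else {})"
      unfolding solution_def ind_new using edge by (auto simp: image_Un)
    fix u' k' assume "(u', k') \<noteq> (u, k)"
    then have ne: "slot n id u' k' \<noteq> ?sv" if "k' < n" using inj[OF that] by auto
    show "present s' id u' k' = present s id u' k'" using ne by (auto simp: mem)
    assume "present s id u' k'"
    then show "boundA s' id u' k' = boundA s id u' k' \<and> boundB s' id u' k' = boundB s id u' k' \<and>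
        solution_at s' id u' k' = solution_at s id u' k'"
      using ne ind_old by (simp add: mem solution_def)
  qed (use uk in \<open>simp_all add: mem\<close>)
  moreover have "\<forall>z\<ge>slot n (Suc id) 0 0. nmem s' ''ptr'' z = 0"
    using I sv by (auto simp: Inv_def mem)
  ultimately have "Inv (insert (u1, k1, u2, k2, f) Q) s'"
    using ag sb0 low desc by (simp add: Inv_def)
  then show ?thesis
    unfolding store_def
    by - (rule runs_NSet_Seq[where ?T2.0 = 5],
      rule runs_RSet_Seq[where ?T2.0 = 4],
      rule runs_RSet_Seq[where ?T2.0 = 3],
      rule runs_NSet_Seq[where ?T2.0 = 2], rule runs_NSet_Seq[where ?T2.0 = 1],
      rule runs_NSet, simp, cases f; simp add: s'_def v static(6) slot1_def slot2_def)
qed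

lemma Inv_skip:
  assumes I: "Inv Q s"
    and skip: "\<And>u k x y. present s0 lc u1 k1 \<Longrightarrow> present s0 rc u2 k2 \<Longrightarrow>
      combined (l (join_edge t1 t2)) (u1, k1, u2, k2, f) (boundA s0 lc) (boundB s0 lc)
        (boundA s0 rc) (boundB s0 rc) = (True, u, k, x, y) \<Longrightarrow> present s id u k \<and> boundB s id u k \<le> y"
  shows "Inv (insert (u1, k1, u2, k2, f) Q) s"
proof -
  have "merged Q s" using I by (simp add: Inv_def)
  then have "merged (insert (u1, k1, u2, k2, f) Q) s"
    by (rule merging_skip) (use skip in blast)
  then show ?thesis using I by (simp add: Inv_def)
qed

text \<open>Nothing is stored in three cases: an operand is absent, the halves are incompatible, or
  the present entry is at least as good. The bound 22 is 2 for the addresses, 5 for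
  \<open>extend\<close>, 6 each for \<open>choose_slot\<close> and \<open>store\<close>, and 3
  tests.\<close>

lemma runs_merge_step:
  assumes I: "Inv Q s" and u: "u1 < n" "k1 < n" "u2 < n" "k2 < n"
    and vars: "nmem s ''u1'' 0 = u1" "nmem s ''k1'' 0 = k1" "nmem s ''u2'' 0 = u2" "nmem s ''k2'' 0 = k2"
  shows "runs (merge_step f) s 22 (Inv (insert (u1, k1, u2, k2, f) Q))"
proof -
  let ?s1 = "slot n lc u1 k1" let ?s2 = "slot n rc u2 k2" let ?q = "(u1, k1, u2, k2, f)"
  let ?w = "l (join_edge t1 t2)"
  let ?test = "BAnd (NLess (NConst 0) (NGet ''ptr'' slot1)) (NLess (NConst 0) (NGet ''ptr'' slot2))"
  let ?rest = "Cond better_exp (store f) Skip"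
  let ?mid = "Cond compatible_exp (Seq (choose_slot f) ?rest) Skip"
  let ?comb = "combined ?w ?q (boundA s0 lc) (boundB s0 lc) (boundA s0 rc) (boundB s0 rc)"
  let ?x = "extA f ?w (boundA s0 rc u2 k2)"
  let ?y = "extB f ?w (boundA s0 rc u2 k2) (boundB s0 rc u2 k2)"
  \<comment> \<open>Before \<open>store\<close> only temporaries are written, so \<open>Inv\<close>
    persists and reads from the tables refer back to \<open>s\<close>.\<close>
  define core where "core s' \<longleftrightarrow> agree temps s s'" for s'
  have core_Inv: "Inv Q s'" if "core s'" for s'
    using that Inv_temps[OF I] by (simp add: core_def)
  have core_nmem: "nmem s' b = nmem s b" if "core s'" "b \<notin> {''s1'', ''s2'', ''u'', ''s''}" for s' b
    using that by (simp add: core_def agree_def nwrites_temps)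
  have core_rmem: "rmem s' d = rmem s d" if "core s'" "d \<notin> {''x'', ''y'', ''a'', ''b''}" for s' d
    using that by (simp add: core_def agree_def rwrites_temps)
  note static = Inv_static[OF I]
  have mem: "nmem s ''ptr'' z = nmem s0 ''ptr'' z" "rmem s ''av'' z = rmem s0 ''av'' z"
    "rmem s ''bv'' z = rmem s0 ''bv'' z" if "z < slot n id 0 0" for z
    using I that by (auto simp: Inv_def same_below_def)
  note mem1 = mem[OF child_slots(1)[OF u(1,2)]] and mem2 = mem[OF child_slots(2)[OF u(3,4)]]
  have addr: "runs address s 2 (\<lambda>s'. nmem s' ''s1'' 0 = ?s1 \<and> nmem s' ''s2'' 0 = ?s2)"
  proof -
    have 1: "nval (slot_exp (nvar ''lc'') (nvar ''u1'') (nvar ''k1'')) s = ?s1"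
      using static ids u vars by (subst nval_slot_exp) auto
    have 2: "nval (slot_exp (nvar ''rc'') (nvar ''u2'') (nvar ''k2'')) (nset ''s1'' 0 ?s1 s) = ?s2"
      using static ids u vars by (subst nval_slot_exp) (auto simp: rows_nset)
    show ?thesis
      unfolding address_def
      by (rule runs_Seq[where ?T1.0 = 1 and ?T2.0 = 1], rule runs_NSet) (auto simp: 1 2 intro!: runs_NSet)
  qed
  show ?thesis
    unfolding merge_step_def
  proof (rule runs_Seq[where ?T2.0 = 20, OF runs_mono[OF addr order.refl]], rule impI)
    fix sA assume sA: "nmem sA ''s1'' 0 = ?s1 \<and> nmem sA ''s2'' 0 = ?s2" "agree address s sA"
    have coreA: "core sA"
      using sA(2) unfolding core_def agree_def nwrites_temps rwrites_temps nwrites_address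
        rwrites_address by simp
    have pA: "bval ?test sA \<longleftrightarrow> present s0 lc u1 k1 \<and> present s0 rc u2 k2"
      using sA(1) core_nmem[OF coreA, of "''ptr''"] mem1 mem2 u by (simp add: slot1_def slot2_def)
    show "runs (Cond ?test (Seq (extend f) ?mid) Skip) sA 20 (Inv (insert ?q Q))"
    proof (rule runs_Cond[where T = 19])
      assume "\<not> bval ?test sA"
      then show "runs Skip sA 19 (Inv (insert ?q Q))"
        using pA core_Inv[OF coreA] by (intro runs_Skip Inv_skip) auto
    next
      assume "bval ?test sA"
      then have p: "present s0 lc u1 k1" "present s0 rc u2 k2" using pA by auto
      have gA: "given sA" using Inv_static(1)[OF core_Inv[OF coreA]] by simp
      have avA: "rmem sA ''av'' ?s2 = boundA s0 rc u2 k2" "rmem sA ''bv'' ?s2 = boundB s0 rc u2 k2"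
        using core_rmem[OF coreA] mem2 by simp_all
      have "rmem sA ''len'' (nmem sA ''e'' 0) = ?w"
        using gA edge Inv_static(6)[OF core_Inv[OF coreA]] by (simp add: given_def)
      then have ext: "runs (extend f) sA 5 (\<lambda>s'. rmem s' ''x'' 0 = ?x \<and> rmem s' ''y'' 0 = ?y)"
        using runs_extend[OF gA, of f] sA(1) avA by simp
      show "runs (Seq (extend f) ?mid) sA 19 (Inv (insert ?q Q))"
      proof (rule runs_Seq[where ?T2.0 = 14, OF runs_mono[OF ext order.refl]], rule impI)
        fix sB assume sB: "rmem sB ''x'' 0 = ?x \<and> rmem sB ''y'' 0 = ?y" "agree (extend f) sA sB"
        have coreB: "core sB"
          using coreA sB(2) unfolding core_def
          by (rule agree_trans) (auto simp: nwrites_temps rwrites_temps nwrites_extend rwrites_extend)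
        have sB12: "nmem sB ''s1'' 0 = ?s1" "nmem sB ''s2'' 0 = ?s2"
          using sA(1) agree_nmem[OF sB(2)] by (simp_all add: nwrites_extend)
        have avB: "rmem sB ''av'' ?s1 = boundA s0 lc u1 k1" "rmem sB ''bv'' ?s1 = boundB s0 lc u1 k1"
          using core_rmem[OF coreB] mem1 by simp_all
        have IB: "Inv Q sB" using core_Inv[OF coreB] by simp
        have cB: "bval compatible_exp sB \<longleftrightarrow> compatible (boundA s0 lc u1 k1) (boundB s0 lc u1 k1) ?x ?y"
          using bval_compatible[OF Inv_static(1)[OF IB]] sB(1) sB12 avB by simp
        show "runs ?mid sB 14 (Inv (insert ?q Q))"
        proof (rule runs_Cond[where T = 13])
          assume "\<not> bval compatible_exp sB"
          then show "runs Skip sB 13 (Inv (insert ?q Q))"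
            using cB IB by (intro runs_Skip Inv_skip) (auto simp: combined_def Let_def)
        next
          assume "bval compatible_exp sB"
          then have comp: "compatible (boundA s0 lc u1 k1) (boundB s0 lc u1 k1) ?x ?y" using cB by simp
          define v where "v = (if boundA s0 lc u1 k1 < ?x then u2 else u1)"
          let ?k = "k1 + k2 + of_bool f"
          let ?a = "max (boundA s0 lc u1 k1) ?x" let ?b = "max (boundB s0 lc u1 k1) ?y"
          have comb: "?comb = (True, v, ?k, ?a, ?b)"
            using comp by (simp add: combined_def Let_def v_def)
          have varsB: "nmem sB ''u1'' 0 = u1" "nmem sB ''k1'' 0 = k1" "nmem sB ''u2'' 0 = u2"
            "nmem sB ''k2'' 0 = k2"
            using vars core_nmem[OF coreB] by simp_all
          have "runs (choose_slot f) sB 6 (\<lambda>s'. rmem s' ''a'' 0 = ?a \<and> rmem s' ''b'' 0 = ?b \<and>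
              nmem s' ''s'' 0 = slot n id v ?k)"
            using runs_choose_slot[of sB f] Inv_static[OF IB] ids u varsB sB12 sB(1) avB
            by (simp add: v_def cong: if_cong)
          then show "runs (Seq (choose_slot f) ?rest) sB 13 (Inv (insert ?q Q))"
          proof (rule runs_Seq[where ?T2.0 = 7, OF runs_mono[OF _ order.refl]], intro impI)
            fix sC
            assume sC: "rmem sC ''a'' 0 = ?a \<and> rmem sC ''b'' 0 = ?b \<and> nmem sC ''s'' 0 = slot n id v ?k"
              "agree (choose_slot f) sB sC"
            have coreC: "core sC"
              using coreB sC(2) unfolding core_def
              by (rule agree_trans)
                (auto simp: nwrites_temps rwrites_temps nwrites_choose_slot rwrites_choose_slot)
            have IC: "Inv Q sC" using core_Inv[OF coreC] by simp
            have sC12: "nmem sC ''s1'' 0 = ?s1" "nmem sC ''s2'' 0 = ?s2"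
              using sB12 agree_nmem[OF sC(2)] by (simp_all add: nwrites_choose_slot)
            show "runs ?rest sC 7 (Inv (insert ?q Q))"
            proof (rule runs_Cond[where T = 6])
              assume "bval better_exp sC"
              then show "runs (store f) sC 6 (Inv (insert ?q Q))"
                using sC(1) by (intro runs_store[OF IC u p comb sC12]) (auto simp: better_exp_def)
            next
              assume "\<not> bval better_exp sC"
              then show "runs Skip sC 6 (Inv (insert ?q Q))"
                using sC(1) comb combined_less[OF u(1,3) p comb]
                by (intro runs_Skip Inv_skip[OF IC]) (auto simp: better_exp_def)
            qed simp
          qed simp_all
        qed simp
      qed simp_all
    qed simp
  qed simp_all
qed

lemma runs_merge_loop:
  "runs merge_loop s0 (60 * n ^ 4) (\<lambda>s. table_at s id (Join t1 t2) \<and> same_below (slot n id 0 0) s0 s \<and>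
     lower (slot n (Suc id) 0 0) s \<and> descending s \<and> (\<forall>x\<ge>slot n (Suc id) 0 0. nmem s ''ptr'' x = 0))"
proof -
  let ?step = "Seq (merge_step False) (merge_step True)"
  let ?L4 = "For ''k2'' (nvar ''n'') ?step" let ?L3 = "For ''u2'' (nvar ''n'') ?L4"
  let ?L2 = "For ''k1'' (nvar ''n'') ?L3"
  let ?R4 = "\<lambda>u1 k1 u2 k2. {(u1, k1, u2, k2, False), (u1, k1, u2, k2, True)}"
  let ?R3 = "\<lambda>u1 k1 u2. \<Union>k2<n. ?R4 u1 k1 u2 k2"
  let ?R2 = "\<lambda>u1 k1. \<Union>u2<n. ?R3 u1 k1 u2" let ?R1 = "\<lambda>u1. \<Union>k1<n. ?R2 u1 k1"
  note simps = nwrites_address nwrites_extend nwrites_choose_slot merge_step_def store_def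
  have Inv_n: "nmem s ''n'' 0 = n" if "Inv Q s" for Q s
    using Inv_static(1)[OF that] by (simp add: given_def)
  \<comment> \<open>Both choices for the joining edge, 22 steps each.\<close>
  have L5: "runs ?step s (44 * n ^ 0) (Inv (Q \<union> ?R4 u1 k1 u2 k2))"
    if I: "Inv Q s" and u: "u1 < n" "k1 < n" "u2 < n" "k2 < n"
      and vars: "nmem s ''u1'' 0 = u1" "nmem s ''k1'' 0 = k1" "nmem s ''u2'' 0 = u2" "nmem s ''k2'' 0 = k2"
    for Q s u1 k1 u2 k2
  proof (rule runs_Seq[where ?T2.0 = 22, OF runs_mono[OF runs_merge_step[OF I u vars] order.refl]],
      rule impI)
    fix s' assume s': "Inv (insert (u1, k1, u2, k2, False) Q) s'" "agree (merge_step False) s s'"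
    have "nmem s' ''u1'' 0 = u1" "nmem s' ''k1'' 0 = k1" "nmem s' ''u2'' 0 = u2" "nmem s' ''k2'' 0 = k2"
      using vars by (simp_all add: agree_nmem[OF s'(2)] simps)
    from runs_merge_step[OF s'(1) u this, of True]
    show "runs (merge_step True) s' 22 (Inv (Q \<union> ?R4 u1 k1 u2 k2))"
      by (simp add: insert_commute)
  qed simp_all
  have L4: "runs ?L4 s (48 * n ^ 1) (Inv (Q \<union> ?R3 u1 k1 u2))"
    if I: "Inv Q s" and u: "u1 < n" "k1 < n" "u2 < n"
      and vars: "nmem s ''u1'' 0 = u1" "nmem s ''k1'' 0 = k1" "nmem s ''u2'' 0 = u2"
    for Q s u1 k1 u2
  proof -
    have "runs ?L4 s ((44 + 4) * n ^ Suc 0) (Inv (Q \<union> (\<Union>k2<n. ?R4 u1 k1 u2 k2)))"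
    proof (rule runs_For_collect[where Inv = Inv, OF _ _ _ Inv_n[OF I] n_pos _ I])
      fix Q k s' assume *: "k < n" "Inv Q s'" "nmem s' ''k2'' 0 = k" "agree ?L4 s s'"
      have "nmem s' ''u1'' 0 = u1" "nmem s' ''k1'' 0 = k1" "nmem s' ''u2'' 0 = u2"
        using vars by (simp_all add: agree_nmem[OF *(4)] simps)
      then show "runs ?step s' (44 * n ^ 0) (Inv (Q \<union> ?R4 u1 k1 u2 k))"
        using L5 * u by blast
    qed (simp_all add: simps Inv_nset)
    then show ?thesis by simp
  qed
  have L3: "runs ?L3 s (52 * n ^ 2) (Inv (Q \<union> ?R2 u1 k1))"
    if I: "Inv Q s" and u: "u1 < n" "k1 < n"
      and vars: "nmem s ''u1'' 0 = u1" "nmem s ''k1'' 0 = k1"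
    for Q s u1 k1
  proof -
    have "runs ?L3 s ((48 + 4) * n ^ Suc 1) (Inv (Q \<union> (\<Union>u2<n. ?R3 u1 k1 u2)))"
    proof (rule runs_For_collect[where Inv = Inv, OF _ _ _ Inv_n[OF I] n_pos _ I])
      fix Q k s' assume *: "k < n" "Inv Q s'" "nmem s' ''u2'' 0 = k" "agree ?L3 s s'"
      have "nmem s' ''u1'' 0 = u1" "nmem s' ''k1'' 0 = k1"
        using vars by (simp_all add: agree_nmem[OF *(4)] simps)
      then show "runs ?L4 s' (48 * n ^ 1) (Inv (Q \<union> ?R3 u1 k1 k))"
        using L4 * u by blast
    qed (simp_all add: simps Inv_nset)
    then show ?thesis by (simp add: power2_eq_square)
  qed
  have L2: "runs ?L2 s (56 * n ^ 3) (Inv (Q \<union> ?R1 u1))"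
    if I: "Inv Q s" and u: "u1 < n" and vars: "nmem s ''u1'' 0 = u1" for Q s u1
  proof -
    have "runs ?L2 s ((52 + 4) * n ^ Suc 2) (Inv (Q \<union> (\<Union>k1<n. ?R2 u1 k1)))"
    proof (rule runs_For_collect[where Inv = Inv, OF _ _ _ Inv_n[OF I] n_pos _ I])
      fix Q k s' assume *: "k < n" "Inv Q s'" "nmem s' ''k1'' 0 = k" "agree ?L2 s s'"
      have "nmem s' ''u1'' 0 = u1"
        using vars by (simp_all add: agree_nmem[OF *(4)] simps)
      then show "runs ?L3 s' (52 * n ^ 2) (Inv (Q \<union> ?R2 u1 k))"
        using L3 * u by blast
    qed (simp_all add: simps Inv_nset)
    then show ?thesis by (simp add: eval_nat_numeral)
  qed
  \<comment> \<open>The block of the new table is still empty, which is right for the empty set of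
    combinations.\<close>
  have init: "Inv {} s0"
  proof -
    have "present s0 id u k \<Longrightarrow> False" for u k
      using fresh slot_ge[of n id u k] by auto
    then have "merged {} s0" unfolding merging_def by blast
    moreover have "slot n id 0 0 \<le> slot n (Suc id) 0 0" by (rule slot_mono) simp
    ultimately show ?thesis
      using fresh lower0 desc0 by (auto simp: Inv_def agree_refl same_below_def)
  qed
  have L1: "runs merge_loop s0 ((56 + 4) * n ^ Suc 3) (Inv ({} \<union> (\<Union>u1<n. ?R1 u1)))"
    unfolding merge_loop_def
  proof (rule runs_For_collect[where Inv = Inv, OF _ _ _ Inv_n[OF init] n_pos _ init])
    fix Q k s' assume "k < n" "Inv Q s'" "nmem s' ''u1'' 0 = k"
    then show "runs ?L2 s' (56 * n ^ 3) (Inv (Q \<union> ?R1 k))" using L2 by blast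
  qed (simp_all add: simps Inv_nset)
  show ?thesis
  proof (rule runs_mono[OF L1], goal_cases)
    case (2 s)
    then have I: "Inv (\<Union>u1<n. ?R1 u1) s" by simp
    have "pos_lengths (Join t1 t2)" using wf(3) pos by blast
    moreover have "merged (\<Union>u1<n. ?R1 u1) s" using I by (simp add: Inv_def)
    ultimately have "table_at s id (Join t1 t2)"
      unfolding table_at_def
      \<comment> \<open>The loops have covered all index combinations in range, and
        \<open>present\<close> confines the entries to these ranges.\<close>
      by (rule table_Join[OF wf(1) _ tables[unfolded table_at_def]]) auto
    moreover have "lower (slot n (Suc id) 0 0) s"
      using I slot_mono[of id "Suc id" n] by (auto simp: Inv_def lower_def intro: order_less_le_trans)
    ultimately show ?case using I by (simp add: Inv_def)
  qed (simp add: eval_nat_numeral)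
qed

end

section \<open>The complete program\<close>

text \<open>Round \<open>j\<close> undoes growth step \<open>n - 2 - j\<close>, the last one still
  standing. \<open>cur\<close> gives the id of the table that belongs to the tree of a root.\<close>

definition prepare_merge :: com where
  "prepare_merge = Seq (nlet ''r'' (NMinus (NMinus (nvar ''n'') (NConst 2)) (nvar ''j'')))
     (Seq (nlet ''p'' (NGet ''op'' (nvar ''r'')))
     (Seq (nlet ''e'' (NGet ''oe'' (nvar ''r'')))
     (Seq (nlet ''lc'' (NGet ''cur'' (nvar ''p'')))
     (Seq (nlet ''rc'' (NGet ''cur'' (NGet ''oc'' (nvar ''r''))))
       (nlet ''id'' (NPlus (nvar ''n'') (nvar ''j'')))))))"

definition merge_all :: com where
  "merge_all = For ''j'' (NMinus (nvar ''n'') (NConst 1))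
     (Seq prepare_merge (Seq merge_loop (NSet ''cur'' (nvar ''p'') (nvar ''id''))))"

definition candidate :: nexp where
  "candidate = slot_exp (NGet ''cur'' (NConst 0)) (nvar ''u'') (nvar ''k'')"

text \<open>Every hit overwrites \<open>sel\<close>, and \<open>k\<close> increases in the outer
  loop, so the last hit has the largest count. The count \<open>n - 1\<close> is left out: it
  belongs to the full edge set, which leaves the graph connected.\<close>

definition select :: com where
  "select = For ''k'' (NMinus (nvar ''n'') (NConst 1)) (For ''u'' (nvar ''n'')
     (Cond (NLess (NConst 0) (NGet ''ptr'' candidate)) (nlet ''sel'' candidate) Skip))"

definition visit :: com where
  "visit = Cond (NLess (NConst 0) (NGet ''mark'' (nvar ''q'')))
     (Seq (NSet ''mark'' (NGet ''nl'' (nvar ''q'')) (NConst 1))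
     (Seq (NSet ''mark'' (NGet ''nr'' (nvar ''q'')) (NConst 1))
       (Cond (NLess (NConst 0) (NGet ''ne'' (nvar ''q'')))
         (NSet ''out'' (NMinus (NGet ''ne'' (nvar ''q'')) (NConst 1)) (NConst 1)) Skip)))
     Skip"

text \<open>Marks spread along back pointers in one sweep from the highest address down. As pointers
  descend, the mark of a node is final when the sweep reaches it. The two lookups in
  \<open>row\<close> yield the number of cells, \<open>2 * n * n * n\<close>.\<close>

definition read_off :: com where
  "read_off = Seq (nlet ''m'' (NGet ''row'' (NGet ''row'' (NPlus (nvar ''n'') (nvar ''n'')))))
     (Seq (NSet ''mark'' (nvar ''sel'') (NConst 1))
       (For ''j'' (nvar ''m'')
         (Seq (nlet ''q'' (NMinus (NMinus (nvar ''m'') (NConst 1)) (nvar ''j''))) visit)))"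

definition contraction_program :: com where
  "contraction_program = Seq init_rows (Seq sum_lengths (Seq grow (Seq init_leaves
     (Seq merge_all (Seq select read_off)))))"

context contraction_instance
begin

lemma slot_block_unique:
  assumes "slot n i u k = slot n j u' k'" "u < n" "k < n" "u' < n" "k' < n"
  shows "i = j"
  using slot_less[of i j u n k] slot_less[of j i u' n k'] slot_ge[of n i u k] slot_ge[of n j u' k']
    assms by (cases i j rule: linorder_cases) auto

lemma same_below_core:
  assumes "nmem s' ''ptr'' = nmem s ''ptr''" "nmem s' ''nl'' = nmem s ''nl''"
      "nmem s' ''nr'' = nmem s ''nr''" "nmem s' ''ne'' = nmem s ''ne''"
      "rmem s' ''av'' = rmem s ''av''" "rmem s' ''bv'' = rmem s ''bv''"
  shows "same_below M s s'"
  using assms by (simp add: same_below_def)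

lemma runs_init_leaves:
  assumes g: "given s" and r: "rows n s" and ls: "rmem s ''lsum'' 0 = sum l E"
    and z: "\<And>x. nmem s ''ptr'' x = 0"
  shows "runs init_leaves s (7 * n) (\<lambda>s'. (\<forall>i<n. nmem s' ''cur'' i = i) \<and>
    (\<forall>x. 0 < nmem s' ''ptr'' x \<longleftrightarrow> (\<exists>i<n. x = slot n i i 0)) \<and>
    (\<forall>i<n. rmem s' ''bv'' (slot n i i 0) = - sum l E))"
  unfolding init_leaves_def
proof (rule runs_For[where T = 3 and N = n and
      I = "\<lambda>k s'. (\<forall>i<k. nmem s' ''cur'' i = i) \<and>
        (\<forall>x. 0 < nmem s' ''ptr'' x \<longleftrightarrow> (\<exists>i<k. x = slot n i i 0)) \<and>
        (\<forall>i<k. rmem s' ''bv'' (slot n i i 0) = - sum l E)"])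
  let ?addr = "slot_exp (nvar ''i'') (nvar ''i'') (NConst 0)"
  let ?body = "Seq (NSet ''cur'' (nvar ''i'') (nvar ''i'')) (Seq (NSet ''ptr'' ?addr (NConst 1))
       (RSet ''bv'' ?addr (RMinus (RConst 0) (rvar ''lsum''))))"
  fix k s'
  assume *: "k < n" "(\<forall>i<k. nmem s' ''cur'' i = i) \<and>
        (\<forall>x. 0 < nmem s' ''ptr'' x \<longleftrightarrow> (\<exists>i<k. x = slot n i i 0)) \<and>
        (\<forall>i<k. rmem s' ''bv'' (slot n i i 0) = - sum l E)" "nmem s' ''i'' 0 = k"
    "agree (For ''i'' (nvar ''n'') ?body) s s'"
  have rows: "rows n s'" by (rule rows_agree[OF r *(4)]) simp
  have ls': "rmem s' ''lsum'' 0 = sum l E" using agree_rmem[OF *(4), of "''lsum''"] ls by simp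
  let ?sA = "nset ''cur'' k k s'" let ?sB = "nset ''ptr'' (slot n k k 0) 1 ?sA"
  have a: "nval ?addr ?sA = slot n k k 0" "nval ?addr ?sB = slot n k k 0"
    by (subst nval_slot_exp; use rows *(1,3) in \<open>simp add: rows_nset\<close>)+
  show "runs ?body s' 3 (\<lambda>s''. agree ?body s' s'' \<longrightarrow>
      (\<forall>i<Suc k. nmem (nset ''i'' 0 (Suc k) s'') ''cur'' i = i) \<and>
        (\<forall>x. 0 < nmem (nset ''i'' 0 (Suc k) s'') ''ptr'' x \<longleftrightarrow> (\<exists>i<Suc k. x = slot n i i 0)) \<and>
        (\<forall>i<Suc k. rmem (nset ''i'' 0 (Suc k) s'') ''bv'' (slot n i i 0) = - sum l E))"
    by (rule runs_NSet_Seq[where ?T2.0 = 2], rule runs_NSet_Seq[where ?T2.0 = 1],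
        rule runs_RSet, simp)
      (use a *(2,3) ls' in \<open>auto simp: less_Suc_eq\<close>)
qed (use assms n_pos in \<open>auto simp: given_def agree_def\<close>)

lemma table_at_leaf:
  assumes "v < n" "\<forall>x. 0 < nmem s ''ptr'' x \<longleftrightarrow> (\<exists>i<n. x = slot n i i 0)"
    "rmem s ''bv'' (slot n v v 0) = - sum l E" "\<And>x. rmem s ''av'' x = 0"
    "\<And>x. nmem s ''nl'' x = 0" "\<And>x. nmem s ''nr'' x = 0" "\<And>x. nmem s ''ne'' x = 0"
  shows "table_at s v (Leaf v)"
  unfolding table_at_def
proof (rule table_mono[OF table_Leaf])
  have "indices s x = {}" for x
    unfolding indices_def by (induction x rule: less_induct) (subst dag.simps, simp add: assms)
  then show "boundA s v u k = 0 \<and> boundB s v u k = - sum l E \<and> solution_at s v u k = {}"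
    if "u = v \<and> k = 0" for u k
    using that assms by (simp add: solution_def)
  have "u = v \<and> k = 0" if "u < n" "k < n" "slot n v u k = slot n i i 0" "i < n" for u k i
    using slot_block_unique[OF that(3)] slot_inj[of n v u k i 0] that n_pos by auto
  then show "u = v \<and> k = 0 \<longleftrightarrow> present s v u k" for u k
    using assms(1,2) n_pos by auto
qed

text \<open>A vertex that is no longer a root keeps an outdated id in \<open>cur\<close>, so only
  the bound on ids is claimed for it.\<close>

definition merged_upto :: "state \<Rightarrow> nat \<Rightarrow> state \<Rightarrow> bool" where
  "merged_upto s0 k s \<longleftrightarrow> (\<forall>v<n. nmem s ''cur'' v < n + k) \<and>
     (\<forall>v\<in>visited (nmem s0 ''oc'') (n - 1 - k).
        table_at s (nmem s ''cur'' v) (forest (nmem s0 ''op'') (nmem s0 ''oc'') (n - 1) k v)) \<and>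
     lower (slot n (n + k) 0 0) s \<and> descending s \<and> (\<forall>x\<ge>slot n (n + k) 0 0. nmem s ''ptr'' x = 0)"

lemma merged_upto_nset:
  assumes "merged_upto s0 k s" "x \<notin> {''cur'', ''ptr'', ''nl'', ''nr'', ''ne''}"
  shows "merged_upto s0 k (nset x i y s)"
proof -
  have core: "nmem (nset x i y s) a = nmem s a" if "a \<in> {''cur'', ''ptr'', ''nl'', ''nr'', ''ne''}" for a
    using assms(2) that by auto
  have tab: "table_at s j t \<Longrightarrow> table_at (nset x i y s) j t" for j t
    by (erule table_at_below[where j = "Suc j"], rule same_below_core)
      (simp_all add: core del: nmem_nset)
  show ?thesis
    using assms(1) tab unfolding merged_upto_def lower_def descending_def
    by (simp add: core del: nmem_nset)
qed

lemma runs_prepare_merge: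
  assumes "given s" "nmem s ''j'' 0 = k" "k < n - 1"
  defines "r \<equiv> n - 1 - Suc k"
  shows "runs prepare_merge s 6 (\<lambda>s'. nmem s' ''p'' 0 = nmem s ''op'' r \<and>
    nmem s' ''e'' 0 = nmem s ''oe'' r \<and> nmem s' ''lc'' 0 = nmem s ''cur'' (nmem s ''op'' r) \<and>
    nmem s' ''rc'' 0 = nmem s ''cur'' (nmem s ''oc'' r) \<and> nmem s' ''id'' 0 = n + k)"
proof -
  have "n - 2 - k = r" "nmem s ''n'' 0 = n" using assms(1) by (simp_all add: r_def given_def)
  then show ?thesis
    unfolding prepare_merge_def
    by - (rule runs_NSet_Seq[where ?T2.0 = 5], rule runs_NSet_Seq[where ?T2.0 = 4], rule runs_NSet_Seq[where ?T2.0 = 3], rule runs_NSet_Seq[where ?T2.0 = 2], rule runs_NSet_Seq[where ?T2.0 = 1], rule runs_NSet, simp_all add: assms(2))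
qed

lemma nwrites_prepare_merge: "nwrites prepare_merge = {''r'', ''p'', ''e'', ''lc'', ''rc'', ''id''}"
  and rwrites_prepare_merge: "rwrites prepare_merge = {}"
  by (auto simp: prepare_merge_def)

lemma merge_round:
  assumes g: "given s" and rows: "rows n s" and o: "order s0 (n - 1)" and k: "k < n - 1"
    and M: "merged_upto s0 k s" and j: "nmem s ''j'' 0 = k"
    and eq: "nmem s ''op'' = nmem s0 ''op''" "nmem s ''oc'' = nmem s0 ''oc''"
      "nmem s ''oe'' = nmem s0 ''oe''"
  shows "runs (Seq prepare_merge (Seq merge_loop (NSet ''cur'' (nvar ''p'') (nvar ''id'')))) s
    (67 * n ^ 4) (merged_upto s0 (Suc k))"
proof -
  let ?op = "nmem s0 ''op''" let ?oc = "nmem s0 ''oc''" let ?oe = "nmem s0 ''oe''"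
  let ?F = "forest ?op ?oc (n - 1)"
  define r where "r = n - 1 - Suc k"
  let ?p = "?op r" let ?c = "?oc r"
  have rn: "r < n - 1" "n - 1 - k = Suc r" using k by (auto simp: r_def)
  note grown = order_grown[OF o]
  have rec: "recorded s0 r" using o rn by (simp add: order_def)
  have pc: "?p \<in> visited ?oc r" "?c \<notin> visited ?oc r" "?c < n"
    using rec by (auto simp: recorded_def)
  have V: "visited ?oc (n - 1) = {..<n}" using visited_all[OF _ grown] n_pos by simp
  have pn: "?p < n" using pc(1) visited_mono[of r "n - 1" ?oc] rn V by auto
  have vis: "visited ?oc (n - 1 - k) = insert ?c (visited ?oc r)"
    unfolding rn(2) visited_Suc by (rule refl)
  have in_vis: "?p \<in> visited ?oc (n - 1 - k)" "?c \<in> visited ?oc (n - 1 - k)" using pc vis by auto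
  have kn: "k \<le> n - 1" using k by simp
  note F = forest_root[OF grown kn] forest_wf[OF grown kn] forest_verts[OF grown kn]
    forest_edges[OF grown kn] forest_disjoint[OF grown kn]
  let ?t1 = "?F k ?p" let ?t2 = "?F k ?c"
  let ?lc = "nmem s ''cur'' ?p" let ?rc = "nmem s ''cur'' ?c"
  note prep = runs_prepare_merge[OF g j k, folded r_def, unfolded eq]
  have M': "\<forall>v<n. nmem s ''cur'' v < n + k"
    "\<And>v. v \<in> visited ?oc (n - 1 - k) \<Longrightarrow> table_at s (nmem s ''cur'' v) (?F k v)"
    "lower (slot n (n + k) 0 0) s" "descending s" "\<forall>x\<ge>slot n (n + k) 0 0. nmem s ''ptr'' x = 0"
    using M by (auto simp: merged_upto_def)
  have "runs (Seq prepare_merge (Seq merge_loop (NSet ''cur'' (nvar ''p'') (nvar ''id'')))) s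
    (6 + (60 * n ^ 4 + 1)) (merged_upto s0 (Suc k))"
  proof (rule runs_Seq[where ?T2.0 = "60 * n ^ 4 + 1", OF runs_mono[OF prep order.refl]], rule impI)
    fix sP assume sP: "nmem sP ''p'' 0 = ?p \<and> nmem sP ''e'' 0 = ?oe r \<and> nmem sP ''lc'' 0 = ?lc \<and>
      nmem sP ''rc'' 0 = ?rc \<and> nmem sP ''id'' 0 = n + k" "agree prepare_merge s sP"
    have sb: "same_below M s sP" for M
      by (rule same_below_core)
        (simp_all add: agree_nmem[OF sP(2)] agree_rmem[OF sP(2)] nwrites_prepare_merge rwrites_prepare_merge)
    have inst: "merge_instance n E l \<alpha> \<beta> es sP ?t1 ?t2 ?lc ?rc (n + k) (?oe r)"
    proof
      show "given sP"
        by (rule given_agree[OF g sP(2)]) (simp_all add: nwrites_prepare_merge rwrites_prepare_merge)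
      show "rows n sP" by (rule rows_agree[OF rows sP(2)]) (simp add: nwrites_prepare_merge)
      show "?lc < n + k" "?rc < n + k" using M'(1) pn pc(3) by auto
      show "n + k < 2 * n" using k by simp
      show "?oe r < length es" using rec by (simp add: recorded_def)
      show "edge_of (es ! ?oe r) = join_edge ?t1 ?t2"
        using rec F(1) in_vis by (simp add: recorded_def)
      show "table_at sP ?lc ?t1"
        by (rule table_at_below[OF M'(2)[OF in_vis(1)] sb, of "n + k"]) (use M'(1) pn in auto)
      show "table_at sP ?rc ?t2"
        by (rule table_at_below[OF M'(2)[OF in_vis(2)] sb, of "n + k"]) (use M'(1) pc in auto)
      have "verts ?t1 \<inter> verts ?t2 = {}" by (rule F(5)[OF in_vis]) (use pc in auto)
      then show "wf_btree (Join ?t1 ?t2)" using F(2)[OF in_vis(1)] F(2)[OF in_vis(2)] by simp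
      show "verts (Join ?t1 ?t2) \<subseteq> {..<n}" using F(3) in_vis V by auto
      have "{?p, ?c} \<in> E" using grown rn by (auto simp: grown_def)
      then show "edges (Join ?t1 ?t2) \<subseteq> E" using F(1,4) in_vis by auto
      show "\<forall>x\<ge>slot n (n + k) 0 0. nmem sP ''ptr'' x = 0"
        using M'(5) by (simp add: agree_nmem[OF sP(2)] nwrites_prepare_merge)
      show "lower (slot n (n + k) 0 0) sP"
        using M'(3) by (simp add: lower_def agree_nmem[OF sP(2)] nwrites_prepare_merge)
      show "descending sP"
        using M'(4) by (simp add: descending_def agree_nmem[OF sP(2)] nwrites_prepare_merge)
    qed (use sP(1) in simp_all)
    note loop = merge_instance.runs_merge_loop[OF inst]
    show "runs (Seq merge_loop (NSet ''cur'' (nvar ''p'') (nvar ''id''))) sP (60 * n ^ 4 + 1)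
        (merged_upto s0 (Suc k))"
    proof (rule runs_Seq[where ?T2.0 = 1, OF runs_mono[OF loop order.refl]], rule impI)
      fix sL assume sL: "table_at sL (n + k) (Join ?t1 ?t2) \<and> same_below (slot n (n + k) 0 0) sP sL \<and>
          lower (slot n (Suc (n + k)) 0 0) sL \<and> descending sL \<and>
          (\<forall>x\<ge>slot n (Suc (n + k)) 0 0. nmem sL ''ptr'' x = 0)" "agree merge_loop sP sL"
      let ?s' = "nset ''cur'' ?p (n + k) sL"
      have vars: "nmem sL ''p'' 0 = ?p" "nmem sL ''id'' 0 = n + k"
        using sP(1) by (simp_all add: agree_nmem[OF sL(2)] nwrites_merge_loop)
      have cur: "nmem sL ''cur'' = nmem s ''cur''"
        using agree_nmem[OF sL(2), of "''cur''"] agree_nmem[OF sP(2), of "''cur''"]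
        by (simp add: nwrites_merge_loop nwrites_prepare_merge)
      have sb1: "same_below M sL ?s'" for M by (rule same_below_core) simp_all
      have sb2: "same_below (slot n (n + k) 0 0) s ?s'"
        using sb[of "slot n (n + k) 0 0"] sL(1) sb1[of "slot n (n + k) 0 0"]
        by (simp add: same_below_def)
      have "table_at ?s' (nmem ?s' ''cur'' v) (?F (Suc k) v)" if v: "v \<in> visited ?oc r" for v
      proof (cases "v = ?p")
        case True
        have "table_at ?s' (n + k) (Join ?t1 ?t2)"
          by (rule table_at_below[OF _ sb1, of _ _ "Suc (n + k)"]) (use sL(1) in auto)
        then show ?thesis using True unfolding forest_Suc r_def[symmetric] by simp
      next
        case False
        have vn: "v < n" using v visited_mono[of r "n - 1" ?oc] rn V by auto
        \<comment> \<open>The tables of the other roots have ids below \<open>n + k\<close>, so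
          their blocks lie below the one just filled.\<close>
        have "table_at ?s' (nmem s ''cur'' v) (?F k v)"
          by (rule table_at_below[OF M'(2) sb2]) (use v vis M'(1) vn in auto)
        then show ?thesis using False cur unfolding forest_Suc r_def[symmetric] by simp
      qed
      then have "merged_upto s0 (Suc k) ?s'"
        using sL(1) M'(1) cur unfolding merged_upto_def r_def[symmetric]
        by (auto simp: lower_def descending_def less_Suc_eq)
      then show "runs (NSet ''cur'' (nvar ''p'') (nvar ''id'')) sL 1 (merged_upto s0 (Suc k))"
        using vars by (intro runs_NSet) simp_all
    qed simp_all
  qed simp_all
  moreover have "6 + (60 * n ^ 4 + 1) \<le> 67 * n ^ 4" using n_pos by (simp add: Suc_le_eq)
  ultimately show ?thesis by (rule runs_mono)
qed

lemma runs_merge_all: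
  assumes g: "given s" and rows: "rows n s" and o: "order s (n - 1)" and M: "merged_upto s 0 s"
  shows "runs merge_all s (71 * n ^ 5) (merged_upto s (n - 1))"
  unfolding merge_all_def
proof (rule runs_For[where T = "67 * n ^ 4" and N = "n - 1" and I = "merged_upto s"])
  let ?c = "Seq prepare_merge (Seq merge_loop (NSet ''cur'' (nvar ''p'') (nvar ''id'')))"
  let ?b = "NMinus (nvar ''n'') (NConst 1)"
  note simps = nwrites_prepare_merge rwrites_prepare_merge nwrites_merge_loop rwrites_merge_loop
  fix k s' assume *: "k < n - 1" "merged_upto s k s'" "nmem s' ''j'' 0 = k" "agree (For ''j'' ?b ?c) s s'"
  have "given s'" by (rule given_agree[OF g *(4)]) (simp_all add: simps)
  moreover have "rows n s'" by (rule rows_agree[OF rows *(4)]) (simp add: simps)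
  ultimately have "runs ?c s' (67 * n ^ 4) (merged_upto s (Suc k))"
    using o * by (intro merge_round) (simp_all add: agree_nmem[OF *(4)] simps)
  then show "runs ?c s' (67 * n ^ 4) (\<lambda>s''. agree ?c s' s'' \<longrightarrow>
      merged_upto s (Suc k) (nset ''j'' 0 (Suc k) s''))"
    by (rule runs_mono) (simp_all add: merged_upto_nset)
next
  fix s' assume "agree (For ''j'' (NMinus (nvar ''n'') (NConst 1))
      (Seq prepare_merge (Seq merge_loop (NSet ''cur'' (nvar ''p'') (nvar ''id''))))) s s'"
  from agree_nmem[OF this, of "''n''"]
  show "nval (NMinus (nvar ''n'') (NConst 1)) s' = n - 1"
    using g by (simp add: given_def nwrites_prepare_merge nwrites_merge_loop)
next
  show "(n - 1) * (67 * n ^ 4 + 2) + 2 \<le> 71 * n ^ 5"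
    using loop_time[of n "n - 1" 67 4] n_pos by simp
qed (simp_all add: nwrites_prepare_merge nwrites_merge_loop merged_upto_nset M)

section \<open>Selecting and reading off an entry\<close>

definition candidates :: "state \<Rightarrow> nat \<Rightarrow> (nat \<times> nat) set \<Rightarrow> (nat \<times> nat) set" where
  "candidates s i R = {(u, k). (u, k) \<in> R \<and> present s i u k}"

text \<open>The largest count is what is wanted, since on a tree the value of a contraction is its
  number of edges. Without candidates \<open>sel\<close> stays 0, which is still a legal
  address.\<close>

definition best :: "(nat \<times> nat) set \<Rightarrow> nat \<Rightarrow> state \<Rightarrow> bool" where
  "best C i s \<longleftrightarrow> (C = {} \<longrightarrow> nmem s ''sel'' 0 = 0) \<and>
     (C \<noteq> {} \<longrightarrow> (\<exists>(u, k)\<in>C. nmem s ''sel'' 0 = slot n i u k \<and> (\<forall>(u', k')\<in>C. k' \<le> k)))"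

lemma candidates_insert:
  "candidates s i (insert (u, k) R) =
     (if present s i u k then insert (u, k) (candidates s i R) else candidates s i R)"
  by (auto simp: candidates_def)

lemma runs_select:
  assumes g: "given s" and rows: "rows n s" and cur: "nmem s ''cur'' 0 = i" "i < 2 * n"
    and sel: "nmem s ''sel'' 0 = 0"
  shows "runs select s (10 * n ^ 2) (best (candidates s i ({..<n} \<times> {..<n - 1})) i)"
proof -
  let ?c = "Cond (NLess (NConst 0) (NGet ''ptr'' candidate)) (nlet ''sel'' candidate) Skip"
  let ?b = "NMinus (nvar ''n'') (NConst 1)"
  let ?B = "\<lambda>R. best (candidates s i R) i"
  let ?L = "For ''u'' (nvar ''n'') ?c"
  show ?thesis
    unfolding select_def
  proof (rule runs_For[where T = "6 * n ^ 1" and N = "n - 1" and I = "\<lambda>k. ?B ({..<n} \<times> {..<k})"])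
    fix k s' assume *: "k < n - 1" "?B ({..<n} \<times> {..<k}) s'" "nmem s' ''k'' 0 = k"
      "agree (For ''k'' ?b ?L) s s'"
    \<comment> \<open>The pairs scanned so far: all smaller counts, and for count \<open>k\<close>
      the vertices below \<open>u\<close>. A new hit therefore has maximal count.\<close>
    let ?R = "\<lambda>u. {..<n} \<times> {..<k} \<union> {..<u} \<times> {k}"
    have "runs ?L s' (6 * n ^ 1) (?B (?R n))"
    proof (rule runs_For[where T = 2 and N = n and I = "\<lambda>u. ?B (?R u)"])
      fix u s'' assume **: "u < n" "?B (?R u) s''" "nmem s'' ''u'' 0 = u" "agree ?L s' s''"
      have R: "?R (Suc u) = insert (u, k) (?R u)" by (auto simp: less_Suc_eq)
      have k'': "nmem s'' ''k'' 0 = k" using *(3) agree_nmem[OF **(4), of "''k''"] by simp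
      have pt: "nmem s'' ''ptr'' = nmem s ''ptr''" "nmem s'' ''cur'' 0 = i"
        using agree_nmem[OF *(4)] agree_nmem[OF **(4)] cur by simp_all
      have "rows n s''"
        by (rule rows_agree[OF rows_agree[OF rows *(4)] **(4)]) simp_all
      then have cand: "nval candidate s'' = slot n i u k"
        unfolding candidate_def using **(1,3) k'' pt cur by (subst nval_slot_exp) auto
      have kn: "k < n" using *(1) by simp
      show "runs ?c s'' 2 (\<lambda>s'''. agree ?c s'' s''' \<longrightarrow> ?B (?R (Suc u)) (nset ''u'' 0 (Suc u) s'''))"
      proof (rule runs_Cond[where T = 1])
        assume "bval (NLess (NConst 0) (NGet ''ptr'' candidate)) s''"
        then have "present s i u k" using cand pt kn **(1) by simp
        then have "?B (?R (Suc u)) (nset ''u'' 0 (Suc u) (nset ''sel'' 0 (slot n i u k) s''))"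
          unfolding best_def R candidates_insert by (auto simp: candidates_def)
        then show "runs (nlet ''sel'' candidate) s'' 1
            (\<lambda>s'''. agree ?c s'' s''' \<longrightarrow> ?B (?R (Suc u)) (nset ''u'' 0 (Suc u) s'''))"
          using cand by (intro runs_NSet) simp_all
      next
        assume "\<not> bval (NLess (NConst 0) (NGet ''ptr'' candidate)) s''"
        then have np: "\<not> present s i u k" using cand pt by simp
        have "?B (?R (Suc u)) (nset ''u'' 0 (Suc u) s'')"
          using **(2) unfolding R candidates_insert if_not_P[OF np] by (simp add: best_def)
        then show "runs Skip s'' 1
            (\<lambda>s'''. agree ?c s'' s''' \<longrightarrow> ?B (?R (Suc u)) (nset ''u'' 0 (Suc u) s'''))"
          by (intro runs_Skip) simp
      qed simp
    next
      show "n * (2 + 2) + 2 \<le> 6 * n ^ 1" using n_pos by simp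
    next
      show "?B (?R 0) (nset ''u'' 0 0 s')" using *(2) by (simp add: best_def)
    next
      fix s'' assume "agree ?L s' s''"
      then show "nval (nvar ''n'') s'' = n"
        using agree_nmem[OF *(4), of "''n''"] agree_nmem[of ?L s' s'' "''n''"] g
        by (simp add: given_def)
    qed simp_all
    moreover have "?R n = {..<n} \<times> {..<Suc k}" by (auto simp: less_Suc_eq)
    ultimately have "runs ?L s' (6 * n ^ 1) (?B ({..<n} \<times> {..<Suc k}))" by simp
    then show "runs ?L s' (6 * n ^ 1)
        (\<lambda>s''. agree ?L s' s'' \<longrightarrow> ?B ({..<n} \<times> {..<Suc k}) (nset ''k'' 0 (Suc k) s''))"
      by (rule runs_mono) (simp_all add: best_def)
  next
    show "(n - 1) * (6 * n ^ 1 + 2) + 2 \<le> 10 * n ^ 2"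
      using loop_time[of n "n - 1" 6 1] n_pos by (simp add: power2_eq_square)
  next
    fix s' assume "agree (For ''k'' ?b ?L) s s'"
    from agree_nmem[OF this, of "''n''"] show "nval ?b s' = n - 1" using g by (simp add: given_def)
  qed (simp_all add: best_def candidates_def sel)
qed

lemma indices_unfold:
  assumes "descending s" "0 < x"
  shows "indices s x = indices s (nmem s ''nl'' x) \<union> indices s (nmem s ''nr'' x) \<union>
    (if nmem s ''ne'' x = 0 then {} else {nmem s ''ne'' x - 1})"
  unfolding indices_def by (subst dag.simps) (use assms in \<open>simp add: descending_def\<close>)

lemma indices_0: "descending s \<Longrightarrow> indices s 0 = {}"
  by (simp add: indices_def descending_def)

lemma indices_less: "descending s \<Longrightarrow> i \<in> indices s x \<Longrightarrow> i < length es"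
proof (induction x rule: less_induct)
  case (less x)
  show ?case
  proof (cases "x = 0")
    case False
    then have "nmem s ''nl'' x < x" "nmem s ''nr'' x < x" "nmem s ''ne'' x \<le> length es"
      using less.prems by (auto simp: descending_def)
    then show ?thesis
      using less indices_unfold[of s x] False by (auto split: if_splits)
  qed (use less indices_0 in auto)
qed

lemma runs_read_off:
  assumes g: "given s" and rows: "rows n s" and desc: "descending s"
    and sel: "nmem s ''sel'' 0 < 2 * n * n * n"
    and z: "\<And>x. nmem s ''mark'' x = 0" "\<And>x. nmem s ''out'' x = 0"
  shows "runs read_off s (20 * n ^ 3)
    (\<lambda>s'. \<forall>i. 0 < nmem s' ''out'' i \<longleftrightarrow> i \<in> indices s (nmem s ''sel'' 0))"
proof -
  let ?M = "2 * n * n * n" let ?sel = "nmem s ''sel'' 0"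
  let ?c = "Seq (nlet ''q'' (NMinus (NMinus (nvar ''m'') (NConst 1)) (nvar ''j''))) visit"
  let ?L = "For ''j'' (nvar ''m'') ?c"
  let ?s1 = "nset ''m'' 0 ?M s" let ?s2 = "nset ''mark'' ?sel 1 ?s1"
  have m: "nmem s ''row'' (nmem s ''row'' (n + n)) = ?M"
  proof -
    have "n + n \<le> 2 * n * n" using n_pos by (cases n) auto
    then have "nmem s ''row'' (n + n) = 2 * n * n"
      using rows by (simp add: rows_def algebra_simps)
    then show ?thesis using rows by (simp add: rows_def)
  qed
  \<comment> \<open>What has been output, together with the solutions of the marked nodes still
    ahead of the sweep, is the wanted set throughout.\<close>
  define I where "I = (\<lambda>k (s' :: state). {i. 0 < nmem s' ''out'' i} \<union>
    (\<Union>y\<in>{y. y < ?M - k \<and> 0 < nmem s' ''mark'' y}. indices s y) = indices s ?sel)"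
  have loop: "runs ?L ?s2 (?M * (6 + 2) + 2)
      (\<lambda>s'. \<forall>i. 0 < nmem s' ''out'' i \<longleftrightarrow> i \<in> indices s ?sel)"
  proof (rule runs_For[where T = 6 and N = ?M and I = I])
    show "I 0 (nset ''j'' 0 0 ?s2)" using z sel by (auto simp: I_def split: if_splits)
  next
    fix k s' assume *: "k < ?M" "I k s'" "nmem s' ''j'' 0 = k" "agree ?L ?s2 s'"
    define q where "q = ?M - 1 - k"
    have q: "?M - k = Suc q" "?M - Suc k = q" using *(1) by (auto simp: q_def)
    let ?sq = "nset ''q'' 0 q s'"
    have mem: "nmem s' ''m'' 0 = ?M" "nmem s' ''nl'' = nmem s ''nl''" "nmem s' ''nr'' = nmem s ''nr''"
      "nmem s' ''ne'' = nmem s ''ne''"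
      using agree_nmem[OF *(4)] by (simp_all add: visit_def)
    have I: "{i. 0 < nmem s' ''out'' i} \<union>
        (\<Union>y\<in>{y. y < Suc q \<and> 0 < nmem s' ''mark'' y}. indices s y) = indices s ?sel"
      using *(2) by (simp add: I_def q)
    let ?nl = "nmem s ''nl'' q" let ?nr = "nmem s ''nr'' q" let ?ne = "nmem s ''ne'' q"
    have "runs visit ?sq 5 (I (Suc k))"
      unfolding visit_def
    proof (rule runs_Cond[where T = 4])
      assume "bval (NLess (NConst 0) (NGet ''mark'' (nvar ''q''))) ?sq"
      then have mark: "0 < nmem s' ''mark'' q" by simp
      let ?mk = "((nmem s' ''mark'')(?nl := 1))(?nr := 1)"
      let ?s3 = "nset ''mark'' ?nr 1 (nset ''mark'' ?nl 1 ?sq)"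
      \<comment> \<open>Node \<open>q\<close> gives way to its two successors and its own edge. At
        \<open>q = 0\<close> the successors are \<open>q\<close> itself, but its solution is
        empty.\<close>
      have U: "(\<Union>y\<in>{y. y < Suc q \<and> 0 < nmem s' ''mark'' y}. indices s y) =
          (if ?ne = 0 then {} else {?ne - 1}) \<union> (\<Union>y\<in>{y. y < q \<and> 0 < ?mk y}. indices s y)"
      proof (cases "q = 0")
        case True
        then have "?ne = 0" using desc by (simp add: descending_def)
        then show ?thesis using True indices_0[OF desc] by auto
      next
        case False
        then have lt: "?nl < q" "?nr < q" using desc by (auto simp: descending_def)
        have "{y. y < Suc q \<and> 0 < nmem s' ''mark'' y} = insert q {y. y < q \<and> 0 < nmem s' ''mark'' y}"
          using mark by (auto simp: less_Suc_eq)
        moreover have "{y. y < q \<and> 0 < ?mk y} = {?nl, ?nr} \<union> {y. y < q \<and> 0 < nmem s' ''mark'' y}"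
          using lt by auto
        ultimately show ?thesis using indices_unfold[OF desc, of q] False by auto
      qed
      have res: "I (Suc k) (if ?ne = 0 then ?s3 else nset ''out'' (?ne - 1) 1 ?s3)"
        unfolding I_def q using I unfolding U by (auto split: if_splits)
      show "runs (Seq (NSet ''mark'' (NGet ''nl'' (nvar ''q'')) (NConst 1))
         (Seq (NSet ''mark'' (NGet ''nr'' (nvar ''q'')) (NConst 1))
           (Cond (NLess (NConst 0) (NGet ''ne'' (nvar ''q'')))
             (NSet ''out'' (NMinus (NGet ''ne'' (nvar ''q'')) (NConst 1)) (NConst 1)) Skip)))
         ?sq 4 (I (Suc k))"
        by (rule runs_NSet_Seq[where ?T2.0 = 3], rule runs_NSet_Seq[where ?T2.0 = 2],
            rule runs_Cond[where T = 1], rule runs_NSet, simp_all)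
          (use res mem in \<open>auto intro!: runs_Skip\<close>)
    next
      assume "\<not> bval (NLess (NConst 0) (NGet ''mark'' (nvar ''q''))) ?sq"
      then have "\<not> 0 < nmem s' ''mark'' q" by simp
      then have "{y. y < Suc q \<and> 0 < nmem s' ''mark'' y} = {y. y < q \<and> 0 < nmem s' ''mark'' y}"
        by (auto simp: less_Suc_eq)
      then have "I (Suc k) ?sq" using I by (simp add: I_def q)
      then show "runs Skip ?sq 4 (I (Suc k))" by (rule runs_Skip)
    qed simp
    then have V: "runs visit ?sq 5 (\<lambda>s''. agree ?c s' s'' \<longrightarrow> I (Suc k) (nset ''j'' 0 (Suc k) s''))"
      by (rule runs_mono) (simp_all add: I_def)
    show "runs ?c s' 6 (\<lambda>s''. agree ?c s' s'' \<longrightarrow> I (Suc k) (nset ''j'' 0 (Suc k) s''))"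
      by (rule runs_Seq[where ?T1.0 = 1 and ?T2.0 = 5], rule runs_NSet)
        (use V mem(1) *(3) in \<open>simp_all add: q_def\<close>)
  next
    fix s' assume "agree ?L ?s2 s'"
    from agree_nmem[OF this, of "''m''"] show "nval (nvar ''m'') s' = ?M" by (simp add: visit_def)
  next
    fix s' assume "I ?M s'"
    then show "\<forall>i. 0 < nmem s' ''out'' i \<longleftrightarrow> i \<in> indices s ?sel" by (auto simp: I_def)
  qed (simp_all add: visit_def)
  have "1 + (1 + (?M * (6 + 2) + 2)) \<le> 20 * n ^ 3"
  proof -
    have "1 \<le> n * n * n" using n_pos by simp
    then show ?thesis by (simp add: power3_eq_cube)
  qed
  then show ?thesis
    unfolding read_off_def
    by - (rule runs_NSet_Seq[where ?T2.0 = "1 + (?M * (6 + 2) + 2)"],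
      rule runs_NSet_Seq[where ?T2.0 = "?M * (6 + 2) + 2"],
      use loop m g in \<open>simp_all add: given_def\<close>)
qed

end

lemma nwrites_init_rows: "nwrites init_rows = {''i'', ''row'', ''m''}"
  and rwrites_init_rows: "rwrites init_rows = {}"
  and nwrites_sum_lengths: "nwrites sum_lengths = {''i''}"
  and rwrites_sum_lengths: "rwrites sum_lengths = {''lsum''}"
  and nwrites_grow: "nwrites grow = {''i'', ''j'', ''vis'', ''op'', ''oc'', ''oe''}"
  and rwrites_grow: "rwrites grow = {}"
  and nwrites_init_leaves: "nwrites init_leaves = {''i'', ''cur'', ''ptr''}"
  and rwrites_init_leaves: "rwrites init_leaves = {''bv''}"
  and nwrites_select: "nwrites select = {''k'', ''u'', ''sel''}"
  and rwrites_select: "rwrites select = {}"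
  and nwrites_merge_all: "nwrites merge_all = {''j'', ''cur''} \<union> nwrites prepare_merge \<union> nwrites merge_loop"
  and rwrites_merge_all: "rwrites merge_all = rwrites merge_loop"
  by (auto simp: init_rows_def add_row_def sum_lengths_def grow_def find_crossing_def record_edge_def
      init_leaves_def select_def merge_all_def prepare_merge_def)

lemmas writes = nwrites_init_rows rwrites_init_rows nwrites_sum_lengths rwrites_sum_lengths
  nwrites_grow rwrites_grow nwrites_init_leaves rwrites_init_leaves nwrites_select rwrites_select
  nwrites_merge_all rwrites_merge_all nwrites_merge_loop rwrites_merge_loop

section \<open>The program as a whole\<close>

context contraction_instance
begin

abbreviation "feasible \<equiv> weak_contraction {..<n} E l (\<lambda>x. x / \<alpha> - \<beta>)"
abbreviation "optimal \<equiv> optimal_weak_contraction {..<n} E l (\<lambda>x. x / \<alpha> - \<beta>)"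

text \<open>Every feasible \<open>C\<close> has a candidate with the same number of edges, so the
  largest count bounds them all; the set behind it has fewer than \<open>n - 1\<close> edges and is
  thus proper.\<close>

lemma optimal_output:
  assumes wf: "wf_btree t" "verts t = {..<n}" "edges t = E"
    and T: "table_at s i t" and desc: "descending s"
    and best: "best (candidates s i ({..<n} \<times> {..<n - 1})) i s'"
    and out: "\<forall>j. 0 < nmem s'' ''out'' j \<longleftrightarrow> j \<in> indices s (nmem s' ''sel'' 0)"
    and ex: "feasible C0"
  shows "optimal (output_edges es s'')"
proof -
  have weak: "feasible C \<longleftrightarrow> C \<subseteq> E \<and> C \<noteq> E \<and> valid C t" for C
    using weak_contraction_iff_valid[OF wf(1), of C] wf pos by simp
  have value_eq: "contraction_value {..<n} E C = int (card C)" if "C \<subseteq> E" for C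
    using contraction_value_tree[OF wf(1), of C] wf that by simp
  note T' = T[unfolded table_at_def]
  have cand: "\<exists>u. (u, card C) \<in> candidates s i ({..<n} \<times> {..<n - 1})"
    if C: "feasible C" for C
  proof -
    have C': "C \<subseteq> E" "C \<noteq> E" "valid C t" using C weak by auto
    then obtain u where u: "present s i u (card C)" using table_complete[OF T', of C] wf by auto
    have "card C < n - 1" using psubset_card_mono[OF finite_E, of C] C' card_tree[OF tree] by auto
    with u show ?thesis by (auto simp: candidates_def)
  qed
  then have "candidates s i ({..<n} \<times> {..<n - 1}) \<noteq> {}" using ex by blast
  then obtain u k where uk: "(u, k) \<in> candidates s i ({..<n} \<times> {..<n - 1})"
    "nmem s' ''sel'' 0 = slot n i u k"
    "\<forall>(u', k')\<in>candidates s i ({..<n} \<times> {..<n - 1}). k' \<le> k"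
    using best unfolding best_def by auto
  let ?S = "solution_at s i u k"
  have p: "present s i u k" "k < n - 1" using uk(1) by (auto simp: candidates_def)
  note S = table_sound[OF T' p(1)]
  have "output_edges es s'' = ?S"
    using out indices_less[OF desc] unfolding output_edges_def solution_def uk(2) by auto
  moreover have "?S \<noteq> E" using S(4) p(2) card_tree[OF tree] by auto
  then have "feasible ?S" using weak S wf(3) by simp
  moreover have "contraction_value {..<n} E C \<le> contraction_value {..<n} E ?S"
    if C: "feasible C" for C
    using cand[OF C] uk(3) value_eq[of C] value_eq[of ?S] C weak S(3,4) wf(3) by auto
  ultimately show ?thesis by (simp add: optimal_weak_contraction_def)
qed

text \<open>The phases cost at most 17, 5, 17, 7, 71, 10 and 20 times \<open>n ^ 5\<close>, well
  within 200. The premise in the conclusion is there for the single vertex, which has no weak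
  contraction since its empty edge set is already connected.\<close>

lemma runs_contraction_program:
  "runs contraction_program (input_state n es l \<alpha> \<beta>) (200 * n ^ 5)
     (\<lambda>s. (\<exists>C. feasible C) \<longrightarrow> optimal (output_edges es s))"
    (is "runs _ ?s0 _ ?Q")
proof -
  have g0: "given ?s0" by (simp add: given_def input_state_def)
  have zero_n: "nmem ?s0 a = (\<lambda>_. 0)" if "a \<notin> {''n'', ''src'', ''dst''}" for a
    using that by (simp add: input_state_def)
  have zero_r: "rmem ?s0 a = (\<lambda>_. 0)" if "a \<notin> {''len'', ''alpha'', ''beta''}" for a
    using that by (simp add: input_state_def)
  have n0: "nmem ?s0 ''n'' 0 = n" using g0 by (simp add: given_def)
  have p: "c * n ^ i \<le> c * n ^ 5" if "i \<le> 5" for c i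
    using power_increasing[OF that n_pos] by simp
  have t: "17 * n ^ 2 \<le> 17 * n ^ 5" "5 * n \<le> 5 * n ^ 5" "7 * n \<le> 7 * n ^ 5" "10 * n ^ 2 \<le> 10 * n ^ 5"
    "20 * n ^ 3 \<le> 20 * n ^ 5"
    using p[of 2 17] p[of 1 5] p[of 1 7] p[of 2 10] p[of 3 20] by simp_all
  show ?thesis
    unfolding contraction_program_def
  proof (rule runs_Seq[where ?T2.0 = "183 * n ^ 5", OF runs_mono[OF runs_init_rows[OF n0 _ n_pos] t(1)]],
      simp add: zero_n, rule impI)
    fix s1 assume s1: "rows n s1" "agree init_rows ?s0 s1"
    have g1: "given s1" by (rule given_agree[OF g0 s1(2)]) (simp_all add: writes)
    have z1: "rmem s1 ''lsum'' 0 = 0" using zero_r by (simp add: agree_rmem[OF s1(2)] writes)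
    show "runs (Seq sum_lengths (Seq grow (Seq init_leaves (Seq merge_all (Seq select read_off))))) s1
        (183 * n ^ 5) ?Q"
    proof (rule runs_Seq[where ?T2.0 = "178 * n ^ 5", OF runs_mono[OF runs_sum_lengths[OF g1 z1] t(2)]],
        rule impI)
      fix s2 assume s2: "rmem s2 ''lsum'' 0 = sum l E" "agree sum_lengths s1 s2"
      have g2: "given s2" by (rule given_agree[OF g1 s2(2)]) (simp_all add: writes)
      have z2: "nmem s2 ''vis'' v = 0" for v
        using zero_n by (simp add: agree_nmem[OF s1(2)] agree_nmem[OF s2(2)] writes)
      show "runs (Seq grow (Seq init_leaves (Seq merge_all (Seq select read_off)))) s2 (178 * n ^ 5) ?Q"
      proof (rule runs_Seq[where ?T2.0 = "161 * n ^ 5", OF runs_mono[OF runs_grow[OF g2 z2] t(1)]],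
          rule impI)
        fix s3 assume s3: "order s3 (n - 1)" "agree grow s2 s3"
        have g3: "given s3" by (rule given_agree[OF g2 s3(2)]) (simp_all add: writes)
        have "rows n s2" by (rule rows_agree[OF s1(1) s2(2)]) (simp add: writes)
        then have r3: "rows n s3" by (rule rows_agree[OF _ s3(2)]) (simp add: writes)
        have l3: "rmem s3 ''lsum'' 0 = sum l E" using s2(1) by (simp add: agree_rmem[OF s3(2)] writes)
        have n3: "nmem s3 a = nmem ?s0 a"
          if "a \<notin> {''i'', ''row'', ''m'', ''j'', ''vis'', ''op'', ''oc'', ''oe''}" for a
          using that by (simp add: agree_nmem[OF s1(2)] agree_nmem[OF s2(2)] agree_nmem[OF s3(2)] writes)
        have r3z: "rmem s3 a = rmem ?s0 a" if "a \<noteq> ''lsum''" for a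
          using that by (simp add: agree_rmem[OF s1(2)] agree_rmem[OF s2(2)] agree_rmem[OF s3(2)] writes)
        have z3: "nmem s3 ''ptr'' x = 0" for x using zero_n n3 by simp
        show "runs (Seq init_leaves (Seq merge_all (Seq select read_off))) s3 (161 * n ^ 5) ?Q"
        proof (rule runs_Seq[where ?T2.0 = "154 * n ^ 5",
              OF runs_mono[OF runs_init_leaves[OF g3 r3 l3 z3] t(3)]], rule impI)
          fix s4 assume s4: "(\<forall>i<n. nmem s4 ''cur'' i = i) \<and>
              (\<forall>x. 0 < nmem s4 ''ptr'' x \<longleftrightarrow> (\<exists>i<n. x = slot n i i 0)) \<and>
              (\<forall>i<n. rmem s4 ''bv'' (slot n i i 0) = - sum l E)" "agree init_leaves s3 s4"
          have g4: "given s4" by (rule given_agree[OF g3 s4(2)]) (simp_all add: writes)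
          have r4: "rows n s4" by (rule rows_agree[OF r3 s4(2)]) (simp add: writes)
          have o4: "order s4 (n - 1)"
            using s3(1) recorded_cong[of _ s3 s4]
            by (simp add: order_def agree_nmem[OF s4(2)] writes)
          have n4: "nmem s4 a x = 0" if "a \<in> {''nl'', ''nr'', ''ne'', ''sel'', ''mark'', ''out''}" for a x
          proof -
            have "a \<notin> nwrites init_leaves" "a \<notin> {''n'', ''src'', ''dst''}"
              "a \<notin> {''i'', ''row'', ''m'', ''j'', ''vis'', ''op'', ''oc'', ''oe''}"
              using that by (auto simp: writes)
            then show ?thesis using agree_nmem[OF s4(2), of a] n3[of a] zero_n[of a] by simp
          qed
          have a4: "rmem s4 ''av'' x = 0" for x
            using zero_r r3z by (simp add: agree_rmem[OF s4(2)] writes)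
          have V: "visited (nmem s4 ''oc'') (n - 1) = {..<n}"
            using visited_all[OF _ order_grown[OF o4]] n_pos by simp
          have M4: "merged_upto s4 0 s4"
          proof -
            have "table_at s4 v (Leaf v)" if "v < n" for v
              using that s4(1) a4 n4 by (intro table_at_leaf) auto
            moreover have "nmem s4 ''ptr'' x = 0" if "slot n n 0 0 \<le> x" for x
            proof (rule ccontr)
              assume "nmem s4 ''ptr'' x \<noteq> 0"
              then obtain i where "i < n" "x = slot n i i 0" using s4(1) by auto
              then show False using that slot_less[of i n i n 0] n_pos by simp
            qed
            moreover have "0 < slot n n 0 0" using n_pos by (simp add: slot_def)
            ultimately show ?thesis
              using s4(1) n4 V by (simp add: merged_upto_def lower_def descending_def)
          qed
          show "runs (Seq merge_all (Seq select read_off)) s4 (154 * n ^ 5) ?Q"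
          proof (rule runs_Seq[where ?T2.0 = "30 * n ^ 5",
                OF runs_mono[OF runs_merge_all[OF g4 r4 o4 M4] order.refl]], rule impI)
            fix s5 assume s5: "merged_upto s4 (n - 1) s5" "agree merge_all s4 s5"
            have g5: "given s5" by (rule given_agree[OF g4 s5(2)]) (simp_all add: writes prepare_merge_def)
            have r5: "rows n s5" by (rule rows_agree[OF r4 s5(2)]) (simp add: writes prepare_merge_def)
            have n5: "nmem s5 a x = 0" if "a \<in> {''sel'', ''mark'', ''out''}" for a x
            proof -
              have "a \<notin> nwrites merge_all" "a \<in> {''nl'', ''nr'', ''ne'', ''sel'', ''mark'', ''out''}"
                using that by (auto simp: writes prepare_merge_def)
              then show ?thesis using agree_nmem[OF s5(2), of a] n4[of a] by simp
            qed
            let ?i = "nmem s5 ''cur'' 0"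
            let ?t = "forest (nmem s4 ''op'') (nmem s4 ''oc'') (n - 1) (n - 1) 0"
            have i: "?i < 2 * n" and T: "table_at s5 ?i ?t" and desc: "descending s5"
              using s5(1) n_pos by (auto simp: merged_upto_def)
            note wf = grown_tree[OF tree order_grown[OF o4]]
            show "runs (Seq select read_off) s5 (30 * n ^ 5) ?Q"
            proof (rule runs_Seq[where ?T2.0 = "20 * n ^ 5",
                  OF runs_mono[OF runs_select[OF g5 r5 refl i] t(4)]], simp add: n5, rule impI)
              fix s6 assume s6: "best (candidates s5 ?i ({..<n} \<times> {..<n - 1})) ?i s6" "agree select s5 s6"
              have g6: "given s6" by (rule given_agree[OF g5 s6(2)]) (simp_all add: writes)
              have r6: "rows n s6" by (rule rows_agree[OF r5 s6(2)]) (simp add: writes)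
              have d6: "descending s6" using desc
                by (simp add: descending_def agree_nmem[OF s6(2)] writes)
              have ind: "indices s6 = indices s5"
                by (simp add: indices_def fun_eq_iff agree_nmem[OF s6(2)] writes)
              have sel: "nmem s6 ''sel'' 0 < 2 * n * n * n"
              proof (cases "candidates s5 ?i ({..<n} \<times> {..<n - 1}) = {}")
                case True
                then show ?thesis using s6(1) n_pos by (simp add: best_def)
              next
                case False
                then obtain u k where "u < n" "k < n" "nmem s6 ''sel'' 0 = slot n ?i u k"
                  using s6(1) by (auto simp: best_def candidates_def)
                then show ?thesis using slot_less[OF i] by (simp add: slot_def)
              qed
              have z6: "nmem s6 ''mark'' x = 0" "nmem s6 ''out'' x = 0" for x
                using n5 by (simp_all add: agree_nmem[OF s6(2)] writes)
              show "runs read_off s6 (20 * n ^ 5) ?Q"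
              proof (rule runs_mono[OF runs_read_off[OF g6 r6 d6 sel z6] t(5)], intro impI, elim exE)
                fix s7 :: state and C assume "\<forall>i. 0 < nmem s7 ''out'' i \<longleftrightarrow> i \<in> indices s6 (nmem s6 ''sel'' 0)"
                  "feasible C"
                then show "optimal (output_edges es s7)"
                  using optimal_output[OF wf T desc s6(1)] ind by simp
              qed
            qed simp
          qed simp
        qed simp
      qed simp
    qed simp
  qed simp
qed

end

theorem theorem9:
  shows "\<exists>(prog :: com) (time :: nat \<Rightarrow> nat).
    (\<lambda>n. real (time n)) \<in> O(\<lambda>n. real n ^ 5) \<and>
    (\<forall>(n :: nat) (E :: nat set set) (l :: nat set \<Rightarrow> real) (\<alpha> :: real) (\<beta> :: real)
       (es :: (nat \<times> nat) list).
       tree {..<n} E \<longrightarrow> (\<forall>e\<in>E. l e > 0) \<longrightarrow> \<alpha> \<ge> 1 \<longrightarrow> \<beta> \<ge> 0 \<longrightarrow> edge_list es E \<longrightarrow>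
       (\<exists>t s. exec prog (input_state n es l \<alpha> \<beta>) t s \<and> t \<le> time n \<and>
          ((\<exists>C. weak_contraction {..<n} E l (\<lambda>x. x / \<alpha> - \<beta>) C) \<longrightarrow>
           optimal_weak_contraction {..<n} E l (\<lambda>x. x / \<alpha> - \<beta>) (output_edges es s))))"
proof (intro exI[of _ contraction_program] exI[of _ "\<lambda>n. 200 * n ^ 5"] conjI allI impI)
  show "(\<lambda>n. real (200 * n ^ 5)) \<in> O(\<lambda>n. real n ^ 5)"
    by (rule landau_o.bigI[where c = 200]) auto
next
  fix n :: nat and E :: "nat set set" and l :: "nat set \<Rightarrow> real" and \<alpha> \<beta> :: real
    and es :: "(nat \<times> nat) list"
  assume "tree {..<n} E" "\<forall>e\<in>E. l e > 0" "\<alpha> \<ge> 1" "\<beta> \<ge> 0" "edge_list es E"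
  then interpret contraction_instance n E l \<alpha> \<beta> es by unfold_locales
  show "\<exists>t s. exec contraction_program (input_state n es l \<alpha> \<beta>) t s \<and> t \<le> 200 * n ^ 5 \<and>
      ((\<exists>C. weak_contraction {..<n} E l (\<lambda>x. x / \<alpha> - \<beta>) C) \<longrightarrow>
       optimal_weak_contraction {..<n} E l (\<lambda>x. x / \<alpha> - \<beta>) (output_edges es s))"
    using runs_contraction_program unfolding runs_def .
qed

end
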